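(* Let $m\in\{3,4,5\}$ and let $\Gamma=\langle a,b\mid a^2=b^3=(ab)^m=e\rangle$ (the tetrahedral group for $m=3$, the octahedral group for $m=4$, the icosahedral group for $m=5$), so that $o(a)=2$ and $o(b)=3$, with symmetric generating set $S=\{a,b,b^{-1}\}$. Let $\theta$ be the automorphism defined by $\theta(a)=a$, $\theta(b)=b^{-1}$. Then $\mathbb Q(\Gamma,S)\cong\mathcal D_\theta(C^*(\Gamma),\Delta_\Gamma)$ as compact quantum groups.
   Context: A compact quantum group (CQG) is a unital $C^*$-algebra $\mathcal Q$ with a coassociative unital $*$-homomorphism $\Delta:\mathcal Q\to\mathcal Q\hat\otimes\mathcal Q$ ($\hat\otimes$ the spatial tensor product) such that the linear spans of $\Delta(\mathcal Q)(1\otimes\mathcal Q)$ and $\Delta(\mathcal Q)(\mathcal Q\otimes 1)$ are norm-dense. A CQG morphism is a unital $*$-homomorphism intertwining the coproducts. An action of $\mathcal Q$ on a unital $C^*$-algebra $B$ is a unital $*$-homomorphism $\alpha:B\to B\hat\otimes\mathcal Q$ with $(\alpha\otimes id)\alpha=(id\otimes\Delta)\alpha$ and with the linear span of $\alpha(B)(1\otimes\mathcal Q)$ dense in $B\hat\otimes\mathcal Q$. Let $\Gamma$ be a discrete group with finite symmetric generating set $S$ ($a\in S\Rightarrow a^{-1}\in S$, elements of order 2 listed once), with word length $l$, canonical unitaries $\lambda_g\in C^*_r(\Gamma)$ and canonical trace $\tau$. $\mathbb Q(\Gamma,S)$ denotes the quantum isometry group $QISO^+(\mathbb C\Gamma,\ell^2(\Gamma),D_\Gamma)$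 of the spectral triple with $D_\Gamma\delta_g=l(g)\delta_g$. Equivalently it is the universal object in the category of pairs $(\mathcal Q,\alpha)$ where $\mathcal Q$ is a CQG and $\alpha$ is a $\tau$-preserving action of $\mathcal Q$ on $C^*_r(\Gamma)$ mapping $\mathrm{span}\{\lambda_g:l(g)=r\}$ into $\mathrm{span}\{\lambda_g:l(g)=r\}\otimes\mathcal Q$ for every $r\ge0$ (morphisms are CQG morphisms intertwining the actions; universality means that for every object there is a unique morphism from $\mathbb Q(\Gamma,S)$ to it). $(C^*(\Gamma),\Delta_\Gamma)$ is the full group $C^*$-algebra with $\Delta_\Gamma(\lambda_g)=\lambda_g\otimes\lambda_g$; a group automorphism of $\Gamma$ induces a CQG automorphism of it, denoted by the same symbol. Doubling: for a CQG $(\mathcal Q,\Delta)$ with CQG automorphism $\theta$, $\theta^2=id$, the doubling $\mathcal D_\theta(\mathcal Q,\Delta)$ is the $C^*$-algebra $\mathcal Q\oplus\mathcal Q$ with coproduct $\tilde\Delta$ determined by $\tilde\Delta\circ\xi=(\xi\otimes\xi+\eta\otimes[\eta\circ\theta])\circ\Delta$ and $\tilde\Delta\circ\eta=(\xi\otimes\eta+\eta\otimes[\xi\circ\theta])\circ\Delta$, where $\xi(a)=(a,0)$ and $\eta(a)=(0,a)$. *)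

theory Defs
  imports Complex_Main "HOL-Library.Function_Algebras" "HOL-Analysis.L2_Norm"
    "HOL-Analysis.Infinite_Sum" "HOL-Algebra.Group"
begin

section \<open>Bounded operators on $\ell^2$\<close>

text \<open>
  A bounded operator on the Hilbert space $\ell^2(I)$, where the index set \<open>I\<close> is (the universe of)
  a type, is identified with its matrix with respect to the standard orthonormal basis.
\<close>

type_synonym 'i opr = "'i \<Rightarrow> 'i \<Rightarrow> complex"

definition op_scale :: "complex \<Rightarrow> 'i opr \<Rightarrow> 'i opr"
  where "op_scale c M = (\<lambda>i j. c * M i j)"

global_interpretation op: vector_space "op_scale :: complex \<Rightarrow> 'i opr \<Rightarrow> 'i opr"
  defines op_span = op.span and op_subspace = op.subspace
  by unfold_locales (auto simp: op_scale_def fun_eq_iff algebra_simps)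

definition op_bound :: "'i opr \<Rightarrow> real \<Rightarrow> bool"
  where "op_bound M C \<longleftrightarrow> 0 \<le> C \<and>
    (\<forall>F x y. finite F \<longrightarrow>
      cmod (\<Sum>i\<in>F. \<Sum>j\<in>F. cnj (y i) * M i j * x j)
        \<le> C * L2_set (\<lambda>i. cmod (x i)) F * L2_set (\<lambda>i. cmod (y i)) F)"

definition bounded_op :: "'i opr \<Rightarrow> bool"
  where "bounded_op M \<longleftrightarrow> (\<exists>C. op_bound M C)"

definition op_norm :: "'i opr \<Rightarrow> real"
  where "op_norm M = Inf {C. op_bound M C}"

definition op_id :: "'i opr"
  where "op_id = (\<lambda>i j. if i = j then 1 else 0)"

definition op_mult :: "'i opr \<Rightarrow> 'i opr \<Rightarrow> 'i opr"  (infixl \<open>\<star>\<close> 70)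
  where "M \<star> N = (\<lambda>i k. \<Sum>\<^sub>\<infinity>j. M i j * N j k)"

definition op_adj :: "'i opr \<Rightarrow> 'i opr"
  where "op_adj M = (\<lambda>i j. cnj (M j i))"

definition op_closure :: "'i opr set \<Rightarrow> 'i opr set"
  where "op_closure X = {M. bounded_op M \<and> (\<forall>\<epsilon>>0. \<exists>N\<in>X. op_norm (M - N) < \<epsilon>)}"


section \<open>Unital C*-algebras and their spatial tensor product\<close>

text \<open>
  By the Gelfand--Naimark theorem every C*-algebra is, up to isomorphism, a norm-closed
  *-subalgebra of the bounded operators on some $\ell^2(I)$. The unit of the algebra may be a
  projection other than the identity operator. Homomorphisms below are arbitrary
  *-homomorphisms; they are not required to be compatible with the representing Hilbert spaces.
\<close>

definition is_op_unit :: "'i opr set \<Rightarrow> 'i opr \<Rightarrow> bool"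
  where "is_op_unit A e \<longleftrightarrow> e \<in> A \<and> (\<forall>x\<in>A. e \<star> x = x \<and> x \<star> e = x)"

definition unit_of :: "'i opr set \<Rightarrow> 'i opr"
  where "unit_of A = (THE e. is_op_unit A e)"

definition unital_cstar_algebra :: "'i opr set \<Rightarrow> bool"
  where "unital_cstar_algebra A \<longleftrightarrow>
    (\<forall>x\<in>A. bounded_op x) \<and> op_subspace A \<and>
    (\<forall>x\<in>A. \<forall>y\<in>A. x \<star> y \<in> A) \<and> (\<forall>x\<in>A. op_adj x \<in> A) \<and>
    op_closure A = A \<and> (\<exists>e. is_op_unit A e)"

definition unital_star_hom :: "'i opr set \<Rightarrow> 'j opr set \<Rightarrow> ('i opr \<Rightarrow> 'j opr) \<Rightarrow> bool"
  where "unital_star_hom A B f \<longleftrightarrow>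
    (\<forall>x\<in>A. f x \<in> B) \<and>
    (\<forall>x\<in>A. \<forall>y\<in>A. f (x + y) = f x + f y) \<and>
    (\<forall>c. \<forall>x\<in>A. f (op_scale c x) = op_scale c (f x)) \<and>
    (\<forall>x\<in>A. \<forall>y\<in>A. f (x \<star> y) = f x \<star> f y) \<and>
    (\<forall>x\<in>A. f (op_adj x) = op_adj (f x)) \<and>
    f (unit_of A) = unit_of B"

definition tensor :: "'i opr \<Rightarrow> 'j opr \<Rightarrow> ('i \<times> 'j) opr"  (infixr \<open>\<boxtimes>\<close> 75)
  where "M \<boxtimes> N = (\<lambda>(i, j) (i', j'). M i i' * N j j')"

definition alg_tensor :: "'i opr set \<Rightarrow> 'j opr set \<Rightarrow> ('i \<times> 'j) opr set"
  where "alg_tensor A B = op_span {a \<boxtimes> b |a b. a \<in> A \<and> b \<in> B}"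

definition spatial_tensor :: "'i opr set \<Rightarrow> 'j opr set \<Rightarrow> ('i \<times> 'j) opr set"
  where "spatial_tensor A B = op_closure (alg_tensor A B)"

text \<open>
  For an operator \<open>x\<close> on $\ell^2(I \times J)$, \<open>right_block x i i'\<close> and \<open>left_block x j j'\<close> are the
  operators obtained by slicing the other leg with the vector functional of a pair of basis
  vectors. If \<open>x\<close> belongs to the spatial tensor product of \<open>A\<close> and \<open>B\<close>, these slices belong to
  \<open>B\<close> and \<open>A\<close> respectively.
\<close>

definition right_block :: "('i \<times> 'j) opr \<Rightarrow> 'i \<Rightarrow> 'i \<Rightarrow> 'j opr"
  where "right_block x i i' = (\<lambda>j j'. x (i, j) (i', j'))"

definition left_block :: "('i \<times> 'j) opr \<Rightarrow> 'j \<Rightarrow> 'j \<Rightarrow> 'i opr"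
  where "left_block x j j' = (\<lambda>i i'. x (i, j) (i', j'))"

text \<open>
  The maps $\mathrm{id} \otimes g$ and $f \otimes \mathrm{id}$ act on block matrices by applying
  \<open>g\<close>, respectively \<open>f\<close>, to every block. This is the continuous extension of
  $a \otimes b \mapsto a \otimes g(b)$, respectively $a \otimes b \mapsto f(a) \otimes b$, because
  slice maps are continuous and determine an operator.
\<close>

definition id_tensor :: "('j opr \<Rightarrow> 'l opr) \<Rightarrow> ('i \<times> 'j) opr \<Rightarrow> ('i \<times> 'l) opr"
  where "id_tensor g x = (\<lambda>(i, l) (i', l'). g (right_block x i i') l l')"

definition tensor_id :: "('i opr \<Rightarrow> 'k opr) \<Rightarrow> ('i \<times> 'j) opr \<Rightarrow> ('k \<times> 'j) opr"
  where "tensor_id f x = (\<lambda>(k, j) (k', j'). f (left_block x j j') k k')"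

definition tensor_map ::
    "('i opr \<Rightarrow> 'k opr) \<Rightarrow> ('j opr \<Rightarrow> 'l opr) \<Rightarrow> ('i \<times> 'j) opr \<Rightarrow> ('k \<times> 'l) opr"
  where "tensor_map f g x = tensor_id f (id_tensor g x)"

definition functional_tensor_id :: "('i opr \<Rightarrow> complex) \<Rightarrow> ('i \<times> 'j) opr \<Rightarrow> 'j opr"
  where "functional_tensor_id \<tau> x = (\<lambda>j j'. \<tau> (left_block x j j'))"

lemma tensor_map_tensor:
  assumes "\<And>c. f (op_scale c a) = op_scale c (f a)"
    and "\<And>c. g (op_scale c b) = op_scale c (g b)"
  shows "tensor_map f g (a \<boxtimes> b) = f a \<boxtimes> g b"
proof -
  have "right_block (a \<boxtimes> b) i i' = op_scale (a i i') b" for i i'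
    by (auto simp: right_block_def tensor_def op_scale_def fun_eq_iff)
  then have "id_tensor g (a \<boxtimes> b) = a \<boxtimes> g b"
    by (simp add: id_tensor_def assms(2)) (simp add: tensor_def op_scale_def fun_eq_iff)
  moreover have "left_block (a \<boxtimes> g b) j j' = op_scale (g b j j') a" for j j'
    by (auto simp: left_block_def tensor_def op_scale_def fun_eq_iff)
  then have "tensor_id f (a \<boxtimes> g b) = f a \<boxtimes> g b"
    by (simp add: tensor_id_def assms(1)) (simp add: tensor_def op_scale_def fun_eq_iff)
  ultimately show ?thesis
    by (simp add: tensor_map_def)
qed

definition reassoc :: "('i \<times> 'j \<times> 'k) opr \<Rightarrow> (('i \<times> 'j) \<times> 'k) opr"
  where "reassoc x = (\<lambda>((i, j), k) ((i', j'), k'). x (i, j, k) (i', j', k'))"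


section \<open>Compact quantum groups\<close>

record 'i cqg =
  alg :: "'i opr set"
  comult :: "'i opr \<Rightarrow> ('i \<times> 'i) opr"

definition is_cqg :: "'i cqg \<Rightarrow> bool"
  where "is_cqg Q \<longleftrightarrow>
    unital_cstar_algebra (alg Q) \<and>
    unital_star_hom (alg Q) (spatial_tensor (alg Q) (alg Q)) (comult Q) \<and>
    (\<forall>x\<in>alg Q. tensor_id (comult Q) (comult Q x)
                 = reassoc (id_tensor (comult Q) (comult Q x))) \<and>
    op_closure (op_span {comult Q x \<star> (unit_of (alg Q) \<boxtimes> y) |x y. x \<in> alg Q \<and> y \<in> alg Q})
      = spatial_tensor (alg Q) (alg Q) \<and>
    op_closure (op_span {comult Q x \<star> (y \<boxtimes> unit_of (alg Q)) |x y. x \<in> alg Q \<and> y \<in> alg Q})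
      = spatial_tensor (alg Q) (alg Q)"

definition cqg_morphism :: "'i cqg \<Rightarrow> 'j cqg \<Rightarrow> ('i opr \<Rightarrow> 'j opr) \<Rightarrow> bool"
  where "cqg_morphism Q R \<phi> \<longleftrightarrow>
    unital_star_hom (alg Q) (alg R) \<phi> \<and>
    (\<forall>x\<in>alg Q. comult R (\<phi> x) = tensor_map \<phi> \<phi> (comult Q x))"

definition cqg_isomorphic :: "'i cqg \<Rightarrow> 'j cqg \<Rightarrow> bool"  (infix \<open>\<cong>\<^sub>q\<close> 50)
  where "Q \<cong>\<^sub>q R \<longleftrightarrow> (\<exists>\<phi>. cqg_morphism Q R \<phi> \<and> bij_betw \<phi> (alg Q) (alg R))"

definition cqg_action ::
    "'b opr set \<Rightarrow> 'i cqg \<Rightarrow> ('b opr \<Rightarrow> ('b \<times> 'i) opr) \<Rightarrow> bool"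
  where "cqg_action B Q \<alpha> \<longleftrightarrow>
    unital_star_hom B (spatial_tensor B (alg Q)) \<alpha> \<and>
    (\<forall>x\<in>B. tensor_id \<alpha> (\<alpha> x) = reassoc (id_tensor (comult Q) (\<alpha> x))) \<and>
    op_closure (op_span {\<alpha> x \<star> (unit_of B \<boxtimes> y) |x y. x \<in> B \<and> y \<in> alg Q})
      = spatial_tensor B (alg Q)"


section \<open>The reduced group C*-algebra and the quantum isometry group\<close>

definition reg_unitary :: "('g, 'x) monoid_scheme \<Rightarrow> 'g \<Rightarrow> 'g opr"
  where "reg_unitary G g =
    (\<lambda>h k. if h \<in> carrier G \<and> k \<in> carrier G \<and> h = g \<otimes>\<^bsub>G\<^esub> k then 1 else 0)"

definition reduced_cstar :: "('g, 'x) monoid_scheme \<Rightarrow> 'g opr set"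
  where "reduced_cstar G = op_closure (op_span (reg_unitary G ` carrier G))"

definition group_trace :: "('g, 'x) monoid_scheme \<Rightarrow> 'g opr \<Rightarrow> complex"
  where "group_trace G x = x \<one>\<^bsub>G\<^esub> \<one>\<^bsub>G\<^esub>"

definition word_length :: "('g, 'x) monoid_scheme \<Rightarrow> 'g set \<Rightarrow> 'g \<Rightarrow> nat"
  where "word_length G S g =
    (LEAST n. \<exists>w. length w = n \<and> set w \<subseteq> S \<and> foldr (\<otimes>\<^bsub>G\<^esub>) w \<one>\<^bsub>G\<^esub> = g)"

definition length_space :: "('g, 'x) monoid_scheme \<Rightarrow> 'g set \<Rightarrow> nat \<Rightarrow> 'g opr set"
  where "length_space G S r =
    op_span (reg_unitary G ` {g \<in> carrier G. word_length G S g = r})"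

definition qiso_object ::
    "('g, 'x) monoid_scheme \<Rightarrow> 'g set \<Rightarrow> 'i cqg \<Rightarrow> ('g opr \<Rightarrow> ('g \<times> 'i) opr) \<Rightarrow> bool"
  where "qiso_object G S Q \<alpha> \<longleftrightarrow>
    is_cqg Q \<and> cqg_action (reduced_cstar G) Q \<alpha> \<and>
    (\<forall>x\<in>reduced_cstar G.
       functional_tensor_id (group_trace G) (\<alpha> x)
         = op_scale (group_trace G x) (unit_of (alg Q))) \<and>
    (\<forall>r. \<forall>x\<in>length_space G S r. \<alpha> x \<in> alg_tensor (length_space G S r) (alg Q))"

definition qiso_morphism ::
    "('g, 'x) monoid_scheme \<Rightarrow> 'i cqg \<Rightarrow> ('g opr \<Rightarrow> ('g \<times> 'i) opr)
      \<Rightarrow> 'j cqg \<Rightarrow> ('g opr \<Rightarrow> ('g \<times> 'j) opr) \<Rightarrow> ('i opr \<Rightarrow> 'j opr) \<Rightarrow> bool"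
  where "qiso_morphism G Q \<alpha> R \<beta> \<phi> \<longleftrightarrow>
    cqg_morphism Q R \<phi> \<and> (\<forall>x\<in>reduced_cstar G. \<beta> x = id_tensor \<phi> (\<alpha> x))"

text \<open>
  \<open>(Q, \<alpha>)\<close> is universal among the objects whose algebras act on $\ell^2$ of the type \<open>'u\<close>. HOL
  cannot quantify over all types inside a formula, so the index type of the test objects is a
  parameter; the unrestricted universal property is this one for every \<open>'u\<close>.
\<close>

definition quantum_isometry_group ::
    "'u itself \<Rightarrow> ('g, 'x) monoid_scheme \<Rightarrow> 'g set \<Rightarrow> 'i cqg
      \<Rightarrow> ('g opr \<Rightarrow> ('g \<times> 'i) opr) \<Rightarrow> bool"
  where "quantum_isometry_group _ G S Q \<alpha> \<longleftrightarrow>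
    qiso_object G S Q \<alpha> \<and>
    (\<forall>(R :: 'u cqg) \<beta>. qiso_object G S R \<beta> \<longrightarrow>
      (\<exists>\<phi>. qiso_morphism G Q \<alpha> R \<beta> \<phi> \<and>
        (\<forall>\<psi>. qiso_morphism G Q \<alpha> R \<beta> \<psi> \<longrightarrow> (\<forall>x\<in>alg Q. \<psi> x = \<phi> x))))"


section \<open>The full group C*-algebra as a compact quantum group\<close>

definition unitary_rep :: "('g, 'x) monoid_scheme \<Rightarrow> ('g \<Rightarrow> 'i opr) \<Rightarrow> bool"
  where "unitary_rep G \<pi> \<longleftrightarrow>
    (\<forall>g\<in>carrier G. bounded_op (\<pi> g) \<and> op_adj (\<pi> g) \<star> \<pi> g = op_id \<and> \<pi> g \<star> op_adj (\<pi> g) = op_id) \<and>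
    (\<forall>g\<in>carrier G. \<forall>h\<in>carrier G. \<pi> (g \<otimes>\<^bsub>G\<^esub> h) = \<pi> g \<star> \<pi> h)"

text \<open>
  For a countable group the full group C*-algebra is generated by the direct sum of all its
  unitary representations on $\ell^2(\mathbb{N})$: every cyclic representation acts on a separable
  space and hence is, up to multiplicity, one of them. The indices are pairs of a representation
  and a basis vector; blocks indexed by functions that are not unitary representations are zero.
\<close>

type_synonym 'g full_index = "('g \<Rightarrow> nat opr) \<times> nat"

definition full_unitary :: "('g, 'x) monoid_scheme \<Rightarrow> 'g \<Rightarrow> 'g full_index opr"
  where "full_unitary G g =
    (\<lambda>(\<pi>, i) (\<rho>, j). if \<pi> = \<rho> \<and> unitary_rep G \<pi> then \<pi> g i j else 0)"

definition full_cstar :: "('g, 'x) monoid_scheme \<Rightarrow> 'g full_index opr set"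
  where "full_cstar G = op_closure (op_span (full_unitary G ` carrier G))"

text \<open>
  The unital *-homomorphism on the full group C*-algebra with prescribed values on the canonical
  unitaries; it is unique on \<open>full_cstar G\<close>, and exists when \<open>u\<close> is a unitary representation in \<open>B\<close>.
\<close>

definition full_hom ::
    "('g, 'x) monoid_scheme \<Rightarrow> 'j opr set \<Rightarrow> ('g \<Rightarrow> 'j opr) \<Rightarrow> 'g full_index opr \<Rightarrow> 'j opr"
  where "full_hom G B u =
    (SOME f. unital_star_hom (full_cstar G) B f \<and> (\<forall>g\<in>carrier G. f (full_unitary G g) = u g))"

definition full_cqg :: "('g, 'x) monoid_scheme \<Rightarrow> 'g full_index cqg"
  where "full_cqg G = \<lparr> alg = full_cstar G,
    comult = full_hom G (spatial_tensor (full_cstar G) (full_cstar G))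
               (\<lambda>g. full_unitary G g \<boxtimes> full_unitary G g) \<rparr>"

definition full_aut ::
    "('g, 'x) monoid_scheme \<Rightarrow> ('g \<Rightarrow> 'g) \<Rightarrow> 'g full_index opr \<Rightarrow> 'g full_index opr"
  where "full_aut G \<theta> = full_hom G (full_cstar G) (\<lambda>g. full_unitary G (\<theta> g))"


section \<open>Doubling\<close>

definition dsum_inl :: "'i opr \<Rightarrow> ('i + 'i) opr"
  where "dsum_inl a = (\<lambda>p q. case (p, q) of (Inl i, Inl j) \<Rightarrow> a i j | _ \<Rightarrow> 0)"

definition dsum_inr :: "'i opr \<Rightarrow> ('i + 'i) opr"
  where "dsum_inr a = (\<lambda>p q. case (p, q) of (Inr i, Inr j) \<Rightarrow> a i j | _ \<Rightarrow> 0)"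

definition dsum_fst :: "('i + 'i) opr \<Rightarrow> 'i opr"
  where "dsum_fst x = (\<lambda>i j. x (Inl i) (Inl j))"

definition dsum_snd :: "('i + 'i) opr \<Rightarrow> 'i opr"
  where "dsum_snd x = (\<lambda>i j. x (Inr i) (Inr j))"

definition doubling :: "'i cqg \<Rightarrow> ('i opr \<Rightarrow> 'i opr) \<Rightarrow> ('i + 'i) cqg"
  where "doubling Q \<theta> =
    \<lparr> alg = {dsum_inl a + dsum_inr b |a b. a \<in> alg Q \<and> b \<in> alg Q},
      comult = (\<lambda>x.
        tensor_map dsum_inl dsum_inl (comult Q (dsum_fst x))
        + tensor_map dsum_inr (dsum_inr \<circ> \<theta>) (comult Q (dsum_fst x))
        + (tensor_map dsum_inl dsum_inr (comult Q (dsum_snd x))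
        + tensor_map dsum_inr (dsum_inl \<circ> \<theta>) (comult Q (dsum_snd x)))) \<rparr>"


section \<open>Group presentations\<close>

text \<open>Words in generator symbols; \<open>(x, True)\<close> stands for \<open>x\<close> and \<open>(x, False)\<close> for its inverse.\<close>

type_synonym 'x word = "('x \<times> bool) list"

definition word_val :: "('g, 'z) monoid_scheme \<Rightarrow> ('x \<Rightarrow> 'g) \<Rightarrow> 'x word \<Rightarrow> 'g"
  where "word_val G f w =
    foldr (\<lambda>(x, pos) g. (if pos then f x else inv\<^bsub>G\<^esub> (f x)) \<otimes>\<^bsub>G\<^esub> g) w \<one>\<^bsub>G\<^esub>"

text \<open>Equality of words in the group presented by the relators \<open>R\<close>.\<close>

inductive word_eq :: "'x word set \<Rightarrow> 'x word \<Rightarrow> 'x word \<Rightarrow> bool" for R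
  where
    relator: "r \<in> R \<Longrightarrow> word_eq R r []"
  | cancel: "word_eq R [(x, s), (x, \<not> s)] []"
  | context_closed: "word_eq R u v \<Longrightarrow> word_eq R (p @ u @ q) (p @ v @ q)"
  | refl: "word_eq R u u"
  | sym: "word_eq R u v \<Longrightarrow> word_eq R v u"
  | trans: "word_eq R u v \<Longrightarrow> word_eq R v w \<Longrightarrow> word_eq R u w"

definition has_presentation ::
    "('g, 'z) monoid_scheme \<Rightarrow> ('x \<Rightarrow> 'g) \<Rightarrow> 'x word set \<Rightarrow> bool"
  where "has_presentation G f R \<longleftrightarrow>
    group G \<and> range f \<subseteq> carrier G \<and> word_val G f ` UNIV = carrier G \<and>
    (\<forall>u v. word_val G f u = word_val G f v \<longleftrightarrow> word_eq R u v)"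

datatype gen = GenA | GenB

definition polyhedral_relators :: "nat \<Rightarrow> gen word set"
  where "polyhedral_relators m =
    {replicate 2 (GenA, True), replicate 3 (GenB, True),
     concat (replicate m [(GenA, True), (GenB, True)])}"

end

theory Submission
  imports Defs
begin

text \<open>
  Why the theorem holds. Let $(Q, \beta)$ be an object of the category, $p$ and $p'$ complementary
  projections of $Q$. Call $\beta$ graded if
  $\beta(\lambda_g) = \lambda_g \otimes U_g + \lambda_{\theta(g)} \otimes V_g$ for all $g$, with $U_g$ under $p$ and $V_g$
  under $p'$. The heart of the proof is that every object is graded. On the generators, preservation of
  length leaves only coefficients at $a$, $b$, $b^{-1}$, and comparing coefficients in a few relations
  leaves $\beta(\lambda_a) = \lambda_a \otimes A$ and
  $\beta(\lambda_b) = \lambda_b \otimes D + \lambda_{b^{-1}} \otimes E$, where $p = D^3$ and $p' = E^3$ are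
  complementary projections (\<open>generators_form\<close>). It remains to see that $A$ commutes with $p$, and
  this is where the polyhedron enters: on its edge graph with $m$-gonal faces, a
  closed path of $m$ turns goes around a face, so that the coefficient at $e$ of
  $\beta(\lambda_{ab})^m = 1$ is $(AD)^m + (AE)^m = 1$, from which $ApA = p$ follows
  (\<open>projection_commutes\<close>). Since $\Gamma$ is generated by $a$ and $b$, the grading extends to all $g$
  (\<open>graded_form\<close>), and $U$ and $V$ with the restricted coproduct satisfy the relations of
  $\xi(\lambda_g)$ and $\eta(\lambda_{\theta(g)})$ in the doubling (\<open>doubled_family_exists\<close>).

  Conversely, any two orthogonal copies of a representation of $\Gamma$ with a coproduct and an action
  given by the formulas of the doubling form an object (\<open>is_qiso_object\<close>). This applies to the doubling
  itself and to the span of the coefficients inside any object. As the canonical unitaries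
  of the full group C*-algebra are linearly independent, the doubling maps to every object in
  exactly one way (\<open>DG_universal\<close>), and a universal object is spanned by its coefficients and
  isomorphic to the doubling (\<open>universal_object_isomorphic\<close>).

  The group $\Gamma$ is finite, because the cosets of the rotation $ab$ are the faces of the
  polyhedron. Hence the doubling is finite dimensional, and completions matter only through the
  fact that finite-dimensional spaces of operators are closed (\<open>op_closure_finite_span\<close>). The test
  objects $Q$ may be infinite dimensional; about them only the algebra of bounded matrices is used,
  in particular the associativity of their product (\<open>op_mult_assoc\<close>).
\<close>

section \<open>Bounded matrices and their products\<close>

text \<open>
  Square summability with a bound on the norm, phrased through finite partial sums, because
  \<open>op_bound\<close> only speaks about finite sets of indices.
\<close>

definition l2_bound :: "('i \<Rightarrow> complex) \<Rightarrow> real \<Rightarrow> bool"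
  where "l2_bound v B \<longleftrightarrow> (\<forall>F. finite F \<longrightarrow> L2_set (\<lambda>i. cmod (v i)) F \<le> B)"

lemma l2_bound_nonneg: "l2_bound v B \<Longrightarrow> 0 \<le> B"
  unfolding l2_bound_def by (metis L2_set_empty finite.emptyI)

lemma L2_set_restrict:
  assumes "finite F" "finite F'"
  shows "L2_set (\<lambda>i. cmod (if i \<in> F then x i else 0)) (F \<union> F') = L2_set (\<lambda>i. cmod (x i)) F"
proof -
  have "(\<Sum>i\<in>F \<union> F'. (cmod (if i \<in> F then x i else 0))\<^sup>2) = (\<Sum>i\<in>F. (cmod (x i))\<^sup>2)"
    using assms by (intro sum.mono_neutral_cong_right) auto
  then show ?thesis by (simp add: L2_set_def)
qed

lemma cmod_sum_mult_le:
  "cmod (\<Sum>i\<in>F. u i * v i) \<le> L2_set (\<lambda>i. cmod (u i)) F * L2_set (\<lambda>i. cmod (v i)) F"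
proof -
  have "cmod (\<Sum>i\<in>F. u i * v i) \<le> (\<Sum>i\<in>F. \<bar>cmod (u i)\<bar> * \<bar>cmod (v i)\<bar>)"
    by (rule order_trans[OF norm_sum]) (simp add: norm_mult)
  also note L2_set_mult_ineq
  finally show ?thesis .
qed

text \<open>
  Testing the form with the truncated image vector itself gives one direction, Cauchy--Schwarz the
  other. A bound on image vectors, unlike one on the form, passes to infinite sums directly.
\<close>

lemma op_bound_iff:
  "op_bound M C \<longleftrightarrow> 0 \<le> C \<and> (\<forall>F F' x. finite F \<longrightarrow> finite F' \<longrightarrow>
     L2_set (\<lambda>i. cmod (\<Sum>j\<in>F. M i j * x j)) F' \<le> C * L2_set (\<lambda>j. cmod (x j)) F)"
    (is "_ \<longleftrightarrow> _ \<and> ?V")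
proof (intro iffI conjI allI impI)
  assume b: "op_bound M C"
  then show C: "0 \<le> C" by (simp add: op_bound_def)
  fix F F' :: "'a set" and x :: "'a \<Rightarrow> complex"
  assume f: "finite F" "finite F'"
  define z where "z i = (\<Sum>j\<in>F. M i j * x j)" for i
  define x' where "x' j = (if j \<in> F then x j else 0)" for j
  define y' where "y' i = (if i \<in> F' then z i else 0)" for i
  have "(\<Sum>i\<in>F \<union> F'. \<Sum>j\<in>F \<union> F'. cnj (y' i) * M i j * x' j) = (\<Sum>i\<in>F'. \<Sum>j\<in>F. cnj (z i) * M i j * x j)"
    using f by (intro sum.mono_neutral_cong_right) (auto simp: x'_def y'_def intro!: sum.mono_neutral_cong_right)
  also have "\<dots> = (\<Sum>i\<in>F'. cnj (z i) * z i)"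
    by (simp add: z_def sum_distrib_left mult.assoc)
  also have "\<dots> = of_real ((L2_set (\<lambda>i. cmod (z i)) F')\<^sup>2)"
    by (simp add: L2_set_def sum_nonneg mult.commute[of "cnj _"] flip: complex_norm_square)
  finally have e: "(\<Sum>i\<in>F \<union> F'. \<Sum>j\<in>F \<union> F'. cnj (y' i) * M i j * x' j) = of_real ((L2_set (\<lambda>i. cmod (z i)) F')\<^sup>2)" .
  have "cmod (\<Sum>i\<in>F \<union> F'. \<Sum>j\<in>F \<union> F'. cnj (y' i) * M i j * x' j)
     \<le> C * L2_set (\<lambda>i. cmod (x' i)) (F \<union> F') * L2_set (\<lambda>i. cmod (y' i)) (F \<union> F')"
    using b f by (simp add: op_bound_def)
  also have "L2_set (\<lambda>i. cmod (x' i)) (F \<union> F') = L2_set (\<lambda>i. cmod (x i)) F"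
    unfolding x'_def by (rule L2_set_restrict[OF f])
  also have "L2_set (\<lambda>i. cmod (y' i)) (F \<union> F') = L2_set (\<lambda>i. cmod (z i)) F'"
    using L2_set_restrict[OF f(2,1), of z] by (simp add: y'_def Un_commute)
  finally have le: "(L2_set (\<lambda>i. cmod (z i)) F')\<^sup>2 \<le> C * L2_set (\<lambda>i. cmod (x i)) F * L2_set (\<lambda>i. cmod (z i)) F'"
    unfolding e by (simp add: norm_power)
  have "L2_set (\<lambda>i. cmod (z i)) F' \<le> C * L2_set (\<lambda>i. cmod (x i)) F"
  proof (cases "L2_set (\<lambda>i. cmod (z i)) F' = 0")
    case True then show ?thesis using C by simp
  next
    case False
    then have "L2_set (\<lambda>i. cmod (z i)) F' > 0" by (simp add: less_le)
    with le show ?thesis by (simp add: power2_eq_square)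
  qed
  then show "L2_set (\<lambda>i. cmod (\<Sum>j\<in>F. M i j * x j)) F' \<le> C * L2_set (\<lambda>j. cmod (x j)) F"
    by (simp add: z_def)
next
  assume a: "0 \<le> C \<and> ?V"
  show "op_bound M C" unfolding op_bound_def
  proof (intro conjI allI impI)
    show "0 \<le> C" using a by simp
    fix F :: "'a set" and x y :: "'a \<Rightarrow> complex" assume f: "finite F"
    have "cmod (\<Sum>i\<in>F. \<Sum>j\<in>F. cnj (y i) * M i j * x j) = cmod (\<Sum>i\<in>F. cnj (y i) * (\<Sum>j\<in>F. M i j * x j))"
      by (simp add: sum_distrib_left mult.assoc)
    also have "\<dots> \<le> L2_set (\<lambda>i. cmod (cnj (y i))) F * L2_set (\<lambda>i. cmod (\<Sum>j\<in>F. M i j * x j)) F"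
      by (rule cmod_sum_mult_le)
    also have "\<dots> \<le> L2_set (\<lambda>i. cmod (y i)) F * (C * L2_set (\<lambda>i. cmod (x i)) F)"
      using a f by (auto intro!: mult_left_mono)
    finally show "cmod (\<Sum>i\<in>F. \<Sum>j\<in>F. cnj (y i) * M i j * x j)
      \<le> C * L2_set (\<lambda>i. cmod (x i)) F * L2_set (\<lambda>i. cmod (y i)) F" by (simp add: mult_ac)
  qed
qed

lemma op_bound_apply:
  "op_bound M C \<Longrightarrow> finite F \<Longrightarrow> finite F' \<Longrightarrow>
    L2_set (\<lambda>i. cmod (\<Sum>j\<in>F. M i j * x j)) F' \<le> C * L2_set (\<lambda>j. cmod (x j)) F"
  by (simp add: op_bound_iff)

lemma op_bound_adj: "op_bound M C \<Longrightarrow> op_bound (op_adj M) C"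
  unfolding op_bound_def
proof (intro conjI allI impI; elim conjE)
  fix F :: "'a set" and x y :: "'a \<Rightarrow> complex"
  assume f: "finite F" and H: "\<forall>F x y. finite F \<longrightarrow> cmod (\<Sum>i\<in>F. \<Sum>j\<in>F. cnj (y i) * M i j * x j)
     \<le> C * L2_set (\<lambda>i. cmod (x i)) F * L2_set (\<lambda>i. cmod (y i)) F"
  have "(\<Sum>i\<in>F. \<Sum>j\<in>F. cnj (y i) * op_adj M i j * x j) = cnj (\<Sum>j\<in>F. \<Sum>i\<in>F. cnj (x j) * M j i * y i)"
    by (subst sum.swap) (simp add: op_adj_def mult_ac)
  then have "cmod (\<Sum>i\<in>F. \<Sum>j\<in>F. cnj (y i) * op_adj M i j * x j)
      = cmod (\<Sum>j\<in>F. \<Sum>i\<in>F. cnj (x j) * M j i * y i)"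
    by (simp only: complex_mod_cnj)
  also have "\<dots> \<le> C * L2_set (\<lambda>i. cmod (y i)) F * L2_set (\<lambda>i. cmod (x i)) F"
    using H f by blast
  finally show "cmod (\<Sum>i\<in>F. \<Sum>j\<in>F. cnj (y i) * op_adj M i j * x j)
     \<le> C * L2_set (\<lambda>i. cmod (x i)) F * L2_set (\<lambda>i. cmod (y i)) F"
    by (simp add: mult_ac)
qed

lemma op_bound_column: "op_bound M C \<Longrightarrow> l2_bound (\<lambda>i. M i j) C"
  using op_bound_apply[of M C "{j}" _ "\<lambda>_. 1"] by (simp add: l2_bound_def)

lemma op_bound_row: "op_bound M C \<Longrightarrow> l2_bound (M i) C"
  using op_bound_column[OF op_bound_adj, of M C i] by (simp add: l2_bound_def op_adj_def)

lemma l2_bound_entry: "l2_bound v B \<Longrightarrow> cmod (v i) \<le> B"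
  unfolding l2_bound_def by (drule spec[of _ "{i}"]) simp

lemma op_bound_entry: "op_bound M C \<Longrightarrow> cmod (M i j) \<le> C"
  using l2_bound_entry[OF op_bound_column] .

lemma l2_bound_mult:
  assumes "l2_bound u A" "l2_bound v B"
  shows "(\<lambda>i. u i * v i) summable_on UNIV" "cmod (\<Sum>\<^sub>\<infinity>i. u i * v i) \<le> A * B"
proof -
  have fin: "(\<Sum>i\<in>F. norm (u i * v i)) \<le> A * B" if "finite F" for F
  proof -
    have "(\<Sum>i\<in>F. norm (u i * v i)) \<le> L2_set (\<lambda>i. cmod (u i)) F * L2_set (\<lambda>i. cmod (v i)) F"
      using L2_set_mult_ineq[of "\<lambda>i. cmod (u i)" "\<lambda>i. cmod (v i)" F] by (simp add: norm_mult)
    also have "\<dots> \<le> A * B"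
      using assms that l2_bound_nonneg[OF assms(1)] by (intro mult_mono) (auto simp: l2_bound_def)
    finally show ?thesis .
  qed
  have abs: "(\<lambda>i. norm (u i * v i)) summable_on UNIV"
    by (rule nonneg_bdd_above_summable_on) (auto intro!: bdd_aboveI2[where M="A*B"] fin)
  then show "(\<lambda>i. u i * v i) summable_on UNIV" by (rule abs_summable_summable)
  have "cmod (\<Sum>\<^sub>\<infinity>i. u i * v i) \<le> (\<Sum>\<^sub>\<infinity>i. norm (u i * v i))" by (rule norm_infsum_bound[OF abs])
  also have "\<dots> \<le> A * B" by (rule infsum_le_finite_sums[OF abs]) (use fin in auto)
  finally show "cmod (\<Sum>\<^sub>\<infinity>i. u i * v i) \<le> A * B" .
qed

lemma l2_bound_apply:
  assumes M: "op_bound M C" and v: "l2_bound v B"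
  shows "l2_bound (\<lambda>i. \<Sum>\<^sub>\<infinity>j. M i j * v j) (C * B)"
  unfolding l2_bound_def
proof (intro allI impI)
  fix F' :: "'a set" assume f': "finite F'"
  have "((\<lambda>F. \<Sum>j\<in>F. M i j * v j) \<longlongrightarrow> (\<Sum>\<^sub>\<infinity>j. M i j * v j)) (finite_subsets_at_top UNIV)" for i
    by (intro infsum_tendsto l2_bound_mult(1)[OF op_bound_row[OF M] v])
  then have "((\<lambda>F. L2_set (\<lambda>i. cmod (\<Sum>j\<in>F. M i j * v j)) F') \<longlongrightarrow>
      L2_set (\<lambda>i. cmod (\<Sum>\<^sub>\<infinity>j. M i j * v j)) F') (finite_subsets_at_top UNIV)"
    unfolding L2_set_def by (intro tendsto_intros)
  then show "L2_set (\<lambda>i. cmod (\<Sum>\<^sub>\<infinity>j. M i j * v j)) F' \<le> C * B"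
  proof (rule tendsto_upperbound)
    show "\<forall>\<^sub>F F in finite_subsets_at_top UNIV. L2_set (\<lambda>i. cmod (\<Sum>j\<in>F. M i j * v j)) F' \<le> C * B"
    proof (rule eventually_finite_subsets_at_top_weakI)
      fix F :: "'a set" assume f: "finite F"
      have "L2_set (\<lambda>i. cmod (\<Sum>j\<in>F. M i j * v j)) F' \<le> C * L2_set (\<lambda>j. cmod (v j)) F"
        by (rule op_bound_apply[OF M f f'])
      also have "\<dots> \<le> C * B" using v f M by (intro mult_left_mono) (auto simp: l2_bound_def op_bound_def)
      finally show "L2_set (\<lambda>i. cmod (\<Sum>j\<in>F. M i j * v j)) F' \<le> C * B" .
    qed
  qed simp
qed

lemma l2_bound_finite: "finite F \<Longrightarrow> l2_bound (\<lambda>i. if i \<in> F then v i else 0) (L2_set (\<lambda>i. cmod (v i)) F)"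
  unfolding l2_bound_def
proof (intro allI impI)
  fix F' :: "'a set" assume f: "finite F" "finite F'"
  have "L2_set (\<lambda>i. cmod (if i \<in> F then v i else 0)) F' \<le> L2_set (\<lambda>i. cmod (if i \<in> F then v i else 0)) (F \<union> F')"
    unfolding L2_set_def using f by (auto intro!: sum_mono2)
  then show "L2_set (\<lambda>i. cmod (if i \<in> F then v i else 0)) F' \<le> L2_set (\<lambda>i. cmod (v i)) F"
    by (simp only: L2_set_restrict[OF f])
qed

lemma l2_bound_tail:
  assumes v: "l2_bound v B" and "\<epsilon> > 0"
  shows "\<exists>K. finite K \<and> l2_bound (\<lambda>i. if i \<in> K then 0 else v i) \<epsilon>"
proof -
  have b: "(\<Sum>i\<in>F. (cmod (v i))\<^sup>2) \<le> B\<^sup>2" if "finite F" for F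
    using v that by (intro sqrt_le_D) (simp add: l2_bound_def L2_set_def)
  have s: "(\<lambda>i. (cmod (v i))\<^sup>2) summable_on UNIV"
    by (rule nonneg_bdd_above_summable_on) (auto intro!: bdd_aboveI2[where M="B\<^sup>2"] b)
  obtain K where K: "finite K" "dist (\<Sum>i\<in>K. (cmod (v i))\<^sup>2) (\<Sum>\<^sub>\<infinity>i. (cmod (v i))\<^sup>2) \<le> \<epsilon>\<^sup>2"
    using infsum_finite_approximation[OF s, of "\<epsilon>\<^sup>2"] assms(2) by auto
  have "L2_set (\<lambda>i. cmod (if i \<in> K then 0 else v i)) F \<le> \<epsilon>" if f: "finite F" for F
  proof -
    have e: "(\<Sum>i\<in>F. (cmod (if i \<in> K then 0 else v i))\<^sup>2) = (\<Sum>i\<in>F - K. (cmod (v i))\<^sup>2)"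
      using f by (intro sum.mono_neutral_cong_right) auto
    have "(\<Sum>i\<in>F - K. (cmod (v i))\<^sup>2) + (\<Sum>i\<in>K. (cmod (v i))\<^sup>2) = (\<Sum>i\<in>F \<union> K. (cmod (v i))\<^sup>2)"
      using f K(1) by (subst sum.union_disjoint[symmetric]) (auto intro!: sum.cong)
    also have "\<dots> \<le> (\<Sum>\<^sub>\<infinity>i. (cmod (v i))\<^sup>2)"
      using f K(1) by (intro finite_sum_le_infsum[OF s]) auto
    finally have "(\<Sum>i\<in>F - K. (cmod (v i))\<^sup>2) \<le> \<epsilon>\<^sup>2" using K(2) by (simp add: dist_real_def)
    then show ?thesis unfolding L2_set_def e using assms(2) by (simp add: real_le_lsqrt sum_nonneg)
  qed
  then show ?thesis using K(1) by (auto simp: l2_bound_def)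
qed

lemma infsum_sum:
  fixes f :: "'k \<Rightarrow> 'i \<Rightarrow> complex"
  assumes "\<And>k. k \<in> K \<Longrightarrow> f k summable_on UNIV"
  shows "(\<Sum>\<^sub>\<infinity>i. \<Sum>k\<in>K. f k i) = (\<Sum>k\<in>K. \<Sum>\<^sub>\<infinity>i. f k i)"
proof -
  have "(\<lambda>i. \<Sum>k\<in>K. f k i) summable_on UNIV \<and> (\<Sum>\<^sub>\<infinity>i. \<Sum>k\<in>K. f k i) = (\<Sum>k\<in>K. \<Sum>\<^sub>\<infinity>i. f k i)"
    using assms by (induction K rule: infinite_finite_induct) (auto simp: infsum_add summable_on_add)
  then show ?thesis by simp
qed

text \<open>
  The double series need not converge absolutely, so the two summations cannot simply be swapped.
  Both sides agree when \<open>v\<close> has finite support, and both depend on \<open>v\<close> continuously for the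
  $\ell^2$-norm; cutting off a tail of \<open>v\<close> of small norm gives the general case.
\<close>

lemma infsum_assoc:
  assumes m: "l2_bound m A" and N: "op_bound N C" and v: "l2_bound v B"
  shows "(\<Sum>\<^sub>\<infinity>k. (\<Sum>\<^sub>\<infinity>j. m j * N j k) * v k) = (\<Sum>\<^sub>\<infinity>j. m j * (\<Sum>\<^sub>\<infinity>k. N j k * v k))"
proof -
  define c where "c k = (\<Sum>\<^sub>\<infinity>j. m j * N j k)" for k
  have c: "l2_bound c (C * A)"
  proof -
    have m': "l2_bound (\<lambda>j. cnj (m j)) A" using m by (simp add: l2_bound_def)
    have "cmod (\<Sum>\<^sub>\<infinity>j. op_adj N k j * cnj (m j)) = cmod (c k)" for k
    proof -
      have "(\<Sum>\<^sub>\<infinity>j. op_adj N k j * cnj (m j)) = cnj (c k)"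
        unfolding c_def by (subst infsum_cnj[symmetric]) (simp add: op_adj_def mult.commute)
      then show ?thesis by simp
    qed
    then show ?thesis using l2_bound_apply[OF op_bound_adj[OF N] m'] by (simp add: l2_bound_def)
  qed
  have sj: "(\<lambda>j. m j * N j k) summable_on UNIV" for k
    by (rule l2_bound_mult(1)[OF m op_bound_column[OF N]])
  have "cmod ((\<Sum>\<^sub>\<infinity>k. c k * v k) - (\<Sum>\<^sub>\<infinity>j. m j * (\<Sum>\<^sub>\<infinity>k. N j k * v k))) \<le> 0"
  proof (rule field_le_epsilon)
    fix e :: real assume e: "e > 0"
    define d where "d = e / (2 * (C * A + 1))"
    have CA: "0 \<le> C * A" using l2_bound_nonneg[OF c] .
    then have d: "d > 0" using e by (simp add: d_def)
    obtain K where K: "finite K" and t: "l2_bound (\<lambda>i. if i \<in> K then 0 else v i) d"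
      using l2_bound_tail[OF v d] by blast
    define t where "t i = (if i \<in> K then 0 else v i)" for i
    define h where "h i = (if i \<in> K then v i else 0)" for i
    have t: "l2_bound t d" using t by (simp add: t_def[abs_def])
    have h: "l2_bound h (L2_set (\<lambda>i. cmod (v i)) K)" unfolding h_def by (rule l2_bound_finite[OF K])
    have vth: "v k = h k + t k" for k by (simp add: t_def h_def)
    have row: "l2_bound (N j) C" for j by (rule op_bound_row[OF N])
    have L: "(\<Sum>\<^sub>\<infinity>k. c k * v k) = (\<Sum>\<^sub>\<infinity>k. c k * h k) + (\<Sum>\<^sub>\<infinity>k. c k * t k)"
      unfolding vth distrib_left by (rule infsum_add[OF l2_bound_mult(1)[OF c h] l2_bound_mult(1)[OF c t]])
    have "(\<Sum>\<^sub>\<infinity>k. N j k * v k) = (\<Sum>\<^sub>\<infinity>k. N j k * h k) + (\<Sum>\<^sub>\<infinity>k. N j k * t k)" for j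
      unfolding vth distrib_left by (rule infsum_add[OF l2_bound_mult(1)[OF row h] l2_bound_mult(1)[OF row t]])
    then have R: "(\<Sum>\<^sub>\<infinity>j. m j * (\<Sum>\<^sub>\<infinity>k. N j k * v k))
       = (\<Sum>\<^sub>\<infinity>j. m j * (\<Sum>\<^sub>\<infinity>k. N j k * h k)) + (\<Sum>\<^sub>\<infinity>j. m j * (\<Sum>\<^sub>\<infinity>k. N j k * t k))"
      by (simp add: distrib_left) (intro infsum_add l2_bound_mult(1)[OF m l2_bound_apply[OF N h]]
          l2_bound_mult(1)[OF m l2_bound_apply[OF N t]])
    have fin: "(\<Sum>\<^sub>\<infinity>k. f k * h k) = (\<Sum>k\<in>K. f k * v k)" for f :: "'a \<Rightarrow> complex"
    proof -
      have "(\<Sum>\<^sub>\<infinity>k. f k * h k) = (\<Sum>\<^sub>\<infinity>k\<in>K. f k * v k)"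
        by (intro infsum_cong_neutral) (auto simp: h_def)
      then show ?thesis using K by simp
    qed
    have "(\<Sum>\<^sub>\<infinity>j. m j * (\<Sum>\<^sub>\<infinity>k. N j k * h k)) = (\<Sum>\<^sub>\<infinity>j. \<Sum>k\<in>K. (m j * N j k) * v k)"
      by (simp add: fin sum_distrib_left mult.assoc)
    also have "\<dots> = (\<Sum>k\<in>K. \<Sum>\<^sub>\<infinity>j. (m j * N j k) * v k)"
      by (intro infsum_sum summable_on_cmult_left sj)
    also have "\<dots> = (\<Sum>k\<in>K. c k * v k)" unfolding c_def by (simp add: infsum_cmult_left sj)
    also have "\<dots> = (\<Sum>\<^sub>\<infinity>k. c k * h k)" by (simp add: fin)
    finally have E: "(\<Sum>\<^sub>\<infinity>j. m j * (\<Sum>\<^sub>\<infinity>k. N j k * h k)) = (\<Sum>\<^sub>\<infinity>k. c k * h k)" .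
    have "cmod ((\<Sum>\<^sub>\<infinity>k. c k * v k) - (\<Sum>\<^sub>\<infinity>j. m j * (\<Sum>\<^sub>\<infinity>k. N j k * v k)))
       = cmod ((\<Sum>\<^sub>\<infinity>k. c k * t k) - (\<Sum>\<^sub>\<infinity>j. m j * (\<Sum>\<^sub>\<infinity>k. N j k * t k)))"
      by (simp add: L R E)
    also have "\<dots> \<le> cmod (\<Sum>\<^sub>\<infinity>k. c k * t k) + cmod (\<Sum>\<^sub>\<infinity>j. m j * (\<Sum>\<^sub>\<infinity>k. N j k * t k))"
      by (rule norm_triangle_ineq4)
    also have "\<dots> \<le> (C * A) * d + A * (C * d)"
      by (intro add_mono l2_bound_mult(2)[OF c t] l2_bound_mult(2)[OF m l2_bound_apply[OF N t]])
    also have "\<dots> = (2 * (C * A)) * d" by simp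
    also have "\<dots> \<le> (2 * (C * A + 1)) * d" using d by (intro mult_right_mono) auto
    also have "\<dots> = e" using CA by (simp add: d_def field_simps)
    finally show "cmod ((\<Sum>\<^sub>\<infinity>k. c k * v k) - (\<Sum>\<^sub>\<infinity>j. m j * (\<Sum>\<^sub>\<infinity>k. N j k * v k))) \<le> 0 + e" by simp
  qed
  then show ?thesis by (simp add: c_def)
qed

lemma op_mult_assoc:
  assumes "bounded_op M" "bounded_op N" "bounded_op P"
  shows "(M \<star> N) \<star> P = M \<star> (N \<star> P)"
proof -
  obtain A C B where M: "op_bound M A" and N: "op_bound N C" and P: "op_bound P B"
    using assms by (auto simp: bounded_op_def)
  from infsum_assoc[OF op_bound_row[OF M] N op_bound_column[OF P]] show ?thesis by (simp add: op_mult_def fun_eq_iff)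
qed

lemma bounded_adj [simp, intro]: "bounded_op M \<Longrightarrow> bounded_op (op_adj M)"
  using op_bound_adj by (auto simp: bounded_op_def)

lemma op_bound_zero: "op_bound 0 0"
  by (simp add: op_bound_def)

lemma bounded_zero [simp, intro]: "bounded_op 0"
  using op_bound_zero by (auto simp: bounded_op_def)

lemma bounded_add [simp, intro]:
  assumes "bounded_op M" "bounded_op N" shows "bounded_op (M + N)"
proof -
  obtain A B where AB: "op_bound M A" "op_bound N B" using assms by (auto simp: bounded_op_def)
  have "op_bound (M + N) (A + B)" unfolding op_bound_def
  proof (intro conjI allI impI)
    show "0 \<le> A + B" using AB by (simp add: op_bound_def)
    fix F :: "'a set" and x y :: "'a \<Rightarrow> complex" assume f: "finite F"
    have "cmod (\<Sum>i\<in>F. \<Sum>j\<in>F. cnj (y i) * (M + N) i j * x j)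
      \<le> cmod (\<Sum>i\<in>F. \<Sum>j\<in>F. cnj (y i) * M i j * x j) + cmod (\<Sum>i\<in>F. \<Sum>j\<in>F. cnj (y i) * N i j * x j)"
      by (rule order_trans[OF _ norm_triangle_ineq]) (simp add: sum.distrib algebra_simps)
    also have "\<dots> \<le> A * L2_set (\<lambda>i. cmod (x i)) F * L2_set (\<lambda>i. cmod (y i)) F
       + B * L2_set (\<lambda>i. cmod (x i)) F * L2_set (\<lambda>i. cmod (y i)) F"
      using AB f by (intro add_mono) (auto simp: op_bound_def)
    finally show "cmod (\<Sum>i\<in>F. \<Sum>j\<in>F. cnj (y i) * (M + N) i j * x j)
      \<le> (A + B) * L2_set (\<lambda>i. cmod (x i)) F * L2_set (\<lambda>i. cmod (y i)) F" by (simp add: algebra_simps)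
  qed
  then show ?thesis by (auto simp: bounded_op_def)
qed

lemma bounded_scale [simp, intro]:
  assumes "bounded_op M" shows "bounded_op (op_scale c M)"
proof -
  obtain A where A: "op_bound M A" using assms by (auto simp: bounded_op_def)
  have "op_bound (op_scale c M) (cmod c * A)" unfolding op_bound_def
  proof (intro conjI allI impI)
    show "0 \<le> cmod c * A" using A by (simp add: op_bound_def)
    fix F :: "'a set" and x y :: "'a \<Rightarrow> complex" assume f: "finite F"
    have "(\<Sum>i\<in>F. \<Sum>j\<in>F. cnj (y i) * op_scale c M i j * x j) = c * (\<Sum>i\<in>F. \<Sum>j\<in>F. cnj (y i) * M i j * x j)"
      by (simp add: op_scale_def sum_distrib_left mult_ac)
    then show "cmod (\<Sum>i\<in>F. \<Sum>j\<in>F. cnj (y i) * op_scale c M i j * x j)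
      \<le> cmod c * A * L2_set (\<lambda>i. cmod (x i)) F * L2_set (\<lambda>i. cmod (y i)) F"
      using A f by (simp add: norm_mult op_bound_def mult.assoc mult_left_mono)
  qed
  then show ?thesis by (auto simp: bounded_op_def)
qed

lemma bounded_diff [simp, intro]:
  assumes "bounded_op M" "bounded_op N" shows "bounded_op (M - N)"
proof -
  have "M - N = M + op_scale (-1) N" by (simp add: op_scale_def fun_eq_iff)
  then show ?thesis using assms by (metis bounded_add bounded_scale)
qed

lemma bounded_sum [intro]: "(\<And>k. k \<in> K \<Longrightarrow> bounded_op (f k)) \<Longrightarrow> bounded_op (\<Sum>k\<in>K. f k)"
  by (induction K rule: infinite_finite_induct) auto

lemma op_mult_summable:
  "bounded_op M \<Longrightarrow> bounded_op N \<Longrightarrow> (\<lambda>j. M i j * N j k) summable_on UNIV"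
  unfolding bounded_op_def using l2_bound_mult(1) op_bound_row op_bound_column by metis

lemma op_mult_add_right:
  "bounded_op M \<Longrightarrow> bounded_op N \<Longrightarrow> bounded_op P \<Longrightarrow> M \<star> (N + P) = M \<star> N + M \<star> P"
  unfolding op_mult_def fun_eq_iff plus_fun_def distrib_left
  by (intro allI infsum_add) (rule op_mult_summable; assumption)+

lemma op_mult_add_left:
  "bounded_op M \<Longrightarrow> bounded_op N \<Longrightarrow> bounded_op P \<Longrightarrow> (M + N) \<star> P = M \<star> P + N \<star> P"
  unfolding op_mult_def fun_eq_iff plus_fun_def distrib_right
  by (intro allI infsum_add) (rule op_mult_summable; assumption)+

lemma op_mult_scale_left [simp]: "op_scale c M \<star> N = op_scale c (M \<star> N)"
  unfolding op_mult_def op_scale_def mult.assoc infsum_cmult_right' ..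

lemma op_mult_scale_right [simp]: "M \<star> op_scale c N = op_scale c (M \<star> N)"
  unfolding op_mult_def op_scale_def mult.left_commute[of _ c] infsum_cmult_right' ..

lemma op_mult_zero [simp]: "M \<star> 0 = 0" "0 \<star> M = 0"
  by (simp_all add: op_mult_def fun_eq_iff)

lemma op_adj_mult: "op_adj (M \<star> N) = op_adj N \<star> op_adj M"
  unfolding op_mult_def op_adj_def infsum_cnj[symmetric] complex_cnj_mult mult.commute[of "cnj (M _ _)"] ..

lemma op_adj_simps [simp]:
  "op_adj (op_adj M) = M" "op_adj (M + N) = op_adj M + op_adj N" "op_adj 0 = 0"
  "op_adj (op_scale c M) = op_scale (cnj c) (op_adj M)"
  by (simp_all add: op_adj_def op_scale_def fun_eq_iff)

lemma op_mult_sum_right: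
  "bounded_op M \<Longrightarrow> (\<And>k. k \<in> K \<Longrightarrow> bounded_op (f k)) \<Longrightarrow> M \<star> (\<Sum>k\<in>K. f k) = (\<Sum>k\<in>K. M \<star> f k)"
  by (induction K rule: infinite_finite_induct) (auto simp: op_mult_add_right bounded_sum)

section \<open>Tensor products and finite-dimensional spaces of operators\<close>

text \<open>
  Apply \<open>N\<close> in every fibre of the first index, then \<open>M\<close> in every fibre of the second. It suffices to
  treat rectangles, since a finite set of pairs is contained in one.
\<close>

lemma bounded_tensor [simp, intro]:
  assumes "bounded_op M" "bounded_op N" shows "bounded_op (M \<boxtimes> N)"
proof -
  obtain A B where M: "op_bound M A" and N: "op_bound N B" using assms by (auto simp: bounded_op_def)
  have AB: "0 \<le> A" "0 \<le> B" using M N by (auto simp: op_bound_def)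
  have sq: "(L2_set f S)\<^sup>2 = (\<Sum>i\<in>S. (f i)\<^sup>2)" for f :: "'z \<Rightarrow> real" and S
    by (simp add: L2_set_def sum_nonneg)
  have sqM: "(\<Sum>i\<in>F'. (cmod (\<Sum>j\<in>F. M i j * x j))\<^sup>2) \<le> A\<^sup>2 * (\<Sum>j\<in>F. (cmod (x j))\<^sup>2)"
    if "finite F" "finite F'" for F F' x
    using power_mono[OF op_bound_apply[OF M that, of x], of 2] by (simp add: power_mult_distrib sq)
  have sqN: "(\<Sum>i\<in>F'. (cmod (\<Sum>j\<in>F. N i j * x j))\<^sup>2) \<le> B\<^sup>2 * (\<Sum>j\<in>F. (cmod (x j))\<^sup>2)"
    if "finite F" "finite F'" for F F' x
    using power_mono[OF op_bound_apply[OF N that, of x], of 2] by (simp add: power_mult_distrib sq)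
  have "op_bound (M \<boxtimes> N) (A * B)" unfolding op_bound_iff
  proof (intro conjI allI impI)
    show "0 \<le> A * B" using AB by simp
    fix F F' :: "('a \<times> 'b) set" and x :: "'a \<times> 'b \<Rightarrow> complex" assume f: "finite F" "finite F'"
    define S T S' T' where "S = fst ` F" "T = snd ` F" "S' = fst ` F'" "T' = snd ` F'"
    have fin: "finite S" "finite T" "finite S'" "finite T'" using f by (auto simp: S_T_S'_T'_def)
    have sub: "F \<subseteq> S \<times> T" "F' \<subseteq> S' \<times> T'" by (force simp: S_T_S'_T'_def)+
    define x' where "x' p = (if p \<in> F then x p else 0)" for p
    define z where "z j k = (\<Sum>l\<in>T. N k l * x' (j, l))" for j k
    have e: "(\<Sum>q\<in>F. (M \<boxtimes> N) (i, k) q * x q) = (\<Sum>j\<in>S. M i j * z j k)" for i k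
    proof -
      have "(\<Sum>q\<in>F. (M \<boxtimes> N) (i, k) q * x q) = (\<Sum>q\<in>S \<times> T. (M \<boxtimes> N) (i, k) q * x' q)"
        using sub fin by (intro sum.mono_neutral_cong_left) (auto simp: x'_def)
      also have "\<dots> = (\<Sum>j\<in>S. \<Sum>l\<in>T. (M \<boxtimes> N) (i, k) (j, l) * x' (j, l))"
        by (simp add: sum.cartesian_product)
      also have "\<dots> = (\<Sum>j\<in>S. M i j * z j k)"
        by (simp add: tensor_def z_def sum_distrib_left mult.assoc)
      finally show ?thesis .
    qed
    have "(\<Sum>p\<in>F'. (cmod (\<Sum>q\<in>F. (M \<boxtimes> N) p q * x q))\<^sup>2)
       \<le> (\<Sum>p\<in>S' \<times> T'. (cmod (\<Sum>q\<in>F. (M \<boxtimes> N) p q * x q))\<^sup>2)"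
      using sub fin by (intro sum_mono2) auto
    also have "\<dots> = (\<Sum>i\<in>S'. \<Sum>k\<in>T'. (cmod (\<Sum>j\<in>S. M i j * z j k))\<^sup>2)"
      by (simp add: sum.cartesian_product case_prod_unfold flip: e)
    also have "\<dots> = (\<Sum>k\<in>T'. \<Sum>i\<in>S'. (cmod (\<Sum>j\<in>S. M i j * z j k))\<^sup>2)"
      by (rule sum.swap)
    also have "\<dots> \<le> (\<Sum>k\<in>T'. A\<^sup>2 * (\<Sum>j\<in>S. (cmod (z j k))\<^sup>2))"
      by (intro sum_mono sqM fin)
    also have "\<dots> = A\<^sup>2 * (\<Sum>j\<in>S. \<Sum>k\<in>T'. (cmod (z j k))\<^sup>2)"
      by (subst sum.swap) (simp add: sum_distrib_left)
    also have "\<dots> \<le> A\<^sup>2 * (\<Sum>j\<in>S. B\<^sup>2 * (\<Sum>l\<in>T. (cmod (x' (j, l)))\<^sup>2))"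
      unfolding z_def by (intro mult_left_mono sum_mono sqN fin) auto
    also have "\<dots> = (A * B)\<^sup>2 * (\<Sum>q\<in>S \<times> T. (cmod (x' q))\<^sup>2)"
      by (simp add: sum.cartesian_product sum_distrib_left power_mult_distrib mult.assoc case_prod_unfold)
    also have "(\<Sum>q\<in>S \<times> T. (cmod (x' q))\<^sup>2) = (\<Sum>q\<in>F. (cmod (x q))\<^sup>2)"
      using sub fin by (intro sum.mono_neutral_cong_right) (auto simp: x'_def)
    finally have "(L2_set (\<lambda>p. cmod (\<Sum>q\<in>F. (M \<boxtimes> N) p q * x q)) F')\<^sup>2
        \<le> (A * B * L2_set (\<lambda>q. cmod (x q)) F)\<^sup>2"
      by (simp add: sq power_mult_distrib)
    then show "L2_set (\<lambda>p. cmod (\<Sum>q\<in>F. (M \<boxtimes> N) p q * x q)) F' \<le> A * B * L2_set (\<lambda>q. cmod (x q)) F"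
      by (rule power2_le_imp_le) (use AB in simp)
  qed
  then show ?thesis by (auto simp: bounded_op_def)
qed

lemma tensor_mult:
  assumes "bounded_op a" "bounded_op b" "bounded_op c" "bounded_op d"
  shows "(a \<boxtimes> b) \<star> (c \<boxtimes> d) = (a \<star> c) \<boxtimes> (b \<star> d)"
proof -
  have "(\<Sum>\<^sub>\<infinity>q. (a \<boxtimes> b) (i, k) q * (c \<boxtimes> d) q (i', k'))
      = (\<Sum>\<^sub>\<infinity>j. a i j * c j i') * (\<Sum>\<^sub>\<infinity>l. b k l * d l k')" for i k i' k'
  proof -
    let ?f = "\<lambda>q. (a \<boxtimes> b) (i, k) q * (c \<boxtimes> d) q (i', k')"
    have s: "?f summable_on UNIV" by (rule op_mult_summable) (use assms in auto)
    have "infsum ?f UNIV = infsum ?f (Sigma UNIV (\<lambda>_. UNIV))" by simp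
    also have "\<dots> = (\<Sum>\<^sub>\<infinity>j. \<Sum>\<^sub>\<infinity>l. ?f (j, l))"
      by (rule infsum_Sigma_banach[symmetric]) (use s in simp)
    also have "\<dots> = (\<Sum>\<^sub>\<infinity>j. (a i j * c j i') * (\<Sum>\<^sub>\<infinity>l. b k l * d l k'))"
      by (simp add: tensor_def mult_ac flip: infsum_cmult_right')
    also have "\<dots> = (\<Sum>\<^sub>\<infinity>j. a i j * c j i') * (\<Sum>\<^sub>\<infinity>l. b k l * d l k')"
      by (simp add: infsum_cmult_left')
    finally show ?thesis .
  qed
  then show ?thesis by (simp add: op_mult_def fun_eq_iff tensor_def split_paired_all)
qed

lemmas tensor_expand = op_mult_add_left op_mult_add_right tensor_mult

lemma tensor_simps [simp]:
  "(a + a') \<boxtimes> b = a \<boxtimes> b + a' \<boxtimes> b" "a \<boxtimes> (b + b') = a \<boxtimes> b + a \<boxtimes> b'"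
  "op_scale c a \<boxtimes> b = op_scale c (a \<boxtimes> b)" "a \<boxtimes> op_scale c b = op_scale c (a \<boxtimes> b)"
  "0 \<boxtimes> b = 0" "a \<boxtimes> 0 = 0" "op_adj (a \<boxtimes> b) = op_adj a \<boxtimes> op_adj b"
  by (auto simp: tensor_def op_scale_def op_adj_def fun_eq_iff algebra_simps)

lemma left_block_simps [simp]:
  "left_block (x + y) j j' = left_block x j j' + left_block y j j'"
  "left_block (op_scale c x) j j' = op_scale c (left_block x j j')"
  "left_block (a \<boxtimes> b) j j' = op_scale (b j j') a"
  "left_block 0 j j' = 0"
  by (auto simp: left_block_def tensor_def op_scale_def fun_eq_iff)

lemma right_block_simps [simp]:
  "right_block (x + y) i i' = right_block x i i' + right_block y i i'"
  "right_block (op_scale c x) i i' = op_scale c (right_block x i i')"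
  "right_block (a \<boxtimes> b) i i' = op_scale (a i i') b"
  "right_block 0 i i' = 0"
  by (auto simp: right_block_def tensor_def op_scale_def fun_eq_iff)

lemma sum_fun_eval: "(\<Sum>k\<in>K. f k) i = (\<Sum>k\<in>K. f k i)" for f :: "'k \<Rightarrow> 'i \<Rightarrow> 'c :: comm_monoid_add"
  by (induction K rule: infinite_finite_induct) simp_all

lemma right_block_sum [simp]: "right_block (\<Sum>k\<in>K. f k) i i' = (\<Sum>k\<in>K. right_block (f k) i i')"
  by (simp add: right_block_def fun_eq_iff sum_fun_eval)

lemma op_scale_simps [simp]:
  "op_scale 1 a = a" "op_scale c 0 = 0" "op_scale c (op_scale d a) = op_scale (c * d) a"
  by (auto simp: op_scale_def fun_eq_iff)

lemma has_sum_sum: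
  fixes f :: "'k \<Rightarrow> 'i \<Rightarrow> complex"
  assumes "\<And>k. k \<in> K \<Longrightarrow> (f k has_sum s k) A"
  shows "((\<lambda>i. \<Sum>k\<in>K. f k i) has_sum (\<Sum>k\<in>K. s k)) A"
  using assms by (induction K rule: infinite_finite_induct) (auto intro!: has_sum_add)

lemma op_norm_entry: "bounded_op M \<Longrightarrow> cmod (M i j) \<le> op_norm M"
  unfolding op_norm_def bounded_op_def by (rule cInf_greatest) (auto intro: op_bound_entry)

lemma op_norm_zero [simp]: "op_norm (0 :: 'i opr) = 0"
proof -
  have "Collect (op_bound (0 :: 'i opr)) = {0..}" by (auto simp: op_bound_def intro!: mult_nonneg_nonneg)
  moreover have "Inf {0 :: real..} = 0" by (rule cInf_atLeast)
  ultimately show ?thesis unfolding op_norm_def by (simp only:)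
qed

lemma op_closure_superset: "(\<And>x. x \<in> X \<Longrightarrow> bounded_op x) \<Longrightarrow> X \<subseteq> op_closure X"
  unfolding op_closure_def by (force intro: bexI[of _ x for x])

lemma op_span_induct [consumes 1, case_names zero base add scale]:
  assumes "x \<in> op_span B" "P 0" "\<And>x. x \<in> B \<Longrightarrow> P x"
    "\<And>x y. P x \<Longrightarrow> P y \<Longrightarrow> P (x + y)" "\<And>c x. P x \<Longrightarrow> P (op_scale c x)"
  shows "P x"
  using assms(1) by (rule op.span_induct_alt[where h=P]) (auto intro: assms)

lemma op_span_bounded: "(\<And>x. x \<in> B \<Longrightarrow> bounded_op x) \<Longrightarrow> x \<in> op_span B \<Longrightarrow> bounded_op x"
  by (erule op_span_induct[where P=bounded_op]) auto

text \<open>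
  A finite-dimensional space of matrices is the range of a projection each of whose matrix entries
  is a linear combination of finitely many entries of the argument. One generator is added
  at a time: the part \<open>w\<close> of a new generator that is not yet reached has a nonzero entry
  \<open>(k, l)\<close>, and reading off that entry gives the next coefficient. Such a projection is continuous
  for entrywise convergence, which is all that closedness requires.
\<close>

lemma finite_rank_projection:
  assumes "finite B"
  shows "\<exists>T P c. finite P \<and> (\<forall>v \<in> op_span B. T v = v) \<and> (\<forall>M. T M \<in> op_span B) \<and>
    (\<forall>M i j. T M i j = (\<Sum>p\<in>P. c i j p * M (fst p) (snd p)))"
  using assms
proof (induction B)
  case empty
  show ?case
    by (intro exI[of _ "\<lambda>_. 0"] exI[of _ "{}"]) (auto simp: fun_eq_iff)
next
  case (insert v B)
  then obtain T P c where P: "finite P" and T: "\<And>v. v \<in> op_span B \<Longrightarrow> T v = v" "\<And>M. T M \<in> op_span B"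
    and c: "\<And>M i j. T M i j = (\<Sum>p\<in>P. c i j p * M (fst p) (snd p))" by blast
  show ?case
  proof (cases "v \<in> op_span B")
    case True
    then have "op_span (insert v B) = op_span B" by (simp add: op.span_redundant)
    show ?thesis unfolding \<open>op_span (insert v B) = op_span B\<close>
      by (intro exI[of _ T] exI[of _ P] exI[of _ c] conjI ballI allI P T c)
  next
    case False
    define w where "w = v - T v"
    have w: "w \<in> op_span (insert v B)" unfolding w_def
      using T(2) op.span_mono[of B "insert v B"] by (intro op.span_diff) (auto simp: op.span_base)
    have "w \<noteq> 0" using False T(2)[of v] by (auto simp: w_def)
    then obtain k l where kl: "w k l \<noteq> 0" by (auto simp: fun_eq_iff)
    define T' where "T' M = T M + op_scale ((M k l - T M k l) / w k l) w" for M
    define P' where "P' = insert (k, l) P"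
    define c' where "c' i j p = (if p \<in> P then c i j p else 0)
        + ((if p = (k, l) then 1 else 0) - (if p \<in> P then c k l p else 0)) / w k l * w i j" for i j p
    have lin: "T' (x + y) = T' x + T' y" "T' (op_scale d x) = op_scale d (T' x)" for x y d
      by (auto simp: T'_def fun_eq_iff op_scale_def c algebra_simps sum.distrib sum_distrib_left diff_divide_distrib add_divide_distrib)
    have B: "T' x = x" if "x \<in> op_span B" for x using T(1)[OF that] by (simp add: T'_def)
    have v: "T' v = v" using kl by (simp add: T'_def w_def[symmetric]) (simp add: w_def fun_eq_iff)
    have "T' x = x" if "x \<in> op_span (insert v B)" for x
    proof (rule op.span_induct_alt[OF that, of "\<lambda>x. T' x = x"])
      show "T' 0 = 0" by (rule B) (rule op.span_zero)
      fix d x y assume "x \<in> insert v B" and y: "T' y = y"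
      then have "T' x = x" using v B[of x] by (auto simp: op.span_base)
      with y show "T' (op_scale d x + y) = op_scale d x + y" by (simp only: lin)
    qed
    moreover have "T' M \<in> op_span (insert v B)" for M unfolding T'_def
      using T(2)[of M] op.span_mono[of B "insert v B"] w by (intro op.span_add op.span_scale) auto
    moreover have "T' M i j = (\<Sum>p\<in>P'. c' i j p * M (fst p) (snd p))" for M i j
    proof -
      have s: "(\<Sum>p\<in>P'. (if p \<in> P then d p else 0) * M (fst p) (snd p)) = (\<Sum>p\<in>P. d p * M (fst p) (snd p))" for d
        using P by (intro sum.mono_neutral_cong_right) (auto simp: P'_def)
      have s': "(\<Sum>p\<in>P'. (if p = (k, l) then 1 else 0) * M (fst p) (snd p)) = M k l"
        using P by (subst sum.mono_neutral_cong_right[where S="{(k, l)}"]) (auto simp: P'_def)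
      have "(\<Sum>p\<in>P'. c' i j p * M (fst p) (snd p))
         = (\<Sum>p\<in>P'. (if p \<in> P then c i j p else 0) * M (fst p) (snd p))
         + ((\<Sum>p\<in>P'. (if p = (k, l) then 1 else 0) * M (fst p) (snd p))
          - (\<Sum>p\<in>P'. (if p \<in> P then c k l p else 0) * M (fst p) (snd p))) * (w i j / w k l)"
        unfolding c'_def by (simp only: sum_distrib_right sum.distrib sum_subtractf distrib_right
            left_diff_distrib diff_divide_distrib) (simp add: mult_ac flip: sum.distrib sum_subtractf)
      also have "\<dots> = T' M i j" unfolding s s' by (simp add: T'_def op_scale_def c)
      finally show ?thesis by simp
    qed
    moreover have "finite P'" using P by (simp add: P'_def)
    ultimately show ?thesis by (intro exI[of _ T'] exI[of _ P'] exI[of _ c'] conjI ballI allI)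
  qed
qed

lemma op_closure_finite_span:
  assumes fin: "finite B" and bd: "\<And>x. x \<in> B \<Longrightarrow> bounded_op x"
  shows "op_closure (op_span B) = op_span B"
proof
  have bs: "bounded_op x" if "x \<in> op_span B" for x using op_span_bounded[OF bd that] .
  then show "op_span B \<subseteq> op_closure (op_span B)" by (rule op_closure_superset)
  show "op_closure (op_span B) \<subseteq> op_span B"
  proof
    fix M assume M: "M \<in> op_closure (op_span B)"
    obtain T P c where P: "finite P" and T: "\<And>v. v \<in> op_span B \<Longrightarrow> T v = v" "\<And>M. T M \<in> op_span B"
      and c: "\<And>M i j. T M i j = (\<Sum>p\<in>P. c i j p * M (fst p) (snd p))"
      using finite_rank_projection[OF fin] by blast
    have "M i j = T M i j" for i j
    proof -
      define C where "C = (\<Sum>p\<in>P. cmod (c i j p))"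
      have C: "0 \<le> C" by (simp add: C_def sum_nonneg)
      have "cmod (M i j - T M i j) \<le> 0"
      proof (rule field_le_epsilon)
        fix e :: real assume e: "e > 0"
        then have "e / (1 + C) > 0" using C by simp
        then obtain N where N: "N \<in> op_span B" "op_norm (M - N) < e / (1 + C)"
          using M by (auto simp: op_closure_def)
        have "bounded_op (M - N)" using M bs[OF N(1)] by (auto simp: op_closure_def)
        then have en: "cmod (M k l - N k l) \<le> e / (1 + C)" for k l
          using op_norm_entry[of "M - N" k l] N(2) by simp
        have "T M i j - N i j = (\<Sum>p\<in>P. c i j p * (M (fst p) (snd p) - N (fst p) (snd p)))"
          using T(1)[OF N(1)] c[of N i j] by (simp add: c right_diff_distrib sum_subtractf)
        also have "cmod \<dots> \<le> (\<Sum>p\<in>P. cmod (c i j p) * (e / (1 + C)))"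
          by (rule order_trans[OF norm_sum]) (unfold norm_mult, intro sum_mono mult_left_mono en norm_ge_zero)
        also have "\<dots> = C * (e / (1 + C))" unfolding C_def by (rule sum_distrib_right[symmetric])
        finally have "cmod (T M i j - N i j) \<le> C * (e / (1 + C))" .
        then have "cmod ((M i j - N i j) - (T M i j - N i j)) \<le> e / (1 + C) + C * (e / (1 + C))"
          by (rule order_trans[OF norm_triangle_ineq4 add_mono[OF en]])
        also have "\<dots> = (1 + C) * (e / (1 + C))" by (simp only: distrib_right mult_1)
        also have "\<dots> = e" using C by simp
        finally show "cmod (M i j - T M i j) \<le> 0 + e" by simp
      qed
      then show ?thesis by simp
    qed
    then have "M = T M" by (simp add: fun_eq_iff)
    then show "M \<in> op_span B" using T(2) by metis
  qed
qed

lemma unit_of_eq: "is_op_unit A e \<Longrightarrow> unit_of A = e"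
  unfolding unit_of_def is_op_unit_def by (rule the_equality) metis+

lemma unit_of_is_unit: "unital_cstar_algebra A \<Longrightarrow> is_op_unit A (unit_of A)"
  unfolding unital_cstar_algebra_def using unit_of_eq by metis

text \<open>
  A matrix whose columns are orthogonal, of norm 0 or 1, is a partial isometry. All unitaries below,
  including those of a group algebra whose unit is a proper projection, are bounded for this reason.
\<close>

lemma diagonal_isometry_bounded:
  fixes U :: "'i opr"
  assumes U: "\<And>i j. ((\<lambda>k. cnj (U k i) * U k j) has_sum (if i = j then d i else 0)) UNIV"
    and d: "\<And>i. d i \<in> {0, 1}"
  shows "bounded_op U"
proof -
  have "op_bound U 1" unfolding op_bound_iff
  proof (intro conjI allI impI)
    fix F F' :: "'i set" and x :: "'i \<Rightarrow> complex" assume f: "finite F" "finite F'"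
    define z where "z k = (\<Sum>j\<in>F. U k j * x j)" for k
    have z: "cnj (z k) * z k = (\<Sum>i\<in>F. \<Sum>j\<in>F. (cnj (x i) * x j) * (cnj (U k i) * U k j))" for k
      unfolding z_def cnj_sum sum_product by (simp add: mult_ac)
    have "((\<lambda>k. cnj (z k) * z k) has_sum (\<Sum>i\<in>F. \<Sum>j\<in>F. (cnj (x i) * x j) * (if i = j then d i else 0))) UNIV"
      unfolding z by (intro has_sum_sum has_sum_cmult_right U)
    also have "(\<Sum>i\<in>F. \<Sum>j\<in>F. (cnj (x i) * x j) * (if i = j then d i else 0)) = (\<Sum>i\<in>F. cnj (x i) * x i * d i)"
      using f(1) by (simp add: if_distrib[of "\<lambda>t. _ * t"] cong: if_cong)
    finally have "((\<lambda>k. Re (cnj (z k) * z k)) has_sum Re (\<Sum>i\<in>F. cnj (x i) * x i * d i)) UNIV"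
      by (rule has_sum_Re)
    moreover have zz: "Re (cnj c * c) = (cmod c)\<^sup>2" for c
      by (metis Re_complex_of_real complex_norm_square mult.commute)
    ultimately have h: "((\<lambda>k. (cmod (z k))\<^sup>2) has_sum Re (\<Sum>i\<in>F. cnj (x i) * x i * d i)) UNIV" by (simp only:)
    have "(\<Sum>k\<in>F'. (cmod (z k))\<^sup>2) \<le> Re (\<Sum>i\<in>F. cnj (x i) * x i * d i)"
      by (rule finite_sum_le_has_sum[OF h f(2)]) auto
    also have "\<dots> = (\<Sum>i\<in>F. Re (cnj (x i) * x i * d i))" by simp
    also have "\<dots> \<le> (\<Sum>i\<in>F. (cmod (x i))\<^sup>2)"
    proof (rule sum_mono)
      fix i show "Re (cnj (x i) * x i * d i) \<le> (cmod (x i))\<^sup>2"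
        using d[of i] zz[of "x i"] by auto
    qed
    finally have "(\<Sum>k\<in>F'. (cmod (z k))\<^sup>2) \<le> (\<Sum>i\<in>F. (cmod (x i))\<^sup>2)" .
    then show "L2_set (\<lambda>i. cmod (\<Sum>j\<in>F. U i j * x j)) F' \<le> 1 * L2_set (\<lambda>j. cmod (x j)) F"
      by (simp add: z_def L2_set_def)
  qed simp
  then show ?thesis by (auto simp: bounded_op_def)
qed

section \<open>C*-algebras spanned by a finite multiplicative family\<close>

text \<open>
  Homomorphisms between C*-algebras are total functions of matrices whose behaviour is
  specified on the algebra only, so linearity is relative to a subspace.
\<close>

definition linear_on :: "'i opr set \<Rightarrow> ('i opr \<Rightarrow> 'j opr) \<Rightarrow> bool"
  where "linear_on W f \<longleftrightarrow> (\<forall>x\<in>W. \<forall>y\<in>W. f (x + y) = f x + f y) \<and>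
    (\<forall>c. \<forall>x\<in>W. f (op_scale c x) = op_scale c (f x))"

lemma linear_onD:
  assumes "linear_on W f"
  shows "x \<in> W \<Longrightarrow> y \<in> W \<Longrightarrow> f (x + y) = f x + f y"
    "x \<in> W \<Longrightarrow> f (op_scale c x) = op_scale c (f x)"
  using assms by (auto simp: linear_on_def)

lemma linear_on_zero: "linear_on W f \<Longrightarrow> 0 \<in> W \<Longrightarrow> f 0 = 0"
  using linear_onD(2)[of W f 0 0] by simp

lemma star_hom_linear: "unital_star_hom A B f \<Longrightarrow> linear_on A f"
  by (simp add: unital_star_hom_def linear_on_def)

lemma linear_on_mono: "linear_on W f \<Longrightarrow> V \<subseteq> W \<Longrightarrow> linear_on V f"
  unfolding linear_on_def by blast

lemma linear_on_eq:
  assumes "linear_on (op_span B) f" "linear_on (op_span B) g" "\<And>x. x \<in> B \<Longrightarrow> f x = g x"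
    and "x \<in> op_span B"
  shows "f x = g x"
proof -
  have "x \<in> op_span B \<and> f x = g x" using assms(4)
    by (rule op_span_induct[where P="\<lambda>x. x \<in> op_span B \<and> f x = g x"])
      (auto simp: linear_onD[OF assms(1)] linear_onD[OF assms(2)] assms(3) op.span_zero op.span_base
        op.span_add op.span_scale linear_on_zero[OF assms(1)] linear_on_zero[OF assms(2)])
  then show ?thesis by simp
qed

text \<open>
  The maps \<open>tensor_id\<close> and \<open>id_tensor\<close> apply a function to the blocks of a matrix; they are
  additive at matrices all of whose blocks lie in the domain of linearity of that function.
\<close>

definition left_in :: "'i opr set \<Rightarrow> ('i \<times> 'j) opr \<Rightarrow> bool"
  where "left_in W X \<longleftrightarrow> (\<forall>j j'. left_block X j j' \<in> W)"

definition right_in :: "'j opr set \<Rightarrow> ('i \<times> 'j) opr \<Rightarrow> bool"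
  where "right_in W X \<longleftrightarrow> (\<forall>i i'. right_block X i i' \<in> W)"

lemma left_in_intros:
  assumes "op_subspace W"
  shows "a \<in> W \<Longrightarrow> left_in W (a \<boxtimes> b)" "left_in W X \<Longrightarrow> left_in W Y \<Longrightarrow> left_in W (X + Y)"
    "left_in W X \<Longrightarrow> left_in W (op_scale c X)" "left_in W 0"
  using assms by (auto simp: left_in_def op.subspace_def)

lemma right_in_intros:
  assumes "op_subspace W"
  shows "b \<in> W \<Longrightarrow> right_in W (a \<boxtimes> b)" "right_in W X \<Longrightarrow> right_in W Y \<Longrightarrow> right_in W (X + Y)"
    "right_in W X \<Longrightarrow> right_in W (op_scale c X)" "right_in W 0"
  using assms by (auto simp: right_in_def op.subspace_def)

lemma tensor_id_linear:
  assumes "linear_on W f"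
  shows "left_in W X \<Longrightarrow> left_in W Y \<Longrightarrow> tensor_id f (X + Y) = tensor_id f X + tensor_id f Y"
    "left_in W X \<Longrightarrow> tensor_id f (op_scale c X) = op_scale c (tensor_id f X)"
    "a \<in> W \<Longrightarrow> tensor_id f (a \<boxtimes> b) = f a \<boxtimes> b"
    "0 \<in> W \<Longrightarrow> tensor_id f 0 = 0"
proof -
  show "tensor_id f (X + Y) = tensor_id f X + tensor_id f Y" if "left_in W X" "left_in W Y"
    using that by (auto simp: tensor_id_def left_in_def linear_onD[OF assms] fun_eq_iff)
  show "tensor_id f (op_scale c X) = op_scale c (tensor_id f X)" if "left_in W X"
    using that by (simp add: tensor_id_def left_in_def linear_onD[OF assms]) (simp add: op_scale_def fun_eq_iff)
  show "tensor_id f (a \<boxtimes> b) = f a \<boxtimes> b" if "a \<in> W"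
    using that by (simp add: tensor_id_def linear_onD[OF assms]) (simp add: op_scale_def tensor_def fun_eq_iff)
  show "tensor_id f 0 = 0" if "0 \<in> W"
    by (simp add: tensor_id_def linear_on_zero[OF assms that]) (simp add: fun_eq_iff)
qed

lemma id_tensor_linear:
  assumes "linear_on W f"
  shows "right_in W X \<Longrightarrow> right_in W Y \<Longrightarrow> id_tensor f (X + Y) = id_tensor f X + id_tensor f Y"
    "right_in W X \<Longrightarrow> id_tensor f (op_scale c X) = op_scale c (id_tensor f X)"
    "b \<in> W \<Longrightarrow> id_tensor f (a \<boxtimes> b) = a \<boxtimes> f b"
    "0 \<in> W \<Longrightarrow> id_tensor f 0 = 0"
proof -
  show "id_tensor f (X + Y) = id_tensor f X + id_tensor f Y" if "right_in W X" "right_in W Y"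
    using that by (auto simp: id_tensor_def right_in_def linear_onD[OF assms] fun_eq_iff)
  show "id_tensor f (op_scale c X) = op_scale c (id_tensor f X)" if "right_in W X"
    using that by (simp add: id_tensor_def right_in_def linear_onD[OF assms]) (simp add: op_scale_def fun_eq_iff)
  show "id_tensor f (a \<boxtimes> b) = a \<boxtimes> f b" if "b \<in> W"
    using that by (simp add: id_tensor_def linear_onD[OF assms]) (simp add: op_scale_def tensor_def fun_eq_iff)
  show "id_tensor f 0 = 0" if "0 \<in> W"
    by (simp add: id_tensor_def linear_on_zero[OF assms that]) (simp add: fun_eq_iff)
qed

lemma reassoc_simps [simp]:
  "reassoc (X + Y) = reassoc X + reassoc Y" "reassoc (op_scale c X) = op_scale c (reassoc X)"
  "reassoc (a \<boxtimes> b \<boxtimes> d) = (a \<boxtimes> b) \<boxtimes> d" "reassoc 0 = 0"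
  by (auto simp: reassoc_def tensor_def op_scale_def fun_eq_iff)

definition tensor_set :: "'i opr set \<Rightarrow> 'j opr set \<Rightarrow> ('i \<times> 'j) opr set"
  where "tensor_set A B = (\<lambda>(a, b). a \<boxtimes> b) ` (A \<times> B)"

lemma tensor_setI: "a \<in> A \<Longrightarrow> b \<in> B \<Longrightarrow> a \<boxtimes> b \<in> tensor_set A B"
  by (auto simp: tensor_set_def)

lemma tensor_in_span:
  assumes "a \<in> op_span A" "b \<in> op_span B" shows "a \<boxtimes> b \<in> op_span (tensor_set A B)"
proof -
  have "a' \<boxtimes> b \<in> op_span (tensor_set A B)" if "a' \<in> A" for a'
    using assms(2)
    by (rule op_span_induct[where P="\<lambda>b. a' \<boxtimes> b \<in> op_span (tensor_set A B)"])
      (auto intro: op.span_zero op.span_add op.span_scale op.span_base tensor_setI that)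
  with assms(1) show ?thesis
    by (rule_tac op_span_induct[where P="\<lambda>a. a \<boxtimes> b \<in> op_span (tensor_set A B)"])
      (auto intro: op.span_zero op.span_add op.span_scale)
qed

lemma alg_tensor_span: "alg_tensor (op_span A) (op_span B) = op_span (tensor_set A B)"
proof
  show "alg_tensor (op_span A) (op_span B) \<subseteq> op_span (tensor_set A B)"
    unfolding alg_tensor_def
    by (rule op.span_minimal) (auto intro: tensor_in_span op.subspace_span)
  show "op_span (tensor_set A B) \<subseteq> alg_tensor (op_span A) (op_span B)"
    unfolding alg_tensor_def
    by (rule op.span_mono) (force simp: tensor_set_def intro: op.span_base)
qed

lemma tensor_span_blocks:
  assumes "X \<in> op_span (tensor_set A B)"
  shows "left_in (op_span A) X" "right_in (op_span B) X"
proof -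
  have "left_in (op_span A) X \<and> right_in (op_span B) X"
    using assms
    by (rule op_span_induct[where P="\<lambda>X. left_in (op_span A) X \<and> right_in (op_span B) X"])
      (auto simp: tensor_set_def left_in_intros[OF op.subspace_span] right_in_intros[OF op.subspace_span] op.span_base)
  then show "left_in (op_span A) X" "right_in (op_span B) X" by auto
qed

lemma finite_tensor_set: "finite A \<Longrightarrow> finite B \<Longrightarrow> finite (tensor_set A B)"
  by (simp add: tensor_set_def)

lemma bounded_tensor_set:
  "(\<And>x. x \<in> A \<Longrightarrow> bounded_op x) \<Longrightarrow> (\<And>x. x \<in> B \<Longrightarrow> bounded_op x) \<Longrightarrow> x \<in> tensor_set A B \<Longrightarrow> bounded_op x"
  by (auto simp: tensor_set_def)

lemma spatial_tensor_finite_span: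
  assumes "finite A" "finite B" "\<And>x. x \<in> A \<Longrightarrow> bounded_op x" "\<And>x. x \<in> B \<Longrightarrow> bounded_op x"
  shows "spatial_tensor (op_span A) (op_span B) = op_span (tensor_set A B)"
  unfolding spatial_tensor_def alg_tensor_span
  by (rule op_closure_finite_span) (use assms in \<open>auto intro: finite_tensor_set bounded_tensor_set\<close>)

text \<open>
  Apart from the test objects, all C*-algebras here are finite dimensional, and their structure is
  determined on a finite set \<open>B\<close> of operators; \<open>B\<close> need not be linearly independent. Closedness,
  being an algebra and being a homomorphism are reduced to checks on \<open>B\<close> once and for all.
\<close>

locale star_basis =
  fixes B :: "'i opr set" and e :: "'i opr"
  assumes fin: "finite B" and bounded: "x \<in> B \<Longrightarrow> bounded_op x"
    and mult: "x \<in> B \<Longrightarrow> y \<in> B \<Longrightarrow> x \<star> y \<in> op_span B"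
    and adj: "x \<in> B \<Longrightarrow> op_adj x \<in> op_span B"
    and unit: "e \<in> op_span B" "x \<in> B \<Longrightarrow> e \<star> x = x" "x \<in> B \<Longrightarrow> x \<star> e = x"
begin

lemma span_bounded: "x \<in> op_span B \<Longrightarrow> bounded_op x"
  by (rule op_span_bounded[OF bounded])

lemma span_induct_mem [consumes 1, case_names zero base add scale]:
  assumes "x \<in> op_span B" "P 0" "\<And>x. x \<in> B \<Longrightarrow> P x"
    "\<And>x y. x \<in> op_span B \<Longrightarrow> y \<in> op_span B \<Longrightarrow> P x \<Longrightarrow> P y \<Longrightarrow> P (x + y)"
    "\<And>c x. x \<in> op_span B \<Longrightarrow> P x \<Longrightarrow> P (op_scale c x)"
  shows "P x"
proof -
  have "x \<in> op_span B \<and> P x" using assms(1)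
    by (rule op_span_induct[where P="\<lambda>x. x \<in> op_span B \<and> P x"])
      (auto intro: op.span_zero op.span_add op.span_scale op.span_base assms(2-))
  then show ?thesis ..
qed

lemma span_mult:
  assumes x: "x \<in> op_span B" and y: "y \<in> op_span B" shows "x \<star> y \<in> op_span B"
proof -
  have "b \<star> y \<in> op_span B" if "b \<in> B" for b
    using y
    by (rule span_induct_mem[where P="\<lambda>y. b \<star> y \<in> op_span B"])
      (use that in \<open>auto simp: op_mult_add_right bounded span_bounded intro: op.span_zero op.span_add op.span_scale mult\<close>)
  with x show ?thesis
    by (rule_tac span_induct_mem[where P="\<lambda>x. x \<star> y \<in> op_span B"])
      (use y in \<open>auto simp: op_mult_add_left span_bounded intro: op.span_zero op.span_add op.span_scale\<close>)
qed

lemma span_adj: "x \<in> op_span B \<Longrightarrow> op_adj x \<in> op_span B"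
  by (rule op_span_induct[where P="\<lambda>x. op_adj x \<in> op_span B"])
    (auto intro: op.span_zero op.span_add op.span_scale adj)

lemma is_unit: "is_op_unit (op_span B) e"
  unfolding is_op_unit_def
proof (intro conjI ballI)
  fix x assume x: "x \<in> op_span B"
  show "e \<star> x = x" using x
    by (rule span_induct_mem[where P="\<lambda>x. e \<star> x = x"])
      (use unit in \<open>auto simp: op_mult_add_right span_bounded\<close>)
  show "x \<star> e = x" using x
    by (rule span_induct_mem[where P="\<lambda>x. x \<star> e = x"])
      (use unit in \<open>auto simp: op_mult_add_left span_bounded\<close>)
qed (rule unit)

lemma unit_of_span: "unit_of (op_span B) = e"
  by (rule unit_of_eq[OF is_unit])

lemma closure_span: "op_closure (op_span B) = op_span B"
  by (rule op_closure_finite_span[OF fin bounded])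

lemma unital_cstar: "unital_cstar_algebra (op_span B)"
  unfolding unital_cstar_algebra_def
  using span_bounded span_mult span_adj closure_span is_unit op.subspace_span by blast

lemma star_homI:
  assumes lin: "linear_on (op_span B) f" and C: "op_subspace C"
    and f: "\<And>x. x \<in> B \<Longrightarrow> f x \<in> C" "\<And>x. x \<in> B \<Longrightarrow> bounded_op (f x)"
    and fm: "\<And>x y. x \<in> B \<Longrightarrow> y \<in> B \<Longrightarrow> f (x \<star> y) = f x \<star> f y"
    and fa: "\<And>x. x \<in> B \<Longrightarrow> f (op_adj x) = op_adj (f x)"
    and fe: "f e = unit_of C"
  shows "unital_star_hom (op_span B) C f"
proof -
  have f0: "f 0 = 0" by (rule linear_on_zero[OF lin op.span_zero])
  have fC: "f x \<in> C \<and> bounded_op (f x)" if "x \<in> op_span B" for x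
    using that by (rule span_induct_mem[where P="\<lambda>x. f x \<in> C \<and> bounded_op (f x)"])
      (use C f in \<open>auto simp: linear_onD[OF lin] f0 op.subspace_def\<close>)
  have fm1: "f (b \<star> y) = f b \<star> f y" if b: "b \<in> B" and "y \<in> op_span B" for b y
    using that(2)
  proof (rule span_induct_mem[where P="\<lambda>y. f (b \<star> y) = f b \<star> f y"])
    fix x y assume "x \<in> op_span B" "y \<in> op_span B" "f (b \<star> x) = f b \<star> f x" "f (b \<star> y) = f b \<star> f y"
    then show "f (b \<star> (x + y)) = f b \<star> f (x + y)"
      using b by (simp add: op_mult_add_right bounded span_bounded linear_onD[OF lin] span_mult op.span_base f fC)
  qed (use b in \<open>auto simp: f0 fm linear_onD[OF lin] span_mult op.span_base\<close>)
  have fm2: "f (x \<star> y) = f x \<star> f y" if "x \<in> op_span B" and y: "y \<in> op_span B" for x y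
    using that(1)
  proof (rule span_induct_mem[where P="\<lambda>x. f (x \<star> y) = f x \<star> f y"])
    fix u v assume "u \<in> op_span B" "v \<in> op_span B" "f (u \<star> y) = f u \<star> f y" "f (v \<star> y) = f v \<star> f y"
    then show "f ((u + v) \<star> y) = f (u + v) \<star> f y"
      using y by (simp add: op_mult_add_left span_bounded linear_onD[OF lin] span_mult fC)
  qed (use y in \<open>auto simp: f0 fm1 linear_onD[OF lin] span_mult\<close>)
  have fa2: "f (op_adj x) = op_adj (f x)" if "x \<in> op_span B" for x
    using that by (rule span_induct_mem[where P="\<lambda>x. f (op_adj x) = op_adj (f x)"])
      (auto simp: f0 fa linear_onD[OF lin] span_adj)
  show ?thesis
    unfolding unital_star_hom_def
    using fC fm2 fa2 fe lin unit_of_span by (simp add: linear_on_def)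
qed

end

lemma star_basis_tensor:
  assumes "star_basis A e" "star_basis B f"
  shows "star_basis (tensor_set A B) (e \<boxtimes> f)"
proof -
  interpret A: star_basis A e by fact
  interpret B: star_basis B f by fact
  have eb: "bounded_op e" "bounded_op f" using A.unit(1) A.span_bounded B.unit(1) B.span_bounded by auto
  show ?thesis
  proof
    show "finite (tensor_set A B)" using A.fin B.fin by (rule finite_tensor_set)
    show "e \<boxtimes> f \<in> op_span (tensor_set A B)" using A.unit(1) B.unit(1) by (rule tensor_in_span)
    fix x assume x: "x \<in> tensor_set A B"
    then obtain a b where ab: "x = a \<boxtimes> b" "a \<in> A" "b \<in> B" by (auto simp: tensor_set_def)
    show "bounded_op x" using ab A.bounded B.bounded by simp
    show "op_adj x \<in> op_span (tensor_set A B)" using ab A.adj B.adj by (simp add: tensor_in_span)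
    show "(e \<boxtimes> f) \<star> x = x" "x \<star> (e \<boxtimes> f) = x"
      using ab A.bounded B.bounded A.unit B.unit eb by (simp_all add: tensor_mult)
    fix y assume y: "y \<in> tensor_set A B"
    then obtain c d where cd: "y = c \<boxtimes> d" "c \<in> A" "d \<in> B" by (auto simp: tensor_set_def)
    show "x \<star> y \<in> op_span (tensor_set A B)"
      using ab cd A.bounded B.bounded A.mult B.mult by (simp add: tensor_mult tensor_in_span)
  qed
qed

section \<open>Doubled families over a finite group with an involution\<close>

lemma has_sum_single:
  fixes f :: "'i \<Rightarrow> complex"
  assumes "\<And>j. j \<noteq> j0 \<Longrightarrow> f j = 0"
  shows "(f has_sum f j0) UNIV"
proof -
  have "(f has_sum f j0) {j0} \<longleftrightarrow> (f has_sum f j0) UNIV"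
    by (rule has_sum_cong_neutral) (use assms in auto)
  then show ?thesis by (simp add: has_sum_finiteI)
qed

lemma infsum_single:
  fixes f :: "'i \<Rightarrow> complex"
  assumes "\<And>j. j \<noteq> j0 \<Longrightarrow> f j = 0"
  shows "infsum f UNIV = f j0"
  using has_sum_single[OF assms] by (rule infsumI)

context group
begin

abbreviation "L \<equiv> reg_unitary G"
abbreviation "LG \<equiv> op_span (L ` carrier G)"

lemma reg_unitary_bounded [simp]: "g \<in> carrier G \<Longrightarrow> bounded_op (L g)"
proof (rule diagonal_isometry_bounded[where d="\<lambda>i. if i \<in> carrier G then 1 else 0"])
  fix i j assume g: "g \<in> carrier G"
  have "(\<lambda>k. cnj (L g k i) * L g k j) (g \<otimes> i) = (if i = j then if i \<in> carrier G then 1 else 0 else 0)"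
    using g by (auto simp: reg_unitary_def)
  moreover have "cnj (L g k i) * L g k j = 0" if "k \<noteq> g \<otimes> i" for k
    using that by (auto simp: reg_unitary_def)
  ultimately show "((\<lambda>k. cnj (L g k i) * L g k j)
      has_sum (if i = j then if i \<in> carrier G then 1 else 0 else 0)) UNIV"
    using has_sum_single[of "g \<otimes> i" "\<lambda>k. cnj (L g k i) * L g k j"] by simp
qed simp

lemma reg_unitary_mult [simp]:
  assumes "g \<in> carrier G" "h \<in> carrier G"
  shows "L g \<star> L h = L (g \<otimes> h)"
proof -
  have "(\<Sum>\<^sub>\<infinity>j. L g i j * L h j k) = L (g \<otimes> h) i k" for i k
  proof (subst infsum_single[of "h \<otimes> k"])
    show "L g i (h \<otimes> k) * L h (h \<otimes> k) k = L (g \<otimes> h) i k"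
      using assms by (auto simp: reg_unitary_def m_assoc)
  qed (auto simp: reg_unitary_def)
  then show ?thesis by (simp add: op_mult_def fun_eq_iff)
qed

lemma reg_unitary_adj [simp]:
  "g \<in> carrier G \<Longrightarrow> op_adj (L g) = L (inv g)"
  by (auto simp: op_adj_def reg_unitary_def fun_eq_iff simp flip: m_assoc)

lemma reg_unitary_coeff:
  "g \<in> carrier G \<Longrightarrow> h \<in> carrier G \<Longrightarrow> L g h \<one> = (if g = h then 1 else 0)"
  by (auto simp: reg_unitary_def)

lemma reg_unitary_basis:
  assumes "finite (carrier G)"
  shows "star_basis (L ` carrier G) (L \<one>)"
  by unfold_locales (use assms in \<open>auto intro!: op.span_base imageI\<close>)

lemma reduced_cstar_finite:
  assumes "finite (carrier G)"
  shows "reduced_cstar G = LG"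
  unfolding reduced_cstar_def by (rule star_basis.closure_span[OF reg_unitary_basis[OF assms]])

lemma group_trace_reg_unitary:
  "g \<in> carrier G \<Longrightarrow> group_trace G (L g) = (if g = \<one> then 1 else 0)"
  by (auto simp: group_trace_def reg_unitary_def)

end

locale involutive_group = group G for G (structure) +
  fixes \<theta> :: "'a \<Rightarrow> 'a"
  assumes finite_carrier: "finite (carrier G)"
    and theta_closed [simp]: "g \<in> carrier G \<Longrightarrow> \<theta> g \<in> carrier G"
    and theta_mult [simp]: "g \<in> carrier G \<Longrightarrow> h \<in> carrier G \<Longrightarrow> \<theta> (g \<otimes> h) = \<theta> g \<otimes> \<theta> h"
    and theta_invol [simp]: "g \<in> carrier G \<Longrightarrow> \<theta> (\<theta> g) = g"
begin

lemma theta_one [simp]: "\<theta> \<one> = \<one>"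
  using theta_mult[OF one_closed one_closed] by (metis l_one l_cancel_one one_closed theta_closed)

lemma theta_inv [simp]: "g \<in> carrier G \<Longrightarrow> \<theta> (inv g) = inv (\<theta> g)"
  by (metis inv_closed inv_equality l_inv theta_closed theta_mult theta_one)

lemma theta_eq_one: "g \<in> carrier G \<Longrightarrow> \<theta> g = \<one> \<longleftrightarrow> g = \<one>"
  by (metis theta_invol theta_one)

end

text \<open>
  Two orthogonal copies of a representation of the group: \<open>T True g\<close> plays the role of
  $\xi(\lambda_g)$ and \<open>T False g\<close> that of $\eta(\lambda_g)$. The operators are not assumed
  linearly independent, so the notion covers the doubling itself as well as any quotient of it that
  sits inside another compact quantum group.
\<close>

locale doubled_family = involutive_group G \<theta> for G (structure) and \<theta> +
  fixes T :: "bool \<Rightarrow> 'a \<Rightarrow> 'i opr"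
  assumes T_bounded [simp]: "g \<in> carrier G \<Longrightarrow> bounded_op (T s g)"
    and T_mult [simp]: "g \<in> carrier G \<Longrightarrow> h \<in> carrier G \<Longrightarrow> T s g \<star> T s' h = (if s = s' then T s (g \<otimes> h) else 0)"
    and T_adj [simp]: "g \<in> carrier G \<Longrightarrow> op_adj (T s g) = T s (inv g)"
begin

definition basis where "basis = {T s g |s g. g \<in> carrier G}"

abbreviation "W \<equiv> op_span basis"
abbreviation "e \<equiv> T True \<one> + T False \<one>"

text \<open>
  With $\xi$ and $\eta$ indexed by \<open>True\<close> and \<open>False\<close>, the two defining equations of the doubled
  coproduct become this single one.
\<close>

definition is_coproduct where
  "is_coproduct \<Delta> \<longleftrightarrow> linear_on W \<Delta> \<and>
    (\<forall>s. \<forall>g\<in>carrier G. \<Delta> (T s g) = T True g \<boxtimes> T s g + T False g \<boxtimes> T (\<not> s) (\<theta> g))"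

text \<open>
  In order that this is coassociative for the doubled coproduct, the second summand must carry
  $\eta(\lambda_{\theta(g)})$ and not $\eta(\lambda_g)$.
\<close>

definition is_coaction where
  "is_coaction \<alpha> \<longleftrightarrow> linear_on (reduced_cstar G) \<alpha> \<and>
    (\<forall>g\<in>carrier G. \<alpha> (L g) = L g \<boxtimes> T True g + L (\<theta> g) \<boxtimes> T False (\<theta> g))"

lemma finite_basis: "finite basis"
proof -
  have "basis = (\<lambda>(s, g). T s g) ` (UNIV \<times> carrier G)" by (auto simp: basis_def)
  then show ?thesis using finite_carrier by simp
qed

lemma T_in_W [simp, intro]: "g \<in> carrier G \<Longrightarrow> T s g \<in> W"
  by (rule op.span_base) (auto simp: basis_def)

lemma e_mult: "g \<in> carrier G \<Longrightarrow> e \<star> T s g = T s g" "g \<in> carrier G \<Longrightarrow> T s g \<star> e = T s g"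
  by (cases s; simp add: op_mult_add_left op_mult_add_right)+

sublocale W: star_basis basis e
proof
  show "finite basis" by (rule finite_basis)
  show e: "e \<in> W" by (intro op.span_add) auto
  fix x assume "x \<in> basis"
  then obtain s g where x: "x = T s g" "g \<in> carrier G" by (auto simp: basis_def)
  show "bounded_op x" "op_adj x \<in> W" "e \<star> x = x" "x \<star> e = x" using x by (simp_all add: e_mult)
  fix y assume "y \<in> basis"
  then obtain s' h where "y = T s' h" "h \<in> carrier G" by (auto simp: basis_def)
  then show "x \<star> y \<in> W" using x by (simp add: op.span_zero)
qed

sublocale R: star_basis "L ` carrier G" "L \<one>"
  by (rule reg_unitary_basis[OF finite_carrier])

sublocale WW: star_basis "tensor_set basis basis" "e \<boxtimes> e"
  by (rule star_basis_tensor) (rule W.star_basis_axioms)+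

sublocale RW: star_basis "tensor_set (L ` carrier G) basis" "L \<one> \<boxtimes> e"
  by (rule star_basis_tensor) (rule W.star_basis_axioms R.star_basis_axioms)+

lemma reduced: "reduced_cstar G = LG"
  by (rule reduced_cstar_finite[OF finite_carrier])

lemma spatial_WW: "spatial_tensor W W = op_span (tensor_set basis basis)"
  by (rule spatial_tensor_finite_span[OF W.fin W.fin W.bounded W.bounded])

lemma spatial_RW: "spatial_tensor (reduced_cstar G) W = op_span (tensor_set (L ` carrier G) basis)"
  unfolding reduced by (rule spatial_tensor_finite_span[OF R.fin W.fin R.bounded W.bounded])

lemma TT_in: "g \<in> carrier G \<Longrightarrow> h \<in> carrier G \<Longrightarrow> T s g \<boxtimes> T s' h \<in> op_span (tensor_set basis basis)"
  by (intro tensor_in_span) auto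

lemma LT_in: "g \<in> carrier G \<Longrightarrow> h \<in> carrier G \<Longrightarrow> L g \<boxtimes> T s' h \<in> op_span (tensor_set (L ` carrier G) basis)"
  by (intro tensor_in_span) (auto intro: op.span_base)

context
  fixes \<Delta> assumes coprod: "is_coproduct \<Delta>"
begin

lemma \<Delta>_linear: "linear_on W \<Delta>" using coprod by (simp add: is_coproduct_def)

lemma \<Delta>_T [simp]: "g \<in> carrier G \<Longrightarrow> \<Delta> (T s g) = T True g \<boxtimes> T s g + T False g \<boxtimes> T (\<not> s) (\<theta> g)"
  using coprod by (simp add: is_coproduct_def)

lemma \<Delta>_zero [simp]: "\<Delta> 0 = 0" by (rule linear_on_zero[OF \<Delta>_linear op.span_zero])

lemma \<Delta>_hom: "unital_star_hom W (spatial_tensor W W) \<Delta>"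
proof (rule W.star_homI[OF \<Delta>_linear])
  show "op_subspace (spatial_tensor W W)" unfolding spatial_WW by (rule op.subspace_span)
  show "\<Delta> e = unit_of (spatial_tensor W W)"
    unfolding spatial_WW WW.unit_of_span by (simp add: linear_onD[OF \<Delta>_linear] add_ac)
  fix x assume "x \<in> basis"
  then obtain s g where x: "x = T s g" "g \<in> carrier G" by (auto simp: basis_def)
  show "\<Delta> x \<in> spatial_tensor W W" unfolding spatial_WW using x by (auto intro!: op.span_add TT_in)
  show "bounded_op (\<Delta> x)" "\<Delta> (op_adj x) = op_adj (\<Delta> x)" using x by simp_all
  fix y assume "y \<in> basis"
  then obtain s' h where y: "y = T s' h" "h \<in> carrier G" by (auto simp: basis_def)
  show "\<Delta> (x \<star> y) = \<Delta> x \<star> \<Delta> y"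
    using x y by (simp add: tensor_expand)
qed

lemma \<Delta>_in: "x \<in> W \<Longrightarrow> \<Delta> x \<in> op_span (tensor_set basis basis)"
  using \<Delta>_hom unfolding unital_star_hom_def spatial_WW by blast

lemma \<Delta>_blocks: assumes "x \<in> W" shows "left_in W (\<Delta> x)" "right_in W (\<Delta> x)"
  by (rule tensor_span_blocks[OF \<Delta>_in[OF assms]])+

lemma \<Delta>_coassoc:
  assumes "x \<in> W" shows "tensor_id \<Delta> (\<Delta> x) = reassoc (id_tensor \<Delta> (\<Delta> x))"
proof (rule linear_on_eq[OF _ _ _ assms, of "\<lambda>x. tensor_id \<Delta> (\<Delta> x)" "\<lambda>x. reassoc (id_tensor \<Delta> (\<Delta> x))"])
  show "linear_on W (\<lambda>x. tensor_id \<Delta> (\<Delta> x))" "linear_on W (\<lambda>x. reassoc (id_tensor \<Delta> (\<Delta> x)))"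
    unfolding linear_on_def
    by (auto simp: linear_onD[OF \<Delta>_linear] tensor_id_linear[OF \<Delta>_linear] id_tensor_linear[OF \<Delta>_linear] \<Delta>_blocks)
  fix x assume "x \<in> basis"
  then obtain s g where x: "x = T s g" "g \<in> carrier G" by (auto simp: basis_def)
  show "tensor_id \<Delta> (\<Delta> x) = reassoc (id_tensor \<Delta> (\<Delta> x))"
    using x by (simp add: tensor_id_linear[OF \<Delta>_linear] id_tensor_linear[OF \<Delta>_linear]
      left_in_intros[OF op.subspace_span] right_in_intros[OF op.subspace_span] add_ac)
qed

text \<open>
  Density holds algebraically: since the copies are orthogonal, multiplying $\tilde\Delta(x)$ by an
  element of one copy in one leg kills one of its two summands and leaves an elementary tensor, and
  every elementary tensor of basis elements arises in this way.
\<close>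

lemma \<Delta>_dense_right:
  "op_span {\<Delta> x \<star> (unit_of W \<boxtimes> y) |x y. x \<in> W \<and> y \<in> W} = alg_tensor W W"
proof
  show "op_span {\<Delta> x \<star> (unit_of W \<boxtimes> y) |x y. x \<in> W \<and> y \<in> W} \<subseteq> alg_tensor W W"
    unfolding alg_tensor_span W.unit_of_span
    by (rule op.span_minimal) (auto intro!: WW.span_mult \<Delta>_in tensor_in_span W.unit op.subspace_span simp del: tensor_simps)
  have "T r k \<boxtimes> T s h \<in> {\<Delta> x \<star> (e \<boxtimes> y) |x y. x \<in> W \<and> y \<in> W}" if "k \<in> carrier G" "h \<in> carrier G" for r s k h
  proof (cases r)
    case True
    have "T r k \<boxtimes> T s h = \<Delta> (T s k) \<star> (e \<boxtimes> T s (inv k \<otimes> h))"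
      using that True by (simp add: tensor_expand flip: m_assoc)
    then show ?thesis using that by blast
  next
    case False
    have "T r k \<boxtimes> T s h = \<Delta> (T (\<not> s) k) \<star> (e \<boxtimes> T s (inv (\<theta> k) \<otimes> h))"
      using that False by (simp add: tensor_expand flip: m_assoc)
    moreover have "T (\<not> s) k \<in> W" "T s (inv (\<theta> k) \<otimes> h) \<in> W" using that by auto
    ultimately show ?thesis by blast
  qed
  then show "alg_tensor W W \<subseteq> op_span {\<Delta> x \<star> (unit_of W \<boxtimes> y) |x y. x \<in> W \<and> y \<in> W}"
    unfolding alg_tensor_span W.unit_of_span
    by (intro op.span_mono) (auto simp: tensor_set_def basis_def)
qed

lemma \<Delta>_dense_left:
  "op_span {\<Delta> x \<star> (y \<boxtimes> unit_of W) |x y. x \<in> W \<and> y \<in> W} = alg_tensor W W"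
proof
  show "op_span {\<Delta> x \<star> (y \<boxtimes> unit_of W) |x y. x \<in> W \<and> y \<in> W} \<subseteq> alg_tensor W W"
    unfolding alg_tensor_span W.unit_of_span
    by (rule op.span_minimal) (auto intro!: WW.span_mult \<Delta>_in tensor_in_span W.unit op.subspace_span simp del: tensor_simps)
  have "T s h \<boxtimes> T r k \<in> {\<Delta> x \<star> (y \<boxtimes> e) |x y. x \<in> W \<and> y \<in> W}" if "k \<in> carrier G" "h \<in> carrier G" for r s k h
  proof (cases s)
    case True
    have "T s h \<boxtimes> T r k = \<Delta> (T r k) \<star> (T True (inv k \<otimes> h) \<boxtimes> e)"
      using that True by (simp add: tensor_expand flip: m_assoc)
    then show ?thesis using that by blast
  next
    case False
    have "T s h \<boxtimes> T r k = \<Delta> (T (\<not> r) (\<theta> k)) \<star> (T False (inv (\<theta> k) \<otimes> h) \<boxtimes> e)"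
      using that False by (simp add: tensor_expand flip: m_assoc)
    moreover have "T (\<not> r) (\<theta> k) \<in> W" "T False (inv (\<theta> k) \<otimes> h) \<in> W" using that by auto
    ultimately show ?thesis by blast
  qed
  then show "alg_tensor W W \<subseteq> op_span {\<Delta> x \<star> (y \<boxtimes> unit_of W) |x y. x \<in> W \<and> y \<in> W}"
    unfolding alg_tensor_span W.unit_of_span
    by (intro op.span_mono) (auto simp: tensor_set_def basis_def)
qed

lemma is_cqg: "is_cqg \<lparr>alg = W, comult = \<Delta>\<rparr>"
  unfolding is_cqg_def
  using W.unital_cstar \<Delta>_hom \<Delta>_coassoc \<Delta>_dense_left \<Delta>_dense_right
  by (simp add: spatial_tensor_def)

context
  fixes \<alpha> assumes coact: "is_coaction \<alpha>"
begin

lemma \<alpha>_linear: "linear_on LG \<alpha>" using coact by (simp add: is_coaction_def reduced)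

lemma \<alpha>_L [simp]: "g \<in> carrier G \<Longrightarrow> \<alpha> (L g) = L g \<boxtimes> T True g + L (\<theta> g) \<boxtimes> T False (\<theta> g)"
  using coact by (simp add: is_coaction_def)

lemma L_in: "g \<in> carrier G \<Longrightarrow> L g \<in> LG" by (auto intro: op.span_base)

lemma \<alpha>_hom: "unital_star_hom (reduced_cstar G) (spatial_tensor (reduced_cstar G) W) \<alpha>"
  unfolding spatial_RW unfolding reduced
proof (rule R.star_homI[OF \<alpha>_linear])
  show "op_subspace (op_span (tensor_set (L ` carrier G) basis))" by (rule op.subspace_span)
  show "\<alpha> (L \<one>) = unit_of (op_span (tensor_set (L ` carrier G) basis))"
    unfolding RW.unit_of_span by simp
  fix x assume "x \<in> L ` carrier G"
  then obtain g where x: "x = L g" "g \<in> carrier G" by auto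
  show "\<alpha> x \<in> op_span (tensor_set (L ` carrier G) basis)" using x by (auto intro!: op.span_add LT_in)
  show "bounded_op (\<alpha> x)" "\<alpha> (op_adj x) = op_adj (\<alpha> x)" using x by simp_all
  fix y assume "y \<in> L ` carrier G"
  then obtain h where y: "y = L h" "h \<in> carrier G" by auto
  show "\<alpha> (x \<star> y) = \<alpha> x \<star> \<alpha> y"
    using x y by (simp add: tensor_expand)
qed

lemma \<alpha>_in: "x \<in> LG \<Longrightarrow> \<alpha> x \<in> op_span (tensor_set (L ` carrier G) basis)"
  using \<alpha>_hom unfolding unital_star_hom_def spatial_RW unfolding reduced by blast

lemma \<alpha>_blocks: assumes "x \<in> LG" shows "left_in LG (\<alpha> x)" "right_in W (\<alpha> x)"
  by (rule tensor_span_blocks[OF \<alpha>_in[OF assms]])+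

lemma \<alpha>_coassoc:
  assumes "x \<in> LG" shows "tensor_id \<alpha> (\<alpha> x) = reassoc (id_tensor \<Delta> (\<alpha> x))"
proof (rule linear_on_eq[OF _ _ _ assms, of "\<lambda>x. tensor_id \<alpha> (\<alpha> x)" "\<lambda>x. reassoc (id_tensor \<Delta> (\<alpha> x))"])
  show "linear_on LG (\<lambda>x. tensor_id \<alpha> (\<alpha> x))"
    "linear_on LG (\<lambda>x. reassoc (id_tensor \<Delta> (\<alpha> x)))"
    unfolding linear_on_def
    by (auto simp: linear_onD[OF \<alpha>_linear] tensor_id_linear[OF \<alpha>_linear] id_tensor_linear[OF \<Delta>_linear] \<alpha>_blocks)
  fix x assume "x \<in> L ` carrier G"
  then obtain g where x: "x = L g" "g \<in> carrier G" by auto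
  show "tensor_id \<alpha> (\<alpha> x) = reassoc (id_tensor \<Delta> (\<alpha> x))"
    using x by (simp add: tensor_id_linear[OF \<alpha>_linear] id_tensor_linear[OF \<Delta>_linear] L_in
      left_in_intros[OF op.subspace_span] right_in_intros[OF op.subspace_span] add_ac)
qed

lemma \<alpha>_dense:
  "op_span {\<alpha> x \<star> (unit_of LG \<boxtimes> y) |x y. x \<in> LG \<and> y \<in> W}
    = alg_tensor LG W"
proof
  show "op_span {\<alpha> x \<star> (unit_of LG \<boxtimes> y) |x y. x \<in> LG \<and> y \<in> W}
      \<subseteq> alg_tensor LG W"
    unfolding alg_tensor_span R.unit_of_span
    by (rule op.span_minimal) (auto intro!: RW.span_mult \<alpha>_in tensor_in_span R.unit op.subspace_span simp del: tensor_simps)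
  have "L k \<boxtimes> T s h \<in> {\<alpha> x \<star> (L \<one> \<boxtimes> y) |x y. x \<in> LG \<and> y \<in> W}"
    if "k \<in> carrier G" "h \<in> carrier G" for s k h
  proof (cases s)
    case True
    have "L k \<boxtimes> T s h = \<alpha> (L k) \<star> (L \<one> \<boxtimes> T s (inv k \<otimes> h))"
      using that True by (simp add: tensor_expand flip: m_assoc)
    then show ?thesis using that L_in by blast
  next
    case False
    have "L k \<boxtimes> T s h = \<alpha> (L (\<theta> k)) \<star> (L \<one> \<boxtimes> T s (inv k \<otimes> h))"
      using that False by (simp add: tensor_expand flip: m_assoc)
    moreover have "L (\<theta> k) \<in> LG" "T s (inv k \<otimes> h) \<in> W" using that by (auto intro: L_in)
    ultimately show ?thesis by blast
  qed
  then show "alg_tensor LG W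
      \<subseteq> op_span {\<alpha> x \<star> (unit_of LG \<boxtimes> y) |x y. x \<in> LG \<and> y \<in> W}"
    unfolding alg_tensor_span R.unit_of_span
    by (intro op.span_mono) (auto simp: tensor_set_def basis_def)
qed

lemma is_action: "cqg_action (reduced_cstar G) \<lparr>alg = W, comult = \<Delta>\<rparr> \<alpha>"
  unfolding cqg_action_def
  using \<alpha>_hom \<alpha>_coassoc \<alpha>_dense by (simp add: reduced spatial_tensor_def)

lemma \<alpha>_trace:
  assumes "x \<in> LG"
  shows "functional_tensor_id (group_trace G) (\<alpha> x) = op_scale (group_trace G x) e"
proof (rule linear_on_eq[OF _ _ _ assms, of "\<lambda>x. functional_tensor_id (group_trace G) (\<alpha> x)" "\<lambda>x. op_scale (group_trace G x) e"])
  have lin: "functional_tensor_id (group_trace G) (X + Y) =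
        functional_tensor_id (group_trace G) X + functional_tensor_id (group_trace G) Y"
    "functional_tensor_id (group_trace G) (op_scale c X) = op_scale c (functional_tensor_id (group_trace G) X)"
    "functional_tensor_id (group_trace G) (a \<boxtimes> b) = op_scale (group_trace G a) b"
    for X Y :: "('a \<times> 'i) opr" and c a and b :: "'i opr"
    by (auto simp: functional_tensor_id_def group_trace_def left_block_def op_scale_def tensor_def fun_eq_iff)
  show "linear_on LG (\<lambda>x. functional_tensor_id (group_trace G) (\<alpha> x))"
    by (auto simp: linear_on_def linear_onD[OF \<alpha>_linear] lin)
  show "linear_on LG (\<lambda>x. op_scale (group_trace G x) e)"
    by (auto simp: linear_on_def group_trace_def op_scale_def fun_eq_iff algebra_simps)
  fix x assume "x \<in> L ` carrier G"
  then obtain g where x: "x = L g" "g \<in> carrier G" by auto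
  then show "functional_tensor_id (group_trace G) (\<alpha> x) = op_scale (group_trace G x) e"
    by (auto simp: lin group_trace_reg_unitary theta_eq_one)
qed

text \<open>
  The spheres of the word length are preserved because \<open>\<alpha>\<close> moves $\lambda_g$ only to $\lambda_g$
  and $\lambda_{\theta(g)}$.
\<close>

theorem is_qiso_object:
  assumes len: "\<And>g. g \<in> carrier G \<Longrightarrow> word_length G S (\<theta> g) = word_length G S g"
  shows "qiso_object G S \<lparr>alg = W, comult = \<Delta>\<rparr> \<alpha>"
proof -
  have "\<alpha> x \<in> alg_tensor (length_space G S r) W" if "x \<in> length_space G S r" for r x
  proof -
    let ?C = "L ` {g \<in> carrier G. word_length G S g = r}"
    have x: "x \<in> op_span ?C" using that by (simp add: length_space_def)
    have sub: "op_span ?C \<subseteq> LG" by (rule op.span_mono) auto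
    have "x \<in> op_span ?C \<and> \<alpha> x \<in> op_span (tensor_set ?C basis)"
      using x
    proof (rule op_span_induct[where P="\<lambda>x. x \<in> op_span ?C \<and> \<alpha> x \<in> op_span (tensor_set ?C basis)"])
      show "0 \<in> op_span ?C \<and> \<alpha> 0 \<in> op_span (tensor_set ?C basis)"
        by (simp add: linear_on_zero[OF \<alpha>_linear] op.span_zero)
    next
      fix x assume "x \<in> ?C"
      then obtain g where x: "x = L g" "g \<in> carrier G" "word_length G S g = r" by auto
      then have "L g \<boxtimes> T True g \<in> op_span (tensor_set ?C basis)"
        "L (\<theta> g) \<boxtimes> T False (\<theta> g) \<in> op_span (tensor_set ?C basis)"
        using len by (intro tensor_in_span op.span_base[where S="?C"]; auto)+
      then show "x \<in> op_span ?C \<and> \<alpha> x \<in> op_span (tensor_set ?C basis)"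
        using x by (auto intro: op.span_base op.span_add)
    next
      fix x y assume "x \<in> op_span ?C \<and> \<alpha> x \<in> op_span (tensor_set ?C basis)"
        "y \<in> op_span ?C \<and> \<alpha> y \<in> op_span (tensor_set ?C basis)"
      then show "x + y \<in> op_span ?C \<and> \<alpha> (x + y) \<in> op_span (tensor_set ?C basis)"
        using sub by (auto simp: linear_onD(1)[OF \<alpha>_linear] subsetD intro: op.span_add)
    next
      fix c x assume "x \<in> op_span ?C \<and> \<alpha> x \<in> op_span (tensor_set ?C basis)"
      then show "op_scale c x \<in> op_span ?C \<and> \<alpha> (op_scale c x) \<in> op_span (tensor_set ?C basis)"
        using sub by (auto simp: linear_onD(2)[OF \<alpha>_linear] subsetD intro: op.span_scale)
    qed
    then show ?thesis unfolding length_space_def alg_tensor_span by simp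
  qed
  then show ?thesis
    unfolding qiso_object_def
    using is_cqg is_action \<alpha>_trace by (simp add: reduced W.unit_of_span)
qed

end
end
end

section \<open>The tetrahedral, octahedral and icosahedral groups\<close>

text \<open>
  These three lemmas bound the order of the groups. Think of \<open>A\<close> and \<open>U\<close> as left multiplication by
  $a$ and $u = ab$ on the group and of \<open>Y\<close> as the cyclic group generated by $u$; then \<open>F\<close> is the
  union of the left cosets of $\langle u\rangle$, which correspond to the faces of the polyhedron
  with $m$-gonal faces and three edges at each vertex. The relation $(au)^3 = 1$, which is $b^3 = 1$, takes the form
  $aua = u^{-1}au^{-1}$, and this is what carries one face to another.

  For the tetrahedron there are the base face and the three faces around it.
\<close>

lemma tetrahedral_orbit:
  fixes A U :: "'z \<Rightarrow> 'z"
  assumes A: "\<And>x. A (A x) = x" and U: "\<And>x. U (U (U x)) = x"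
    and AU: "\<And>x. A (U (A (U (A (U x))))) = x" and Y: "\<And>y. y \<in> Y \<Longrightarrow> U y \<in> Y" "finite Y"
  shows "\<exists>F. finite F \<and> Y \<subseteq> F \<and> (\<forall>x\<in>F. A x \<in> F \<and> U x \<in> F)"
proof -
  define F where "F = Y \<union> (\<lambda>y. A y) ` Y \<union> (\<lambda>y. U (A y)) ` Y \<union> (\<lambda>y. U (U (A y))) ` Y"
  have K: "A (U (A x)) = U (U (A (U (U x))))" for x
    using AU[of "U (U x)"] by (metis A U)
  have K': "A (U (U (A x))) = U (A (U x))" for x
    using K[of "U x"] by (metis A U)
  have "\<forall>x\<in>F. A x \<in> F \<and> U x \<in> F"
    unfolding F_def by (auto simp: A U K K' Y(1))
  moreover have "finite F" "Y \<subseteq> F" using Y(2) by (auto simp: F_def)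
  ultimately show ?thesis by blast
qed

text \<open>
  Here the polyhedron is the cube: base, four faces around it and the opposite face, which
  is fixed by $u$ since $au^2a = (aua)(aua) = u^{-1}(au^2a)u^{-1}$.
\<close>

lemma octahedral_orbit:
  fixes A U :: "'z \<Rightarrow> 'z"
  assumes A: "\<And>x. A (A x) = x" and U: "\<And>x. U (U (U (U x))) = x"
    and AU: "\<And>x. A (U (A (U (A (U x))))) = x" and Y: "\<And>y. y \<in> Y \<Longrightarrow> U y \<in> Y" "finite Y"
  shows "\<exists>F. finite F \<and> Y \<subseteq> F \<and> (\<forall>x\<in>F. A x \<in> F \<and> U x \<in> F)"
proof -
  define F where "F = Y \<union> (\<lambda>y. A y) ` Y \<union> (\<lambda>y. U (A y)) ` Y \<union> (\<lambda>y. U (U (A y))) ` Y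
     \<union> (\<lambda>y. U (U (U (A y)))) ` Y \<union> (\<lambda>y. A (U (U (A y)))) ` Y"
  have K: "A (U (A x)) = U (U (U (A (U (U (U x))))))" for x
    using AU[of "U (U (U x))"] by (metis A U)
  have K': "A (U (U (U (A x)))) = U (A (U x))" for x
    using K[of "U x"] by (metis A U)
  have "A (U (U (A x))) = U (U (U (A (U (U (A (U (U (U x)))))))))" for x
    using K[of "A (U (A x))"] K[of x] by (metis A U)
  then have Z: "U (A (U (U (A x)))) = A (U (U (A (U (U (U x))))))" for x
    by (metis U)
  have "\<forall>x\<in>F. A x \<in> F \<and> U x \<in> F"
    unfolding F_def by (auto simp: A U K K' Y(1) Z)
  moreover have "finite F" "Y \<subseteq> F" using Y(2) by (auto simp: F_def)
  ultimately show ?thesis by blast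
qed

text \<open>
  Here the polyhedron is the dodecahedron: base, five faces around it, the five faces $u^kPY$ of the
  second ring, where $P = au^2a$, and the opposite face $ZY$, where $Z = au^3P$. The identities express how $a$ permutes
  these twelve faces; the last one, $uZ = Zu^{-1}$, says that $u$ fixes the opposite face.
\<close>

lemma icosahedral_orbit:
  fixes A U :: "'z \<Rightarrow> 'z"
  assumes A: "\<And>x. A (A x) = x" and U: "\<And>x. U (U (U (U (U x)))) = x"
    and AU: "\<And>x. A (U (A (U (A (U x))))) = x" and Y: "\<And>y. y \<in> Y \<Longrightarrow> U y \<in> Y" "finite Y"
  shows "\<exists>F. finite F \<and> Y \<subseteq> F \<and> (\<forall>x\<in>F. A x \<in> F \<and> U x \<in> F)"
proof -
  define P where "P = (\<lambda>x. A (U (U (A x))))"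
  define Z where "Z = (\<lambda>x. A (U (U (U (A (U (U (A x))))))))"
  define F where "F = Y \<union> (\<lambda>y. A y) ` Y \<union> (\<lambda>y. U (A y)) ` Y \<union> (\<lambda>y. U (U (A y))) ` Y
     \<union> (\<lambda>y. U (U (U (A y)))) ` Y \<union> (\<lambda>y. U (U (U (U (A y))))) ` Y
     \<union> (\<lambda>y. P y) ` Y \<union> (\<lambda>y. U (P y)) ` Y \<union> (\<lambda>y. U (U (P y))) ` Y
     \<union> (\<lambda>y. U (U (U (P y)))) ` Y \<union> (\<lambda>y. U (U (U (U (P y))))) ` Y \<union> (\<lambda>y. Z y) ` Y"
  have K: "A (U (A x)) = U (U (U (U (A (U (U (U (U x))))))))" for x
    using AU[of "U (U (U (U x)))"] by (metis A U)
  have K': "A (U (U (U (U (A x))))) = U (A (U x))" for x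
    using K[of "U x"] by (metis A U)
  have P: "A (U (U (A x))) = P x" for x by (simp add: P_def)
  have "P x = A (U (A (A (U (A x)))))" for x by (simp add: P_def A)
  then have "P x = U (U (U (U (A (U (U (U (A (U (U (U (U x))))))))))))" for x
    by (simp only: K U)
  then have Q: "A (U (U (U (A x)))) = U (P (U x))" for x by (simp add: U)
  have P0: "A (P x) = U (U (A x))" for x by (simp add: P_def A)
  have P1: "A (U (P x)) = U (U (U (A (U (U (U (U x)))))))" for x
    using Q[of "U (U (U (U x)))"] by (metis A U)
  have P4: "A (U (U (U (U (P x))))) = U (U (P (U x)))" for x
    unfolding P_def K' by (simp only: Q[unfolded P_def])
  have P2: "A (U (U (P x))) = U (U (U (U (P (U (U (U (U x))))))))" for x
    using P4[of "U (U (U (U x)))"] by (metis A U)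
  have P3: "A (U (U (U (P x)))) = Z x" for x by (simp add: P_def Z_def)
  have Z0: "A (Z x) = U (U (U (P x)))" for x by (simp add: P_def Z_def A)
  have Z1: "U (Z x) = Z (U (U (U (U x))))" for x
  proof -
    have UZ: "U (Z (U y)) = Z y" for y
    proof -
      have "A (U (Z (U y))) = A (U (A (U (U (U (P (U y)))))))" by (simp add: P3)
      also have "\<dots> = U (U (U (U (A (U (U (P (U y))))))))" by (simp only: K U)
      also have "\<dots> = U (U (U (P y)))" by (simp only: P2 U)
      finally show ?thesis by (metis A P3)
    qed
    then show ?thesis using UZ[of "U (U (U (U x)))"] by (simp only: U)
  qed
  have "\<forall>x\<in>F. A x \<in> F \<and> U x \<in> F"
    unfolding F_def by (auto simp: A U K K' Y(1) Q P P0 P1 P2 P3 P4 Z0 Z1)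
  moreover have "finite F" "Y \<subseteq> F" using Y(2) by (auto simp: F_def)
  ultimately show ?thesis by blast
qed

text \<open>
  Permutations of five points that satisfy the relations: generators of the alternating group on
  four points for $m = 3$, of the symmetric group on four points for $m = 4$, and of the
  alternating group on five points for $m = 5$. They serve to tell elements of the group apart.
\<close>

fun perm_a :: "nat \<Rightarrow> nat \<Rightarrow> nat" where
  "perm_a m n = (if n = 0 then 1 else if n = 1 then 0 else if m = 4 then n
     else if n = 2 then 3 else if n = 3 then 2 else n)"

fun perm_b :: "nat \<Rightarrow> nat \<Rightarrow> nat" where
  "perm_b m n = (if m = 3 then (if n = 0 then 1 else if n = 1 then 2 else if n = 2 then 0 else n)
     else if m = 4 then (if n = 1 then 2 else if n = 2 then 3 else if n = 3 then 1 else n)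
     else (if n = 0 then 2 else if n = 2 then 4 else if n = 4 then 0 else n))"

lemma nat_cases5: "(n::nat) = 0 \<or> n = 1 \<or> n = 2 \<or> n = 3 \<or> n = 4 \<or> n \<ge> 5"
  by presburger

lemma perm_a_order: "perm_a m (perm_a m n) = n"
  using nat_cases5[of n] by (elim disjE) simp_all

lemma perm_b_order: "perm_b m (perm_b m (perm_b m n)) = n"
  using nat_cases5[of n] by (elim disjE) simp_all

lemma perm_ab_order:
  assumes "m \<in> {3, 4, 5}" shows "((perm_a m \<circ> perm_b m) ^^ m) n = n"
  using assms nat_cases5[of n] by (elim disjE insertE emptyE) (simp_all add: numeral_eq_Suc)

primrec perm_turns :: "nat \<Rightarrow> bool list \<Rightarrow> nat \<Rightarrow> nat" where
  "perm_turns m [] n = n"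
| "perm_turns m (s # ss) n = (if s then perm_a m (perm_b m (perm_turns m ss n))
     else perm_a m (perm_b m (perm_b m (perm_turns m ss n))))"

text \<open>
  A walk along the edges of the tetrahedron, the cube or the dodecahedron that turns left or
  right at every vertex and closes up, with its direction, after $m$ steps, goes around a face. This
  is checked for all $2^m$ walks in the permutation representation.
\<close>

lemma perm_turns_trivial:
  assumes "m \<in> {3, 4, 5}" "length ss = m" "\<And>n. perm_turns m ss n = n"
  shows "ss = replicate m True \<or> ss = replicate m False"
proof -
  let ?P = "\<lambda>m ss. map (perm_turns m ss) [0, 1, 2, 3, 4] = [0, 1, 2, 3, 4] \<longrightarrow>
    ss = replicate m True \<or> ss = replicate m False"
  have "list_all (?P 3) (List.n_lists 3 [True, False])" by code_simp
  moreover have "list_all (?P 4) (List.n_lists 4 [True, False])" by code_simp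
  moreover have "list_all (?P 5) (List.n_lists 5 [True, False])" by code_simp
  ultimately have "list_all (?P m) (List.n_lists m [True, False])" using assms(1) by blast
  moreover have "ss \<in> set (List.n_lists m [True, False])" using assms(2) by (auto simp: set_n_lists)
  ultimately have "?P m ss" unfolding list_all_iff by (rule bspec)
  then show ?thesis using assms(3) by simp
qed

definition perm_word :: "nat \<Rightarrow> gen word \<Rightarrow> nat \<Rightarrow> nat" where
  "perm_word m w = foldr (\<lambda>(x, pos) h.
     (case x of GenA \<Rightarrow> perm_a m | GenB \<Rightarrow> if pos then perm_b m else perm_b m \<circ> perm_b m) \<circ> h) w id"

lemma perm_word_append: "perm_word m (u @ v) = perm_word m u \<circ> perm_word m v"
  by (induction u) (auto simp: perm_word_def fun_eq_iff)

lemma perm_word_Cons: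
  "perm_word m ((x, pos) # w) =
    (case x of GenA \<Rightarrow> perm_a m | GenB \<Rightarrow> if pos then perm_b m else perm_b m \<circ> perm_b m) \<circ> perm_word m w"
  by (simp add: perm_word_def)

lemma perm_word_Nil: "perm_word m [] = id"
  by (simp add: perm_word_def)

declare perm_a.simps [simp del] perm_b.simps [simp del]

lemma perm_word_eq:
  assumes "word_eq (polyhedral_relators m) u v" "m \<in> {3, 4, 5}"
  shows "perm_word m u = perm_word m v"
  using assms(1)
proof induction
  case (relator r)
  have "perm_word m (concat (replicate k [(GenA, True), (GenB, True)])) = (perm_a m \<circ> perm_b m) ^^ k" for k
    by (induction k) (simp_all add: perm_word_Cons perm_word_Nil o_assoc)
  then have "perm_word m (concat (replicate m [(GenA, True), (GenB, True)])) = id"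
    using perm_ab_order[OF assms(2)] by (simp add: fun_eq_iff)
  with relator show ?case
    by (auto simp: polyhedral_relators_def numeral_eq_Suc perm_word_Cons perm_word_Nil fun_eq_iff perm_a_order perm_b_order)
next
  case (cancel x s)
  show ?case
    by (cases x; cases s) (simp_all add: perm_word_Cons perm_word_Nil fun_eq_iff perm_a_order perm_b_order)
next
  case (context_closed u v p q)
  then show ?case by (simp add: perm_word_append)
qed simp_all

locale polyhedral = group G for G :: "('g, 'x) monoid_scheme" (structure) +
  fixes a b :: 'g and m :: nat
  assumes m: "m \<in> {3, 4, 5}" and pres: "has_presentation G (case_gen a b) (polyhedral_relators m)"
begin

lemma ab_closed [simp]: "a \<in> carrier G" "b \<in> carrier G"
proof -
  have "case_gen a b x \<in> carrier G" for x using pres by (auto simp: has_presentation_def)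
  from this[of GenA] this[of GenB] show "a \<in> carrier G" "b \<in> carrier G" by simp_all
qed

abbreviation "val \<equiv> word_val G (case_gen a b)"

lemma val_simps: "val [] = \<one>"
  "val ((x, pos) # w) = (if pos then case_gen a b x else inv (case_gen a b x)) \<otimes> val w"
  by (simp_all add: word_val_def)

lemma pow_comm: "x \<in> carrier G \<Longrightarrow> y \<in> carrier G \<Longrightarrow> (x \<otimes> y) [^] k \<otimes> (x \<otimes> y) = x \<otimes> (y \<otimes> (x \<otimes> y) [^] (k::nat))"
  using nat_pow_Suc2[of "x \<otimes> y" k] by (simp add: m_assoc)

lemma val_closed [simp]: "val w \<in> carrier G"
proof (induction w)
  case (Cons p w) then show ?case by (cases p; cases "fst p") (auto simp: val_simps)
qed (simp add: val_simps)

lemma val_eq_iff: "val u = val v \<longleftrightarrow> word_eq (polyhedral_relators m) u v"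
  using pres by (simp add: has_presentation_def)

lemma val_surj: "g \<in> carrier G \<Longrightarrow> \<exists>w. g = val w"
  using pres by (auto simp: has_presentation_def)

lemma val_relator: "r \<in> polyhedral_relators m \<Longrightarrow> val r = \<one>"
  using val_eq_iff[of r "[]"] word_eq.relator by (metis val_simps(1))

lemma a_order [simp]: "a \<otimes> a = \<one>"
  using val_relator[of "replicate 2 (GenA, True)"]
  by (simp add: polyhedral_relators_def numeral_eq_Suc val_simps)

lemma b_order [simp]: "b \<otimes> (b \<otimes> b) = \<one>"
  using val_relator[of "replicate 3 (GenB, True)"]
  by (simp add: polyhedral_relators_def numeral_eq_Suc val_simps)

lemma ab_order: "(a \<otimes> b) [^] m = \<one>"
proof -
  have "val (concat (replicate k [(GenA, True), (GenB, True)])) = (a \<otimes> b) [^] k" for k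
    by (induction k) (simp_all add: val_simps pow_comm)
  then show ?thesis
    using val_relator[of "concat (replicate m [(GenA, True), (GenB, True)])"]
    by (simp add: polyhedral_relators_def)
qed

lemma inv_a [simp]: "inv a = a"
  by (rule inv_equality) simp_all

lemma inv_b: "inv b = b \<otimes> b"
  by (rule inv_equality) (simp_all add: m_assoc)

lemma gen_induct [consumes 1, case_names one a b]:
  assumes "g \<in> carrier G" and "P \<one>" and "\<And>g. g \<in> carrier G \<Longrightarrow> P g \<Longrightarrow> P (a \<otimes> g)"
    and "\<And>g. g \<in> carrier G \<Longrightarrow> P g \<Longrightarrow> P (b \<otimes> g)"
  shows "P g"
proof -
  have "P (val w)" for w
  proof (induction w)
    case Nil show ?case using assms(2) by (simp add: val_simps)
  next
    case (Cons p w)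
    then have "P (a \<otimes> val w)" "P (b \<otimes> val w)" "P (b \<otimes> (b \<otimes> val w))"
      using assms(3,4) by auto
    then show ?case
      by (cases p; cases "fst p"; cases "snd p") (auto simp: val_simps inv_b m_assoc)
  qed
  then show ?thesis using val_surj[OF assms(1)] by blast
qed

definition perm :: "'g \<Rightarrow> nat \<Rightarrow> nat" where
  "perm g = perm_word m (SOME w. val w = g)"

text \<open>
  Well defined since equal values mean that the words are equal in the presented group, where
  the permutations satisfy the relators.
\<close>

lemma perm_val: "perm (val w) = perm_word m w"
proof -
  have "val (SOME w'. val w' = val w) = val w" by (rule someI) (rule HOL.refl)
  then show ?thesis unfolding perm_def val_eq_iff by (rule perm_word_eq[OF _ m])
qed

lemma perm_simps:
  "perm \<one> n = n"
  "g \<in> carrier G \<Longrightarrow> perm (a \<otimes> g) n = perm_a m (perm g n)"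
  "g \<in> carrier G \<Longrightarrow> perm (b \<otimes> g) n = perm_b m (perm g n)"
proof -
  show "perm \<one> n = n" using perm_val[of "[]"] by (simp add: val_simps perm_word_Nil)
  fix g assume "g \<in> carrier G"
  then obtain w where w: "g = val w" using val_surj by blast
  show "perm (a \<otimes> g) n = perm_a m (perm g n)" "perm (b \<otimes> g) n = perm_b m (perm g n)"
    using perm_val[of "(GenA, True) # w"] perm_val[of "(GenB, True) # w"] perm_val[of w]
    by (simp_all add: val_simps perm_word_Cons w)
qed

lemma perm_a_one [simp]: "perm a n = perm_a m n" "perm b n = perm_b m n"
  using perm_simps(2)[of \<one> n] perm_simps(3)[of \<one> n] by (simp_all add: perm_simps)

lemma short_words_distinct:
  "distinct [\<one>, a, b, b \<otimes> b, a \<otimes> b, a \<otimes> (b \<otimes> b), b \<otimes> a, b \<otimes> (b \<otimes> a)]"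
proof -
  let ?xs = "[\<one>, a, b, b \<otimes> b, a \<otimes> b, a \<otimes> (b \<otimes> b), b \<otimes> a, b \<otimes> (b \<otimes> a)]"
  have "distinct (map (\<lambda>g. map (perm g) [0,1,2,3,4]) ?xs)"
    unfolding list.map perm_a_one
    using m by (simp only: perm_simps perm_a_one ab_closed m_closed) (elim insertE emptyE, simp_all add: perm_a.simps perm_b.simps)
  then show ?thesis unfolding distinct_map by (rule conjunct1)
qed

text \<open>
  The product of the factors $ab$ (\<open>True\<close>) and $ab^{-1}$ (\<open>False\<close>) along a list.
\<close>

primrec turns :: "bool list \<Rightarrow> 'g" where
  "turns [] = \<one>"
| "turns (s # ss) = (if s then a \<otimes> (b \<otimes> turns ss) else a \<otimes> (b \<otimes> (b \<otimes> turns ss)))"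

lemma turns_closed [simp]: "turns ss \<in> carrier G"
  by (induction ss) auto

lemma turns_eq_one:
  assumes "length ss = m"
  shows "turns ss = \<one> \<longleftrightarrow> ss = replicate m True \<or> ss = replicate m False"
proof
  assume t: "turns ss = \<one>"
  have "perm (turns ss) n = perm_turns m ss n" for n
    by (induction ss) (simp_all add: perm_simps)
  then show "ss = replicate m True \<or> ss = replicate m False"
    using perm_turns_trivial[OF m assms] t by (simp add: perm_simps)
next
  have "turns (replicate k True) = (a \<otimes> b) [^] k" for k
    by (induction k) (simp_all add: pow_comm)
  moreover have "turns (replicate k False) = (a \<otimes> (b \<otimes> b)) [^] k" for k
    by (induction k) (simp_all add: pow_comm m_assoc)
  moreover have "(a \<otimes> (b \<otimes> b)) [^] m = \<one>"
  proof -
    have l_cancel: "inv a \<otimes> (a \<otimes> z) = z" if "z \<in> carrier G" for z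
      using that by (simp add: m_assoc[symmetric])
    have "(a \<otimes> (x \<otimes> inv a)) [^] k = a \<otimes> ((x [^] k) \<otimes> inv a)" if "x \<in> carrier G" for x and k :: nat
      using that
    proof (induction k)
      case (Suc k)
      have "a \<otimes> (x [^] k \<otimes> inv a) \<otimes> (a \<otimes> (x \<otimes> inv a)) = a \<otimes> (x [^] k \<otimes> (inv a \<otimes> a) \<otimes> x \<otimes> inv a)"
        using Suc.prems l_cancel by (simp add: m_assoc del: inv_a)
      then show ?case using Suc by (simp add: m_assoc)
    qed simp
    note conj = this
    have "a \<otimes> (b \<otimes> b) = a \<otimes> (inv (a \<otimes> b) \<otimes> inv a)" by (simp add: inv_mult_group inv_b m_assoc)
    then have "(a \<otimes> (b \<otimes> b)) [^] m = a \<otimes> ((inv (a \<otimes> b)) [^] m \<otimes> inv a)"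
      by (simp only: conj inv_closed m_closed ab_closed)
    also have "(inv (a \<otimes> b)) [^] m = \<one>" using nat_pow_inv[of "a \<otimes> b" m] by (simp add: ab_order)
    finally show ?thesis by simp
  qed
  moreover assume "ss = replicate m True \<or> ss = replicate m False"
  ultimately show "turns ss = \<one>" by (auto simp: ab_order)
qed

text \<open>
  The orbit lemmas need functions with unconditional equations, hence left multiplication
  is extended by the identity outside the carrier.
\<close>

lemma finite_carrier: "finite (carrier G)"
proof -
  define A where "A x = (if x \<in> carrier G then a \<otimes> x else x)" for x
  define U where "U x = (if x \<in> carrier G then a \<otimes> b \<otimes> x else x)" for x
  define Y where "Y = (\<lambda>k. (a \<otimes> b) [^] k) ` {..<m}"
  have A: "A (A x) = x" for x by (simp add: A_def flip: m_assoc)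
  have AU: "A (U x) = (if x \<in> carrier G then b \<otimes> x else x)" for x
    by (simp add: A_def U_def m_assoc[symmetric])
  have AU3: "A (U (A (U (A (U x))))) = x" for x
    by (simp add: AU m_assoc[symmetric]) (simp add: m_assoc)
  have Ux: "U (x :: 'g) = a \<otimes> b \<otimes> x" if "x \<in> carrier G" for x using that by (simp add: U_def)
  have Uk: "(U ^^ k) x = (a \<otimes> b) [^] k \<otimes> x" if "x \<in> carrier G" for x k
  proof (induction k)
    case (Suc k)
    have "a \<otimes> b \<otimes> (a \<otimes> b) [^] k = (a \<otimes> b) [^] k \<otimes> a \<otimes> b" by (simp add: pow_comm m_assoc)
    with Suc that show ?case by (simp add: Ux flip: m_assoc)
  qed (use that in simp)
  have Um: "(U ^^ m) x = x" for x
  proof (cases "x \<in> carrier G")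
    case True then show ?thesis by (simp add: Uk ab_order)
  next
    case False then have "(U ^^ k) x = x" for k by (induction k) (auto simp: U_def)
    then show ?thesis .
  qed
  have Y: "U y \<in> Y" if y: "y \<in> Y" for y
  proof -
    obtain k where k: "k < m" "y = (a \<otimes> b) [^] k" using y by (auto simp: Y_def)
    have "U y = (a \<otimes> b) [^] Suc k" using k by (simp add: Ux pow_comm m_assoc)
    moreover have "Suc k < m \<or> (Suc k = m \<and> 0 < m)" using k by auto
    ultimately show ?thesis unfolding Y_def using ab_order
      by (metis image_eqI lessThan_iff nat_pow_0)
  qed
  have Y1: "finite Y" "\<one> \<in> Y" using m by (auto simp: Y_def intro!: image_eqI[of _ _ 0])
  have "\<exists>F. finite F \<and> Y \<subseteq> F \<and> (\<forall>x\<in>F. A x \<in> F \<and> U x \<in> F)"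
    using m
  proof (elim insertE emptyE)
    assume m3: "m = 3"
    have "U (U (U x)) = x" for x using Um[of x] by (simp add: m3 numeral_eq_Suc)
    from tetrahedral_orbit[OF A this AU3 Y Y1(1)] show ?thesis .
  next
    assume m4: "m = 4"
    have "U (U (U (U x))) = x" for x using Um[of x] by (simp add: m4 numeral_eq_Suc)
    from octahedral_orbit[OF A this AU3 Y Y1(1)] show ?thesis .
  next
    assume m5: "m = 5"
    have "U (U (U (U (U x)))) = x" for x using Um[of x] by (simp add: m5 numeral_eq_Suc)
    from icosahedral_orbit[OF A this AU3 Y Y1(1)] show ?thesis .
  qed
  then obtain F where F: "finite F" "\<one> \<in> F" "\<And>x. x \<in> F \<Longrightarrow> A x \<in> F" "\<And>x. x \<in> F \<Longrightarrow> U x \<in> F"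
    using Y1(2) by blast
  have "g \<in> F" if "g \<in> carrier G" for g
    using that
  proof (induction rule: gen_induct)
    case one then show ?case using F by simp
  next
    case (a g) then show ?case using F(3)[of g] by (simp add: A_def)
  next
    case (b g) then show ?case using F(3)[OF F(4)[of g]] by (simp add: AU)
  qed
  then show ?thesis using F(1) by (rule_tac finite_subset[of _ F]) auto
qed

end

locale polyhedral_flip = polyhedral G a b m for G :: "('g, 'x) monoid_scheme" (structure) and a b m +
  fixes \<theta> :: "'g \<Rightarrow> 'g"
  assumes theta_iso: "\<theta> \<in> iso G G" and theta_a [simp]: "\<theta> a = a" and theta_b: "\<theta> b = inv b"
begin

sublocale involutive_group G \<theta>
proof
  show "finite (carrier G)" by (rule finite_carrier)
  show cl: "\<theta> g \<in> carrier G" if "g \<in> carrier G" for g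
    using theta_iso that by (auto simp: iso_def hom_def)
  show mult: "\<theta> (g \<otimes> h) = \<theta> g \<otimes> \<theta> h" if "g \<in> carrier G" "h \<in> carrier G" for g h
    using theta_iso that by (auto simp: iso_def hom_def)
  have one: "\<theta> \<one> = \<one>"
    using mult[OF one_closed one_closed] cl[OF one_closed] by (metis l_one l_cancel_one one_closed)
  have bb: "\<theta> (\<theta> b) = b"
    by (simp add: theta_b inv_b mult) (simp add: inv_b m_assoc)
  show "\<theta> (\<theta> g) = g" if "g \<in> carrier G" for g
    using that by (induction rule: gen_induct) (simp_all add: one mult cl bb)
qed

abbreviation "S \<equiv> {a, b, inv b}"

lemma S_closed: "S \<subseteq> carrier G" by simp

lemma theta_S: "s \<in> S \<Longrightarrow> \<theta> s \<in> S"
  by (auto simp: theta_b)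

definition spelled :: "'g \<Rightarrow> nat \<Rightarrow> bool" where
  "spelled g n \<longleftrightarrow> (\<exists>w. length w = n \<and> set w \<subseteq> S \<and> foldr (\<otimes>) w \<one> = g)"

lemma word_length_spelled: "word_length G S g = (LEAST n. spelled g n)"
  by (simp add: word_length_def spelled_def)

lemma spelled_theta: "spelled g n \<Longrightarrow> spelled (\<theta> g) n"
proof -
  assume "spelled g n"
  then obtain w where w: "length w = n" "set w \<subseteq> S" "foldr (\<otimes>) w \<one> = g" by (auto simp: spelled_def)
  have "foldr (\<otimes>) v \<one> \<in> carrier G \<and> \<theta> (foldr (\<otimes>) v \<one>) = foldr (\<otimes>) (map \<theta> v) \<one>" if "set v \<subseteq> S" for v
    using that S_closed by (induction v) auto
  with w have "foldr (\<otimes>) (map \<theta> w) \<one> = \<theta> g" by metis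
  moreover have "set (map \<theta> w) \<subseteq> S" using w(2) theta_S by auto
  moreover have "length (map \<theta> w) = n" using w(1) by simp
  ultimately show "spelled (\<theta> g) n" unfolding spelled_def by blast
qed

text \<open>
  The automorphism permutes the generating set, so it maps the spellings of an element to
  spellings of the same length of its image.
\<close>

lemma word_length_theta: "g \<in> carrier G \<Longrightarrow> word_length G S (\<theta> g) = word_length G S g"
proof -
  assume "g \<in> carrier G"
  then have "spelled (\<theta> g) = spelled g"
    using spelled_theta[of g] spelled_theta[of "\<theta> g"] by (intro ext) auto
  then show ?thesis by (simp add: word_length_spelled)
qed

lemma spelled_exists: "g \<in> carrier G \<Longrightarrow> \<exists>n. spelled g n"
proof (induction rule: gen_induct)
  case one then show ?case by (auto simp: spelled_def intro: exI[of _ "[]"])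
next
  case (a g)
  then obtain w where "set w \<subseteq> S" "foldr (\<otimes>) w \<one> = g" by (auto simp: spelled_def)
  then show ?case unfolding spelled_def by (intro exI[of _ "length (a # w)"] exI[of _ "a # w"]) auto
next
  case (b g)
  then obtain w where "set w \<subseteq> S" "foldr (\<otimes>) w \<one> = g" by (auto simp: spelled_def)
  then show ?case unfolding spelled_def by (intro exI[of _ "length (b # w)"] exI[of _ "b # w"]) auto
qed

lemma spelled_0: "spelled g 0 \<longleftrightarrow> g = \<one>"
  by (auto simp: spelled_def)

lemma spelled_1: "spelled g 1 \<longleftrightarrow> g \<in> S"
proof
  assume "spelled g 1"
  then obtain w where w: "length w = Suc 0" "set w \<subseteq> S" "foldr (\<otimes>) w \<one> = g" by (auto simp: spelled_def)
  then obtain s where "w = [s]" by (auto simp: length_Suc_conv)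
  with w S_closed show "g \<in> S" by auto
next
  assume g: "g \<in> S"
  then have "foldr (\<otimes>) [g] \<one> = g" using S_closed by auto
  with g show "spelled g 1" unfolding spelled_def by (intro exI[of _ "[g]"]) auto
qed

lemma spelled_word_length: "g \<in> carrier G \<Longrightarrow> spelled g (word_length G S g)"
  unfolding word_length_spelled using spelled_exists by (rule LeastI_ex)

lemma word_length_le: "spelled g n \<Longrightarrow> word_length G S g \<le> n"
  unfolding word_length_spelled by (rule Least_le)

lemma word_length_0: "g \<in> carrier G \<Longrightarrow> word_length G S g = 0 \<longleftrightarrow> g = \<one>"
  using spelled_word_length[of g] word_length_le[of g 0] by (auto simp: spelled_0)

lemma word_length_1: "g \<in> carrier G \<Longrightarrow> word_length G S g = 1 \<longleftrightarrow> g \<in> S"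
proof -
  assume g: "g \<in> carrier G"
  have ne: "\<one> \<notin> S" using short_words_distinct by (auto simp: inv_b)
  show ?thesis
  proof
    assume "word_length G S g = 1" then show "g \<in> S" using spelled_word_length[OF g] spelled_1 by simp
  next
    assume s: "g \<in> S"
    then have "word_length G S g \<le> 1" by (intro word_length_le) (simp only: spelled_1)
    moreover have "word_length G S g \<noteq> 0" using word_length_0[OF g] s ne by auto
    ultimately show "word_length G S g = 1" by simp
  qed
qed

end

section \<open>Actions that preserve word length\<close>

lemma bounded_spatial_tensor: "x \<in> spatial_tensor A B \<Longrightarrow> bounded_op x"
  by (simp add: spatial_tensor_def op_closure_def)

lemma reassoc_inj: "reassoc x = reassoc y \<Longrightarrow> x = y"
  by (auto simp: reassoc_def fun_eq_iff split_paired_all)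

context group
begin

lemma reg_tensor_expansion:
  assumes K: "finite K" "K \<subseteq> carrier G" and R: "op_subspace R"
    and X: "X \<in> alg_tensor (op_span (L ` K)) R"
  shows "X = (\<Sum>t\<in>K. L t \<boxtimes> right_block X t \<one>)" "right_in R X"
proof -
  have X: "X \<in> op_span (tensor_set (L ` K) R)"
  proof -
    have "op_span R = R" using R by simp
    from alg_tensor_span[of "L ` K" R, unfolded this] X show ?thesis by (simp only:)
  qed
  then show "right_in R X"
    by (rule op_span_induct[where P="right_in R"]) (auto simp: tensor_set_def right_in_intros[OF R])
  show "X = (\<Sum>t\<in>K. L t \<boxtimes> right_block X t \<one>)"
  proof (rule linear_on_eq[OF _ _ _ X, of "\<lambda>X. X" "\<lambda>X. \<Sum>t\<in>K. L t \<boxtimes> right_block X t \<one>"])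
    fix Y assume "Y \<in> tensor_set (L ` K) R"
    then obtain g r where Y: "Y = L g \<boxtimes> r" "g \<in> K" by (auto simp: tensor_set_def)
    have "(\<Sum>t\<in>K. L t \<boxtimes> right_block Y t \<one>) = (\<Sum>t\<in>K. if t = g then L g \<boxtimes> r else 0)"
      using Y K by (intro sum.cong) (auto simp: reg_unitary_coeff subset_iff)
    also have "\<dots> = Y" using Y K by simp
    finally show "Y = (\<Sum>t\<in>K. L t \<boxtimes> right_block Y t \<one>)" by simp
  next
    show "linear_on (op_span (tensor_set (L ` K) R)) (\<lambda>X. \<Sum>t\<in>K. L t \<boxtimes> right_block X t \<one>)"
      by (simp only: linear_on_def right_block_simps tensor_simps sum.distrib op.scale_sum_right) blast
  qed (simp add: linear_on_def)
qed

text \<open>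
  When $g = h$ the two coefficients cannot be read off separately from the tensor, only their
  sum; the projections \<open>p\<close> and \<open>p'\<close> then separate them. This covers the elements fixed by $\theta$.
\<close>

lemma graded_coefficients_unique:
  fixes p p' :: "'i opr"
  assumes gh: "g \<in> carrier G" "h \<in> carrier G"
    and eq: "L g \<boxtimes> U + L h \<boxtimes> V = L g \<boxtimes> U' + L h \<boxtimes> V'"
    and bd: "bounded_op p" "bounded_op p'" "bounded_op U" "bounded_op V" "bounded_op U'" "bounded_op V'"
    and gr: "p \<star> U = U" "p \<star> V = 0" "p \<star> U' = U'" "p \<star> V' = 0"
      "p' \<star> V = V" "p' \<star> U = 0" "p' \<star> V' = V'" "p' \<star> U' = 0"
  shows "U = U'" "V = V'"
proof -
  have "U = U' \<and> V = V'"
  proof (cases "g = h")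
    case True
    have "U + V = U' + V'"
      using arg_cong[OF eq, of "\<lambda>X. right_block X g \<one>"] gh True by (simp add: reg_unitary_coeff)
    from arg_cong[OF this, of "\<lambda>x. p \<star> x"] arg_cong[OF this, of "\<lambda>x. p' \<star> x"]
    show ?thesis using bd gr by (simp add: op_mult_add_right)
  next
    case False
    then show ?thesis
      using arg_cong[OF eq, of "\<lambda>X. right_block X g \<one>"] arg_cong[OF eq, of "\<lambda>X. right_block X h \<one>"] gh
      by (simp add: reg_unitary_coeff)
  qed
  then show "U = U'" "V = V'" by simp_all
qed

end

text \<open>
  From now on $(Q, \beta)$ is an arbitrary object of the category, possibly infinite dimensional. Its
  coefficients are analysed inside the algebra \<open>R\<close> of $Q$, whose unit \<open>u\<close> need not be the identity
  operator.
\<close>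

locale polyhedral_action = polyhedral_flip G a b m \<theta>
  for G :: "('g, 'x) monoid_scheme" (structure) and a b m \<theta> +
  fixes Q :: "'i cqg" and \<beta> :: "'g opr \<Rightarrow> ('g \<times> 'i) opr"
  assumes object: "qiso_object G S Q \<beta>"
begin

abbreviation "R \<equiv> alg Q"
abbreviation "\<Delta> \<equiv> comult Q"
abbreviation "u \<equiv> unit_of R"

lemma cqg: "is_cqg Q" and action: "cqg_action (reduced_cstar G) Q \<beta>"
  using object by (auto simp: qiso_object_def)

lemma cstar: "unital_cstar_algebra R" using cqg by (simp add: is_cqg_def)

lemma R_subspace: "op_subspace R" using cstar by (simp add: unital_cstar_algebra_def)

lemma R_bounded [simp]: "x \<in> R \<Longrightarrow> bounded_op x" using cstar by (simp add: unital_cstar_algebra_def)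

lemma R_closed [simp]:
  "0 \<in> R" "u \<in> R"
  "x \<in> R \<Longrightarrow> y \<in> R \<Longrightarrow> x + y \<in> R" "x \<in> R \<Longrightarrow> op_scale c x \<in> R"
  "x \<in> R \<Longrightarrow> y \<in> R \<Longrightarrow> x \<star> y \<in> R" "x \<in> R \<Longrightarrow> op_adj x \<in> R"
  using cstar R_subspace unit_of_is_unit[OF cstar]
  by (auto simp: unital_cstar_algebra_def op.subspace_def is_op_unit_def)

lemma R_unit [simp]: "x \<in> R \<Longrightarrow> u \<star> x = x" "x \<in> R \<Longrightarrow> x \<star> u = x"
  using unit_of_is_unit[OF cstar] by (auto simp: is_op_unit_def)

lemma R_assoc: "x \<in> R \<Longrightarrow> y \<in> R \<Longrightarrow> z \<in> R \<Longrightarrow> x \<star> y \<star> z = x \<star> (y \<star> z)"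
  by (simp add: op_mult_assoc)

lemma R_distrib: "x \<in> R \<Longrightarrow> y \<in> R \<Longrightarrow> z \<in> R \<Longrightarrow> (x + y) \<star> z = x \<star> z + y \<star> z"
   "x \<in> R \<Longrightarrow> y \<in> R \<Longrightarrow> z \<in> R \<Longrightarrow> x \<star> (y + z) = x \<star> y + x \<star> z"
  by (simp_all add: op_mult_add_left op_mult_add_right)

lemma \<beta>_hom: "unital_star_hom (reduced_cstar G) (spatial_tensor (reduced_cstar G) R) \<beta>"
  using action by (simp add: cqg_action_def)

lemma L_in: "g \<in> carrier G \<Longrightarrow> L g \<in> reduced_cstar G"
  unfolding reduced_cstar_finite[OF finite_carrier] by (auto intro: op.span_base)

lemma \<beta>_mult: "g \<in> carrier G \<Longrightarrow> h \<in> carrier G \<Longrightarrow> \<beta> (L (g \<otimes> h)) = \<beta> (L g) \<star> \<beta> (L h)"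
  using \<beta>_hom L_in[of g] L_in[of h] unfolding unital_star_hom_def by (metis reg_unitary_mult)

lemma \<beta>_adj: "g \<in> carrier G \<Longrightarrow> \<beta> (L (inv g)) = op_adj (\<beta> (L g))"
  using \<beta>_hom L_in[of g] unfolding unital_star_hom_def by (metis reg_unitary_adj)

lemma \<beta>_linear: "linear_on (reduced_cstar G) \<beta>" by (rule star_hom_linear[OF \<beta>_hom])

lemma \<beta>_expansion:
  assumes g: "g \<in> carrier G"
  shows "\<beta> (L g) = (\<Sum>t | t \<in> carrier G \<and> word_length G S t = word_length G S g.
      L t \<boxtimes> right_block (\<beta> (L g)) t \<one>)"
    and "right_block (\<beta> (L g)) t t' \<in> R"
proof -
  let ?K = "{t \<in> carrier G. word_length G S t = word_length G S g}"
  have "L g \<in> length_space G S (word_length G S g)"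
    using g by (auto simp: length_space_def intro: op.span_base)
  then have "\<beta> (L g) \<in> alg_tensor (op_span (L ` ?K)) R"
    using object unfolding qiso_object_def length_space_def by blast
  from reg_tensor_expansion[OF _ _ R_subspace this]
  show "\<beta> (L g) = (\<Sum>t\<in>?K. L t \<boxtimes> right_block (\<beta> (L g)) t \<one>)" "right_block (\<beta> (L g)) t t' \<in> R"
    using finite_carrier by (simp_all add: right_in_def)
qed

text \<open>
  Preservation of length gives $\beta(\lambda_e) = \lambda_e \otimes q$, and the invariance of the trace
  identifies $q$ with the unit.
\<close>

lemma \<beta>_one: "\<beta> (L \<one>) = L \<one> \<boxtimes> u"
proof -
  have K: "{t \<in> carrier G. word_length G S t = word_length G S \<one>} = {\<one>}"
  proof -
    have 0: "word_length G S \<one> = 0" using word_length_0[OF one_closed] by simp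
    have "word_length G S t = word_length G S \<one> \<longleftrightarrow> t = \<one>" if "t \<in> carrier G" for t
      unfolding 0 by (rule word_length_0[OF that])
    then show ?thesis by auto
  qed
  let ?q = "right_block (\<beta> (L \<one>)) \<one> \<one>"
  have e: "\<beta> (L \<one>) = L \<one> \<boxtimes> ?q"
    using \<beta>_expansion(1)[OF one_closed] unfolding K by simp
  have "functional_tensor_id (group_trace G) (\<beta> (L \<one>)) = op_scale (group_trace G (L \<one>)) u"
    using object L_in[OF one_closed] unfolding qiso_object_def by blast
  moreover have "functional_tensor_id (group_trace G) (L \<one> \<boxtimes> ?q) = ?q"
    by (simp add: functional_tensor_id_def fun_eq_iff) (simp add: group_trace_def op_scale_def reg_unitary_def)
  ultimately have "?q = u" using e by (simp add: group_trace_reg_unitary)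
  then show ?thesis using e by simp
qed

lemmas neqs = short_words_distinct[simplified]

lemma neqs': "distinct [b \<otimes> (b \<otimes> a), b \<otimes> a, a \<otimes> (b \<otimes> b), a \<otimes> b, b \<otimes> b, b, a, \<one>]"
  using neqs by auto

lemma \<beta>_generator:
  assumes s: "s \<in> {a, b}"
  obtains A B C where "A \<in> R" "B \<in> R" "C \<in> R" "\<beta> (L s) = L a \<boxtimes> A + L b \<boxtimes> B + L (b \<otimes> b) \<boxtimes> C"
proof -
  have sc: "s \<in> carrier G" using s by auto
  have "word_length G S s = 1" using word_length_1[OF sc] s by auto
  then have K: "{t \<in> carrier G. word_length G S t = word_length G S s} = {a, b, b \<otimes> b}"
    using word_length_1 by (auto simp: inv_b)
  have "\<beta> (L s) = (\<Sum>t\<in>{a, b, b \<otimes> b}. L t \<boxtimes> right_block (\<beta> (L s)) t \<one>)"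
    using \<beta>_expansion(1)[OF sc] unfolding K .
  also have "\<dots> = L a \<boxtimes> right_block (\<beta> (L s)) a \<one> + L b \<boxtimes> right_block (\<beta> (L s)) b \<one>
      + L (b \<otimes> b) \<boxtimes> right_block (\<beta> (L s)) (b \<otimes> b) \<one>"
    using neqs by (simp add: add.assoc)
  finally show ?thesis using that \<beta>_expansion(2)[OF sc] by blast
qed

lemma \<beta>_ab_short_coeff:
  "right_block (\<beta> (L (a \<otimes> b))) k \<one> = 0" if k: "k \<in> {\<one>, a, b, b \<otimes> b}"
proof -
  have ab: "a \<otimes> b \<in> carrier G" by simp
  have kc: "k \<in> carrier G" using k by auto
  have "word_length G S (a \<otimes> b) \<noteq> word_length G S k"
    using word_length_0[OF ab] word_length_1[OF ab] word_length_0[OF kc] word_length_1[OF kc] k neqs neqs'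
    by (auto simp: inv_b)
  then have "right_block (\<Sum>t | t \<in> carrier G \<and> word_length G S t = word_length G S (a \<otimes> b).
      L t \<boxtimes> right_block (\<beta> (L (a \<otimes> b))) t \<one>) k \<one> = 0"
    using kc by (auto simp: reg_unitary_coeff intro!: sum.neutral)
  then show ?thesis using \<beta>_expansion(1)[OF ab] by simp
qed

text \<open>
  A priori $\beta(\lambda_a)$ and $\beta(\lambda_b)$ are combinations of $\lambda_a$, $\lambda_b$ and
  $\lambda_{b^{-1}}$. Comparing coefficients in the images of $b^2 = b^{-1}$, $bb^{-1} = e$ and of the
  element $ab$ of length 2 forces $\beta(\lambda_a) = \lambda_a \otimes A$ and
  $\beta(\lambda_b) = \lambda_b \otimes D + \lambda_{b^{-1}} \otimes E$, where $D$ and $E$ have orthogonal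
  supports $D^3$ and $E^3$. All products of two generators are distinct apart from the obvious
  coincidences, which is why so few terms contribute to each coefficient.
\<close>

lemma generators_form:
  obtains A D E where "A \<in> R" "D \<in> R" "E \<in> R"
    "\<beta> (L a) = L a \<boxtimes> A" "\<beta> (L b) = L b \<boxtimes> D + L (b \<otimes> b) \<boxtimes> E"
    "A \<star> A = u" "op_adj A = A" "D \<star> D = op_adj D" "E \<star> E = op_adj E"
    "D \<star> E = 0" "E \<star> D = 0" "D \<star> (D \<star> D) + E \<star> (E \<star> E) = u"
proof -
  obtain A B B' where A: "A \<in> R" "B \<in> R" "B' \<in> R"
    and \<beta>a: "\<beta> (L a) = L a \<boxtimes> A + L b \<boxtimes> B + L (b \<otimes> b) \<boxtimes> B'"
    by (rule \<beta>_generator[of a]) auto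
  obtain F D E where D: "F \<in> R" "D \<in> R" "E \<in> R"
    and \<beta>b: "\<beta> (L b) = L a \<boxtimes> F + L b \<boxtimes> D + L (b \<otimes> b) \<boxtimes> E"
    by (rule \<beta>_generator[of b]) auto
  note mults = tensor_expand m_assoc
  note rm = reg_unitary_coeff neqs neqs'[simplified] m_assoc
  have ibb: "inv (b \<otimes> b) = b" by (simp add: inv_mult_group inv_b m_assoc)
  have adj: "op_adj A = A" "op_adj B = B'" "op_adj B' = B"
  proof -
    have e: "\<beta> (L a) = op_adj (\<beta> (L a))" using \<beta>_adj[of a] by simp
    show "op_adj A = A" "op_adj B = B'" "op_adj B' = B"
      using arg_cong[OF e, of "\<lambda>X. right_block X a \<one>"] arg_cong[OF e, of "\<lambda>X. right_block X b \<one>"]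
        arg_cong[OF e, of "\<lambda>X. right_block X (b \<otimes> b) \<one>"]
      by (simp_all add: \<beta>a rm ibb inv_b)
  qed
  have \<beta>b': "\<beta> (L (b \<otimes> b)) = L a \<boxtimes> op_adj F + L (b \<otimes> b) \<boxtimes> op_adj D + L b \<boxtimes> op_adj E"
    using \<beta>_adj[of b] by (simp add: \<beta>b inv_b ibb)
  have sq: "\<beta> (L (b \<otimes> b)) = \<beta> (L b) \<star> \<beta> (L b)" by (rule \<beta>_mult) auto
  \<comment> \<open>no product of two of $a, b, b^{-1}$ equals $a$, so $\beta(\lambda_b)^2$ has no term at $a$\<close>
  have "op_adj F = 0"
    using arg_cong[OF sq, of "\<lambda>X. right_block X a \<one>"] D by (simp add: \<beta>b \<beta>b' mults rm)
  then have F: "F = 0" by (metis op_adj_simps(1,3))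
  have DD: "D \<star> D = op_adj D" and EE: "E \<star> E = op_adj E"
    using arg_cong[OF sq, of "\<lambda>X. right_block X b \<one>"] arg_cong[OF sq, of "\<lambda>X. right_block X (b \<otimes> b) \<one>"] D
    by (simp_all add: \<beta>b \<beta>b' mults rm F)
  have cube: "\<beta> (L \<one>) = \<beta> (L b) \<star> \<beta> (L (b \<otimes> b))" using \<beta>_mult[of b "b \<otimes> b"] by simp
  have ED': "E \<star> (D \<star> D) = 0" and DE': "D \<star> (E \<star> E) = 0" and uu: "D \<star> (D \<star> D) + E \<star> (E \<star> E) = u"
    using arg_cong[OF cube, of "\<lambda>X. right_block X b \<one>"] arg_cong[OF cube, of "\<lambda>X. right_block X (b \<otimes> b) \<one>"]
      arg_cong[OF cube, of "\<lambda>X. right_block X \<one> \<one>"] D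
    by (simp_all add: \<beta>_one \<beta>b \<beta>b' mults rm F DD EE add.commute)
  \<comment> \<open>$DE^2 = 0 = ED^2$ is improved by inserting $u = D^3 + E^3$ on the right\<close>
  have DE: "D \<star> E = 0"
  proof -
    have "D \<star> E = D \<star> E \<star> (D \<star> (D \<star> D) + E \<star> (E \<star> E))" using D by (simp add: uu)
    also have "\<dots> = D \<star> (E \<star> (D \<star> D)) \<star> D + D \<star> (E \<star> E) \<star> (E \<star> E)"
      using D by (simp add: R_distrib R_assoc)
    finally show ?thesis by (simp only: ED' DE') simp
  qed
  have ED: "E \<star> D = 0"
  proof -
    have "E \<star> D = E \<star> D \<star> (D \<star> (D \<star> D) + E \<star> (E \<star> E))" using D by (simp add: uu)
    also have "\<dots> = E \<star> (D \<star> D) \<star> (D \<star> D) + E \<star> (D \<star> E) \<star> (E \<star> E)"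
      using D by (simp add: R_distrib R_assoc)
    finally show ?thesis by (simp only: ED' DE) simp
  qed
  have ab: "\<beta> (L (a \<otimes> b)) = \<beta> (L a) \<star> \<beta> (L b)" by (rule \<beta>_mult) auto
  \<comment> \<open>$\beta(\lambda_{ab})$ has no terms of length at most 1; here at $b^{-1}$ and at $e$\<close>
  have BD: "B \<star> D = 0" and mix: "B \<star> E + B' \<star> D = 0"
    using \<beta>_ab_short_coeff[of "b \<otimes> b"] \<beta>_ab_short_coeff[of \<one>] A D
    unfolding ab \<beta>a \<beta>b by (simp_all add: mults rm F add.commute)
  \<comment> \<open>each summand contains $BD$ or $BE + B'D$ as a factor, up to $DE = 0$\<close>
  have "B = B \<star> (D \<star> (D \<star> D) + E \<star> (E \<star> E))" using A by (simp add: uu)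
  also have "\<dots> = (B \<star> D) \<star> (D \<star> D) + (B \<star> E + B' \<star> D) \<star> (E \<star> E)"
    using A D DE by (simp add: R_distrib R_assoc) (simp add: R_assoc[symmetric] DE)
  finally have B: "B = 0" by (simp only: BD mix) simp
  then have B': "B' = 0" using adj(2) by simp
  have inv: "\<beta> (L \<one>) = \<beta> (L a) \<star> \<beta> (L a)" using \<beta>_mult[of a a] by simp
  have AA: "A \<star> A = u"
    using arg_cong[OF inv, of "\<lambda>X. right_block X \<one> \<one>"] A by (simp add: \<beta>_one \<beta>a B B' mults rm)
  show ?thesis
    by (rule that[OF A(1) D(2,3) _ _ AA adj(1) DD EE DE ED uu]) (simp_all add: \<beta>a \<beta>b B B' F)
qed

text \<open>
  Among the comparisons of coefficients, this one exploits the relation $(ab)^m = e$. Put $X = AD$ and $Y = AE$, so that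
  $\beta(\lambda_{ab}) = \lambda_{ab} \otimes X + \lambda_{ab^{-1}} \otimes Y$. In the $m$-th power the coefficient
  at $e$ receives only the two constant words, by \<open>turns_eq_one\<close>, so $X^m + Y^m = u$. Multiplying
  by $p$ and $p'$ on the right gives $X^m = p$ and $Y^m = p'$. The range of $X$ lies under the projection
  $ApA$ and that of $Y$ under $Ap'A$, so $ApAp = p$ and $Ap'Ap' = p'$; hence $ApA = p$.
\<close>

lemma projection_commutes:
  assumes R: "A \<in> R" "D \<in> R" "E \<in> R"
    and \<beta>a: "\<beta> (L a) = L a \<boxtimes> A" and \<beta>b: "\<beta> (L b) = L b \<boxtimes> D + L (b \<otimes> b) \<boxtimes> E"
    and AA: "A \<star> A = u" and DE: "D \<star> E = 0" and ED: "E \<star> D = 0"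
    and uu: "D \<star> (D \<star> D) + E \<star> (E \<star> E) = u"
  shows "A \<star> (D \<star> (D \<star> D)) = D \<star> (D \<star> D) \<star> A"
proof -
  define X where "X s = A \<star> (if s then D else E)" for s
  define pr where "pr ss = foldr (\<lambda>s r. X s \<star> r) ss u" for ss
  define p where "p = D \<star> (D \<star> D)"
  define p' where "p' = E \<star> (E \<star> E)"
  have XR [simp]: "X s \<in> R" for s using R by (simp add: X_def)
  have pr_Cons: "pr (s # ss) = X s \<star> pr ss" for s ss by (simp add: pr_def)
  have prR [simp]: "pr ss \<in> R" for ss by (induction ss) (simp_all add: pr_def)
  have pR [simp]: "p \<in> R" "p' \<in> R" using R by (simp_all add: p_def p'_def)
  have pu: "p + p' = u" using uu by (simp add: p_def p'_def)
  have D: "D \<star> p = D" "D \<star> p' = 0" "p \<star> D = D" "p' \<star> D = 0"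
    and E: "E \<star> p' = E" "E \<star> p = 0" "p' \<star> E = E" "p \<star> E = 0"
  proof -
    show 1: "D \<star> p' = 0" "p' \<star> D = 0" "E \<star> p = 0" "p \<star> E = 0"
      using R by (simp_all add: p_def p'_def R_assoc DE ED) (simp_all add: R_assoc[symmetric] DE ED)
    have "D \<star> (p + p') = D" "(p + p') \<star> D = D" "E \<star> (p + p') = E" "(p + p') \<star> E = E"
      unfolding pu using R by simp_all
    then show "D \<star> p = D" "p \<star> D = D" "E \<star> p' = E" "p' \<star> E = E"
      using R 1 by (simp_all add: R_distrib)
  qed
  let ?N = "\<lambda>n. {ss :: bool list. length ss = n}"
  have finN: "finite (?N n)" for n
    using finite_lists_length_eq[of "UNIV :: bool set" n] by simp
  have \<beta>ab: "\<beta> (L (a \<otimes> b)) = L (a \<otimes> b) \<boxtimes> X True + L (a \<otimes> (b \<otimes> b)) \<boxtimes> X False"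
    using R by (simp add: \<beta>_mult \<beta>a \<beta>b X_def op_mult_add_right tensor_mult)
  \<comment> \<open>expansion of the power into all words in the two terms of $\beta(\lambda_{ab})$\<close>
  have pow: "\<beta> (L ((a \<otimes> b) [^] n)) = (\<Sum>ss\<in>?N n. L (turns ss) \<boxtimes> pr ss)" for n :: nat
  proof (induction n)
    case 0
    have "?N 0 = {[]}" by auto
    then show ?case by (simp add: \<beta>_one pr_def)
  next
    case (Suc n)
    have split: "?N (Suc n) = (#) True ` ?N n \<union> (#) False ` ?N n"
      by (auto simp: length_Suc_conv)
    have left: "(L g \<boxtimes> X s) \<star> (\<Sum>ss\<in>?N n. L (turns ss) \<boxtimes> pr ss)
        = (\<Sum>ss\<in>?N n. L (g \<otimes> turns ss) \<boxtimes> pr (s # ss))" if "g \<in> carrier G" for g s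
      using that by (subst op_mult_sum_right) (auto simp: tensor_mult pr_Cons)
    have "\<beta> (L ((a \<otimes> b) [^] Suc n)) = \<beta> (L (a \<otimes> b)) \<star> (\<Sum>ss\<in>?N n. L (turns ss) \<boxtimes> pr ss)"
      using \<beta>_mult[of "a \<otimes> b" "(a \<otimes> b) [^] n"] nat_pow_Suc2[of "a \<otimes> b" n] by (simp only: Suc m_closed ab_closed nat_pow_closed)
    also have "\<dots> = (L (a \<otimes> b) \<boxtimes> X True) \<star> (\<Sum>ss\<in>?N n. L (turns ss) \<boxtimes> pr ss)
       + (L (a \<otimes> (b \<otimes> b)) \<boxtimes> X False) \<star> (\<Sum>ss\<in>?N n. L (turns ss) \<boxtimes> pr ss)"
      unfolding \<beta>ab by (rule op_mult_add_left) (auto intro!: bounded_sum)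
    also have "\<dots> = (\<Sum>ss\<in>?N n. L (turns (True # ss)) \<boxtimes> pr (True # ss))
       + (\<Sum>ss\<in>?N n. L (turns (False # ss)) \<boxtimes> pr (False # ss))"
      by (simp add: left m_assoc)
    also have "\<dots> = (\<Sum>ss\<in>?N (Suc n). L (turns ss) \<boxtimes> pr ss)"
      unfolding split using finN by (subst sum.union_disjoint) (auto simp: sum.reindex simp del: turns.simps)
    finally show ?case .
  qed
  have "L \<one> \<boxtimes> u = (\<Sum>ss\<in>?N m. L (turns ss) \<boxtimes> pr ss)"
    using pow[of m] by (simp add: ab_order \<beta>_one)
  from arg_cong[OF this, of "\<lambda>Z. right_block Z \<one> \<one>"]
  have "u = (\<Sum>ss\<in>?N m. if turns ss = \<one> then pr ss else 0)"
    by (simp add: reg_unitary_coeff if_distrib[of "\<lambda>c. op_scale c _"] cong: if_cong)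
  also have "\<dots> = (\<Sum>ss\<in>{replicate m True, replicate m False}. pr ss)"
    using finN by (intro sum.mono_neutral_cong_right) (auto simp: turns_eq_one)
  also have "\<dots> = pr (replicate m True) + pr (replicate m False)"
    using m by (subst sum.insert) (auto simp: numeral_eq_Suc)
  finally have one: "u = pr (replicate m True) + pr (replicate m False)" .
  obtain k where k: "m = Suc k" using m by (auto simp: numeral_eq_Suc)
  have pow_right: "pr (replicate (Suc n) s) = pr (replicate n s) \<star> X s" for n s
  proof (induction n)
    case (Suc n)
    have "pr (replicate (Suc (Suc n)) s) = X s \<star> (pr (replicate n s) \<star> X s)" using Suc by (simp add: pr_Cons)
    then show ?case by (simp add: pr_Cons R_assoc)
  qed (simp add: pr_def)
  have X: "X True \<star> p = X True" "X True \<star> p' = 0" "X False \<star> p = 0" "X False \<star> p' = X False"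
    using R by (simp_all add: X_def R_assoc D E)
  have powp: "pr (replicate m True) = p" "pr (replicate m False) = p'"
  proof -
    have pp: "pr (replicate m True) \<star> p = pr (replicate m True)" "pr (replicate m True) \<star> p' = 0"
      "pr (replicate m False) \<star> p = 0" "pr (replicate m False) \<star> p' = pr (replicate m False)"
      unfolding k pow_right by (simp_all only: R_assoc prR XR pR X op_mult_zero)
    have "pr (replicate m True) = (pr (replicate m True) + pr (replicate m False)) \<star> p"
      "pr (replicate m False) = (pr (replicate m True) + pr (replicate m False)) \<star> p'"
      by (simp_all add: R_distrib pp)
    then show "pr (replicate m True) = p" "pr (replicate m False) = p'"
      unfolding one[symmetric] by simp_all
  qed
  have Xl: "A \<star> (p \<star> A) \<star> X True = X True" "A \<star> (p' \<star> A) \<star> X False = X False"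
  proof -
    have "A \<star> (A \<star> y) = y" if "y \<in> R" for y using that R by (simp add: AA flip: R_assoc)
    then show "A \<star> (p \<star> A) \<star> X True = X True" "A \<star> (p' \<star> A) \<star> X False = X False"
      using R by (simp_all add: X_def R_assoc D E)
  qed
  have "A \<star> (p \<star> A) \<star> p = p" "A \<star> (p' \<star> A) \<star> p' = p'"
  proof -
    have "A \<star> (p \<star> A) \<star> pr (True # ss) = pr (True # ss)" "A \<star> (p' \<star> A) \<star> pr (False # ss) = pr (False # ss)" for ss
      using Xl R by (simp_all add: pr_Cons R_assoc[symmetric])
    then show "A \<star> (p \<star> A) \<star> p = p" "A \<star> (p' \<star> A) \<star> p' = p'"
      using powp by (auto simp: k)
  qed
  note c = this
  \<comment> \<open>$ApAp' = A(u - p')Ap' = p' - p' = 0$\<close>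
  have "A \<star> (p \<star> A) \<star> p' + p' = A \<star> ((p + p') \<star> A) \<star> p'"
    using R c(2) by (simp add: R_distrib)
  also have "\<dots> = p'" unfolding pu using R by (simp add: AA)
  finally have c0: "A \<star> (p \<star> A) \<star> p' = 0" by simp
  have "A \<star> (p \<star> A) = A \<star> (p \<star> A) \<star> (p + p')" unfolding pu using R by simp
  also have "\<dots> = p" using R c c0 by (simp add: R_distrib)
  finally have ApA: "A \<star> (p \<star> A) = p" .
  have "A \<star> p = A \<star> (A \<star> (p \<star> A))" by (simp only: ApA)
  also have "\<dots> = p \<star> A" using R by (simp add: R_assoc[symmetric] AA)
  finally show ?thesis by (simp add: p_def)
qed

text \<open>
  The shape of $\beta(\lambda_g)$ that is propagated along products: the two coefficients live
  under complementary projections, so mixed products vanish.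
\<close>

definition graded :: "'i opr \<Rightarrow> 'i opr \<Rightarrow> 'g \<Rightarrow> 'i opr \<Rightarrow> 'i opr \<Rightarrow> bool" where
  "graded p p' g U V \<longleftrightarrow> \<beta> (L g) = L g \<boxtimes> U + L (\<theta> g) \<boxtimes> V \<and>
     p \<star> U = U \<and> U \<star> p = U \<and> p' \<star> V = V \<and> V \<star> p' = V"

text \<open>
  It holds for $a$, by splitting $A = Ap + Ap'$, and for $b$, with $D$ and $E$; both are compatible with
  multiplication from the left.
\<close>

lemma graded_form:
  obtains p p' where "p \<in> R" "p' \<in> R" "p + p' = u" "op_adj p = p" "op_adj p' = p'"
    "p \<star> p' = 0" "p' \<star> p = 0"
    "\<forall>g\<in>carrier G. \<exists>U\<in>R. \<exists>V\<in>R. graded p p' g U V"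
proof -
  obtain A D E where R: "A \<in> R" "D \<in> R" "E \<in> R"
    and \<beta>: "\<beta> (L a) = L a \<boxtimes> A" "\<beta> (L b) = L b \<boxtimes> D + L (b \<otimes> b) \<boxtimes> E"
    and AA: "A \<star> A = u" "op_adj A = A" and DD: "D \<star> D = op_adj D" and EE: "E \<star> E = op_adj E"
    and DE: "D \<star> E = 0" "E \<star> D = 0" and uu: "D \<star> (D \<star> D) + E \<star> (E \<star> E) = u"
    by (rule generators_form)
  define p where "p = D \<star> (D \<star> D)"
  define p' where "p' = E \<star> (E \<star> E)"
  have pR [simp]: "p \<in> R" "p' \<in> R" using R by (simp_all add: p_def p'_def)
  have pu: "p + p' = u" using uu by (simp add: p_def p'_def)
  have Ap: "A \<star> p = p \<star> A" unfolding p_def by (rule projection_commutes[OF R \<beta> AA(1) DE uu])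
  have "A \<star> (p + p') = (p + p') \<star> A" unfolding pu using R by simp
  then have Ap': "A \<star> p' = p' \<star> A" using R Ap by (simp add: R_distrib)
  have adj: "op_adj p = p" "op_adj p' = p'"
    unfolding p_def p'_def DD EE by (simp_all add: op_adj_mult)
  have z: "D \<star> p' = 0" "p' \<star> D = 0" "E \<star> p = 0" "p \<star> E = 0" "p \<star> p' = 0" "p' \<star> p = 0"
    using R by (simp_all add: p_def p'_def R_assoc DE) (simp_all add: R_assoc[symmetric] DE)
  have "D \<star> (p + p') = D" "(p + p') \<star> D = D" "E \<star> (p + p') = E" "(p + p') \<star> E = E"
     "p \<star> (p + p') = p" "(p + p') \<star> p' = p'"
    unfolding pu using R by simp_all
  then have o: "D \<star> p = D" "p \<star> D = D" "E \<star> p' = E" "p' \<star> E = E" "p \<star> p = p" "p' \<star> p' = p'"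
    using R z by (simp_all add: R_distrib)
  let ?G = "graded p p'"
  have G1: "?G \<one> p p'" using o by (simp add: graded_def \<beta>_one flip: pu)
  have Ga: "?G a (A \<star> p) (A \<star> p')"
  proof -
    have "A = A \<star> p + A \<star> p'" using R by (simp add: pu flip: R_distrib)
    then have "\<beta> (L a) = L a \<boxtimes> (A \<star> p) + L (\<theta> a) \<boxtimes> (A \<star> p')" by (metis \<beta>(1) tensor_simps(2) theta_a)
    moreover have "p \<star> (A \<star> p) = A \<star> p" "p' \<star> (A \<star> p') = A \<star> p'"
      using R o by (simp_all add: Ap Ap' flip: R_assoc)
    ultimately show ?thesis using R o by (simp add: graded_def R_assoc)
  qed
  have Gb: "?G b D E" using o by (simp add: graded_def \<beta>(2) theta_b inv_b)
  have mult: "?G (g \<otimes> h) (U \<star> U') (V \<star> V')"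
    if g: "g \<in> carrier G" "h \<in> carrier G" and UV: "U \<in> R" "V \<in> R" "U' \<in> R" "V' \<in> R"
      and G: "?G g U V" "?G h U' V'" for g h U V U' V'
  proof -
    note Gg = G(1)[unfolded graded_def] and Gh = G(2)[unfolded graded_def]
    \<comment> \<open>the mixed products carry the factor $pp' = 0$ or $p'p = 0$\<close>
    have "U \<star> V' = U \<star> p \<star> (p' \<star> V')" "V \<star> U' = V \<star> p' \<star> (p \<star> U')" using Gg Gh by simp_all
    then have "U \<star> V' = U \<star> (p \<star> p') \<star> V'" "V \<star> U' = V \<star> (p' \<star> p) \<star> U'"
      using UV by (simp_all add: R_assoc)
    then have "U \<star> V' = 0" "V \<star> U' = 0" by (simp_all add: z)
    moreover have "\<beta> (L (g \<otimes> h)) = (L g \<boxtimes> U + L (\<theta> g) \<boxtimes> V) \<star> (L h \<boxtimes> U' + L (\<theta> h) \<boxtimes> V')"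
      using Gg Gh g by (simp only: \<beta>_mult)
    ultimately have "\<beta> (L (g \<otimes> h)) = L (g \<otimes> h) \<boxtimes> (U \<star> U') + L (\<theta> (g \<otimes> h)) \<boxtimes> (V \<star> V')"
      using g UV by (simp add: tensor_expand)
    moreover have "p \<star> (U \<star> U') = U \<star> U'" "p' \<star> (V \<star> V') = V \<star> V'"
      using Gg UV by (simp_all flip: R_assoc)
    moreover have "U \<star> U' \<star> p = U \<star> U'" "V \<star> V' \<star> p' = V \<star> V'"
      using Gh UV by (simp_all add: R_assoc)
    ultimately show ?thesis unfolding graded_def by blast
  qed
  have "\<exists>U\<in>R. \<exists>V\<in>R. ?G g U V" if "g \<in> carrier G" for g
    using that
  proof (induction rule: gen_induct)
    case one then show ?case using G1 pR by blast
  next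
    case (a g)
    then obtain U V where "U \<in> R" "V \<in> R" "?G g U V" by blast
    then have "?G (a \<otimes> g) (A \<star> p \<star> U) (A \<star> p' \<star> V)" using mult[OF ab_closed(1) a(1) _ _ _ _ Ga] R by simp
    moreover have "A \<star> p \<star> U \<in> R" "A \<star> p' \<star> V \<in> R" using R \<open>U \<in> R\<close> \<open>V \<in> R\<close> by simp_all
    ultimately show ?case by blast
  next
    case (b g)
    then obtain U V where "U \<in> R" "V \<in> R" "?G g U V" by blast
    then have "?G (b \<otimes> g) (D \<star> U) (E \<star> V)" using mult[OF ab_closed(2) b(1) _ _ _ _ Gb] R by simp
    moreover have "D \<star> U \<in> R" "E \<star> V \<in> R" using R \<open>U \<in> R\<close> \<open>V \<in> R\<close> by simp_all
    ultimately show ?case by blast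
  qed
  with pR pu adj z show ?thesis by (intro that[of p p']) blast+
qed

text \<open>
  The coefficients form a doubled family inside $Q$. Multiplicativity and the adjoint follow by
  uniqueness of graded coefficients. The coproduct is read off from coassociativity of $\beta$: this
  is immediate for $b$, which $\theta$ moves, and cubing gives the coproduct of the two
  projections; these in turn separate the two coefficients for all other $g$, including those fixed
  by $\theta$.
\<close>

theorem doubled_family_exists:
  "\<exists>T. doubled_family G \<theta> T \<and> (\<forall>s. \<forall>g\<in>carrier G. T s g \<in> R) \<and> T True \<one> + T False \<one> = u \<and>
    doubled_family.is_coproduct G \<theta> T \<Delta> \<and> doubled_family.is_coaction G \<theta> T \<beta>"
proof -
  obtain p p' where p: "p \<in> R" "p' \<in> R" "p + p' = u" "op_adj p = p" "op_adj p' = p'"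
    and pp: "p \<star> p' = 0" "p' \<star> p = 0"
    and ex: "\<forall>g\<in>carrier G. \<exists>U\<in>R. \<exists>V\<in>R. graded p p' g U V"
    by (rule graded_form)
  from ex obtain U V where UV: "\<And>g. g \<in> carrier G \<Longrightarrow> U g \<in> R \<and> V g \<in> R \<and>
      \<beta> (L g) = L g \<boxtimes> U g + L (\<theta> g) \<boxtimes> V g \<and>
       p \<star> U g = U g \<and> U g \<star> p = U g \<and> p' \<star> V g = V g \<and> V g \<star> p' = V g"
    unfolding graded_def by metis
  \<comment> \<open>the coefficient \<open>V g\<close> belongs to $\lambda_{\theta(g)}$, hence the shift by $\theta$\<close>
  define T where "T s g = (if s then U g else V (\<theta> g))" for s g
  have T_R [simp]: "T s g \<in> R" if "g \<in> carrier G" for s g using UV that by (simp add: T_def)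
  have \<beta>_T: "\<beta> (L g) = L g \<boxtimes> T True g + L (\<theta> g) \<boxtimes> T False (\<theta> g)" if "g \<in> carrier G" for g
    using UV that by (simp add: T_def)
  have gr: "p \<star> T True g = T True g" "T True g \<star> p = T True g" "p' \<star> T False g = T False g" "T False g \<star> p' = T False g"
    if "g \<in> carrier G" for g using UV that by (simp_all add: T_def)
  have gr0: "p \<star> T False g = 0" "T False g \<star> p = 0" "p' \<star> T True g = 0" "T True g \<star> p' = 0" if g: "g \<in> carrier G" for g
  proof -
    have "p \<star> (p' \<star> T False g) = p \<star> p' \<star> T False g" "T False g \<star> p' \<star> p = T False g \<star> (p' \<star> p)"
      "p' \<star> (p \<star> T True g) = p' \<star> p \<star> T True g" "T True g \<star> p \<star> p' = T True g \<star> (p \<star> p')"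
      using p g by (simp_all add: R_assoc)
    then show "p \<star> T False g = 0" "T False g \<star> p = 0" "p' \<star> T True g = 0" "T True g \<star> p' = 0"
      unfolding pp gr[OF g] by simp_all
  qed
  have uniq: "T True g = X" "T False (\<theta> g) = Y"
    if g: "g \<in> carrier G" and "X \<in> R" "Y \<in> R" and e: "\<beta> (L g) = L g \<boxtimes> X + L (\<theta> g) \<boxtimes> Y"
      and X: "p \<star> X = X" "p' \<star> X = 0" "p \<star> Y = 0" "p' \<star> Y = Y" for g X Y
    by (rule graded_coefficients_unique[OF g theta_closed[OF g] e[unfolded \<beta>_T[OF g]], of p p'];
        use p that in \<open>simp add: gr gr0\<close>)+
  have one: "T True \<one> = p" "T False \<one> = p'"
  proof -
    have "p \<star> (p + p') = p" "(p + p') \<star> p' = p'" using p(1,2) by (simp_all add: p(3))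
    then have id: "p \<star> p = p" "p' \<star> p' = p'" using p(1,2) pp by (simp_all add: R_distrib)
    have e: "\<beta> (L \<one>) = L \<one> \<boxtimes> p + L (\<theta> \<one>) \<boxtimes> p'"
      unfolding \<beta>_one p(3)[symmetric] by simp
    show "T True \<one> = p" "T False \<one> = p'" using uniq[OF one_closed p(1,2) e] id pp by simp_all
  qed
  have mult: "T s g \<star> T s' h = (if s = s' then T s (g \<otimes> h) else 0)"
    if g: "g \<in> carrier G" "h \<in> carrier G" for s s' g h
  proof -
    have cross: "T True x \<star> T False y = 0" "T False x \<star> T True y = 0"
      if "x \<in> carrier G" "y \<in> carrier G" for x y
    proof -
      have "T True x \<star> T False y = T True x \<star> p \<star> T False y" "T False x \<star> T True y = T False x \<star> p' \<star> T True y"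
        using that by (simp_all add: gr)
      then show "T True x \<star> T False y = 0" "T False x \<star> T True y = 0"
        using that p by (simp_all add: R_assoc gr0)
    qed
    have same: "T True (x \<otimes> y) = T True x \<star> T True y \<and> T False (\<theta> (x \<otimes> y)) = T False (\<theta> x) \<star> T False (\<theta> y)"
      if xy: "x \<in> carrier G" "y \<in> carrier G" for x y
    proof -
      have e: "\<beta> (L (x \<otimes> y)) = L (x \<otimes> y) \<boxtimes> (T True x \<star> T True y) + L (\<theta> (x \<otimes> y)) \<boxtimes> (T False (\<theta> x) \<star> T False (\<theta> y))"
        unfolding \<beta>_mult[OF xy] \<beta>_T[OF xy(1)] \<beta>_T[OF xy(2)]
        using xy by (simp add: tensor_expand cross)
      have "p \<star> (T True x \<star> T True y) = p \<star> T True x \<star> T True y" "p' \<star> (T True x \<star> T True y) = p' \<star> T True x \<star> T True y"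
        "p \<star> (T False (\<theta> x) \<star> T False (\<theta> y)) = p \<star> T False (\<theta> x) \<star> T False (\<theta> y)"
        "p' \<star> (T False (\<theta> x) \<star> T False (\<theta> y)) = p' \<star> T False (\<theta> x) \<star> T False (\<theta> y)"
        using xy p by (simp_all add: R_assoc)
      then show ?thesis
        using uniq[OF _ _ _ e] xy by (simp add: gr gr0)
    qed
    show ?thesis using same[OF g] same[of "\<theta> g" "\<theta> h"] cross[OF g] g by (cases s; cases s') simp_all
  qed
  have adj: "op_adj (T s g) = T s (inv g)" if g: "g \<in> carrier G" for s g
  proof -
    have "T True (inv x) = op_adj (T True x) \<and> T False (\<theta> (inv x)) = op_adj (T False (\<theta> x))"
      if x: "x \<in> carrier G" for x
    proof -
      have e: "\<beta> (L (inv x)) = L (inv x) \<boxtimes> op_adj (T True x) + L (\<theta> (inv x)) \<boxtimes> op_adj (T False (\<theta> x))"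
        unfolding \<beta>_adj[OF x] \<beta>_T[OF x] using x by simp
      have "p \<star> op_adj (T True x) = op_adj (T True x \<star> p)" "p' \<star> op_adj (T True x) = op_adj (T True x \<star> p')"
        "p \<star> op_adj (T False (\<theta> x)) = op_adj (T False (\<theta> x) \<star> p)" "p' \<star> op_adj (T False (\<theta> x)) = op_adj (T False (\<theta> x) \<star> p')"
        by (simp_all add: op_adj_mult p)
      then show ?thesis using uniq[OF _ _ _ e] x by (simp add: gr gr0)
    qed
    from this[OF g] this[of "\<theta> g"] show ?thesis using g by (cases s) simp_all
  qed
  interpret T: doubled_family G \<theta> T
    by unfold_locales (simp_all add: mult adj)
  have W: "T.W \<subseteq> R"
    by (rule op.span_minimal) (auto simp: T.basis_def R_subspace)
  have \<Delta>_hom: "unital_star_hom R (spatial_tensor R R) \<Delta>" using cqg by (simp add: is_cqg_def)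
  have \<Delta>_lin: "linear_on R \<Delta>" by (rule star_hom_linear[OF \<Delta>_hom])
  have \<Delta>_bd: "bounded_op (\<Delta> x)" if "x \<in> R" for x
    using \<Delta>_hom that unfolding unital_star_hom_def by (blast intro: bounded_spatial_tensor)
  have \<Delta>_mult: "\<Delta> (x \<star> y) = \<Delta> x \<star> \<Delta> y" if "x \<in> R" "y \<in> R" for x y
    using \<Delta>_hom that unfolding unital_star_hom_def by blast
  have red: "op_subspace (reduced_cstar G)"
    unfolding reduced_cstar_finite[OF finite_carrier] by (rule op.subspace_span)
  have coassoc: "L g \<boxtimes> (T True g \<boxtimes> T True g + T False g \<boxtimes> T False (\<theta> g))
      + L (\<theta> g) \<boxtimes> (T False (\<theta> g) \<boxtimes> T True g + T True (\<theta> g) \<boxtimes> T False (\<theta> g))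
      = L g \<boxtimes> \<Delta> (T True g) + L (\<theta> g) \<boxtimes> \<Delta> (T False (\<theta> g))" (is "?l = ?r")
    if g: "g \<in> carrier G" for g
  proof (rule reassoc_inj)
    have "reassoc ?l = tensor_id \<beta> (\<beta> (L g))"
      using g by (simp add: \<beta>_T tensor_id_linear[OF \<beta>_linear] left_in_intros[OF red] L_in add_ac)
    also have "\<dots> = reassoc (id_tensor \<Delta> (\<beta> (L g)))"
      using action L_in[OF g] by (simp add: cqg_action_def)
    also have "\<dots> = reassoc ?r"
      using g by (simp add: \<beta>_T id_tensor_linear[OF \<Delta>_lin] right_in_intros[OF R_subspace])
    finally show "reassoc ?l = reassoc ?r" .
  qed
  have \<Delta>b: "\<Delta> (T True b) = T True b \<boxtimes> T True b + T False b \<boxtimes> T False (\<theta> b)"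
    "\<Delta> (T False (\<theta> b)) = T False (\<theta> b) \<boxtimes> T True b + T True (\<theta> b) \<boxtimes> T False (\<theta> b)"
    using arg_cong[OF coassoc[of b], of "\<lambda>X. right_block X b \<one>"]
      arg_cong[OF coassoc[of b], of "\<lambda>X. right_block X (\<theta> b) \<one>"] neqs neqs'
    by (simp_all add: reg_unitary_coeff theta_b inv_b)
  have bbb: "\<theta> b \<otimes> (\<theta> b \<otimes> \<theta> b) = \<one>" by (simp flip: theta_mult)
  \<comment> \<open>the two projections are the cubes of \<open>T True b\<close> and \<open>T False (\<theta> b)\<close>\<close>
  have "\<Delta> (T True \<one>) = \<Delta> (T True b \<star> (T True b \<star> T True b))" by simp
  also have "\<dots> = \<Delta> (T True b) \<star> (\<Delta> (T True b) \<star> \<Delta> (T True b))"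
    by (simp only: \<Delta>_mult T_R R_closed ab_closed)
  finally have \<Delta>p: "\<Delta> (T True \<one>) = T True \<one> \<boxtimes> T True \<one> + T False \<one> \<boxtimes> T False \<one>"
    unfolding \<Delta>b by (simp add: tensor_expand bbb)
  have "\<Delta> (T False \<one>) = \<Delta> (T False (\<theta> b) \<star> (T False (\<theta> b) \<star> T False (\<theta> b)))" by (simp add: bbb)
  also have "\<dots> = \<Delta> (T False (\<theta> b)) \<star> (\<Delta> (T False (\<theta> b)) \<star> \<Delta> (T False (\<theta> b)))"
    by (simp only: \<Delta>_mult T_R R_closed ab_closed theta_closed)
  finally have \<Delta>p': "\<Delta> (T False \<one>) = T False \<one> \<boxtimes> T True \<one> + T True \<one> \<boxtimes> T False \<one>"
    unfolding \<Delta>b by (simp add: tensor_expand bbb)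
  have \<Delta>T: "\<Delta> (T True g) = T True g \<boxtimes> T True g + T False g \<boxtimes> T False (\<theta> g)"
    "\<Delta> (T False (\<theta> g)) = T False (\<theta> g) \<boxtimes> T True g + T True (\<theta> g) \<boxtimes> T False (\<theta> g)"
    if g: "g \<in> carrier G" for g
  proof -
    have "\<Delta> (T s \<one>) \<star> \<Delta> (T s' h) = (if s = s' then \<Delta> (T s h) else 0)" if "h \<in> carrier G" for s s' h
      using that linear_on_zero[OF \<Delta>_lin R_closed(1)] by (simp flip: \<Delta>_mult)
    note gd = this[of _ True True, simplified] this[of _ True False, simplified]
      this[of _ False True, simplified] this[of _ False False, simplified]
    have gd': "\<Delta> (T True \<one>) \<star> (T True x \<boxtimes> T True y + T False z \<boxtimes> T False w) = T True x \<boxtimes> T True y + T False z \<boxtimes> T False w"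
      "\<Delta> (T True \<one>) \<star> (T False x \<boxtimes> T True y + T True z \<boxtimes> T False w) = 0"
      "\<Delta> (T False \<one>) \<star> (T True x \<boxtimes> T True y + T False z \<boxtimes> T False w) = 0"
      "\<Delta> (T False \<one>) \<star> (T False x \<boxtimes> T True y + T True z \<boxtimes> T False w) = T False x \<boxtimes> T True y + T True z \<boxtimes> T False w"
      if "x \<in> carrier G" "y \<in> carrier G" "z \<in> carrier G" "w \<in> carrier G" for x y z w
      using that by (simp_all add: \<Delta>p \<Delta>p' tensor_expand)
    note uq = graded_coefficients_unique[OF g theta_closed[OF g] coassoc[OF g], of "\<Delta> (T True \<one>)" "\<Delta> (T False \<one>)"]
    show "\<Delta> (T True g) = T True g \<boxtimes> T True g + T False g \<boxtimes> T False (\<theta> g)"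
      by (rule uq(1)[symmetric]; use g in \<open>simp add: gd gd' \<Delta>_bd\<close>)
    show "\<Delta> (T False (\<theta> g)) = T False (\<theta> g) \<boxtimes> T True g + T True (\<theta> g) \<boxtimes> T False (\<theta> g)"
      by (rule uq(2)[symmetric]; use g in \<open>simp add: gd gd' \<Delta>_bd\<close>)
  qed
  have "\<Delta> (T s g) = T True g \<boxtimes> T s g + T False g \<boxtimes> T (\<not> s) (\<theta> g)" if g: "g \<in> carrier G" for s g
  proof (cases s)
    case True then show ?thesis using \<Delta>T(1)[OF g] by simp
  next
    case False
    have "\<Delta> (T False g) = T False g \<boxtimes> T True (\<theta> g) + T True g \<boxtimes> T False g"
      using \<Delta>T(2)[OF theta_closed[OF g]] unfolding theta_invol[OF g] .
    then show ?thesis using False by (simp only: add.commute) simp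
  qed
  then have "T.is_coproduct \<Delta>"
    unfolding T.is_coproduct_def by (intro conjI linear_on_mono[OF \<Delta>_lin W]) blast
  moreover have "T.is_coaction \<beta>" unfolding T.is_coaction_def using \<beta>_linear \<beta>_T by blast
  moreover have "T True \<one> + T False \<one> = u" by (simp add: one p)
  ultimately show ?thesis using T.doubled_family_axioms T_R by (intro exI[of _ T]) blast
qed

end

section \<open>The full group C*-algebra of a finite group\<close>

lemma has_sum_inj_iff:
  fixes f :: "'j \<Rightarrow> complex"
  assumes "inj h" "\<And>x. x \<notin> range h \<Longrightarrow> f x = 0"
  shows "(f has_sum s) UNIV \<longleftrightarrow> ((\<lambda>x. f (h x)) has_sum s) UNIV"
proof -
  have "(f has_sum s) UNIV \<longleftrightarrow> (f has_sum s) (range h)"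
    by (rule has_sum_cong_neutral) (use assms in auto)
  also have "\<dots> \<longleftrightarrow> ((\<lambda>x. f (h x)) has_sum s) UNIV"
    using has_sum_reindex[OF assms(1), of f s] by (simp add: o_def)
  finally show ?thesis .
qed

lemma infsum_inj:
  fixes f :: "'j \<Rightarrow> complex"
  assumes "inj h" "\<And>x. x \<notin> range h \<Longrightarrow> f x = 0"
  shows "infsum f UNIV = (\<Sum>\<^sub>\<infinity>x. f (h x))"
proof -
  have "infsum f UNIV = infsum f (range h)"
    by (rule infsum_cong_neutral) (use assms in auto)
  also have "\<dots> = (\<Sum>\<^sub>\<infinity>x. f (h x))"
    using infsum_reindex[OF assms(1), of f] by (simp add: o_def)
  finally show ?thesis .
qed

lemma op_id_mult [simp]: "op_id \<star> M = M" "M \<star> op_id = M"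
proof -
  have "(\<Sum>\<^sub>\<infinity>j. op_id i j * M j k) = M i k" "(\<Sum>\<^sub>\<infinity>j. M i j * op_id j k) = M i k" for i k
    using infsum_single[of i "\<lambda>j. op_id i j * M j k"] infsum_single[of k "\<lambda>j. M i j * op_id j k"]
    by (simp_all add: op_id_def)
  then show "op_id \<star> M = M" "M \<star> op_id = M" by (simp_all add: op_mult_def fun_eq_iff)
qed

text \<open>
  The hypothesis of \<open>diagonal_isometry_bounded\<close>, as a property that passes to direct sums.
\<close>

definition diag_isometry :: "'i opr \<Rightarrow> bool" where
  "diag_isometry U \<longleftrightarrow> (\<exists>d. (\<forall>i. d i \<in> {0, 1}) \<and>
     (\<forall>i j. ((\<lambda>k. cnj (U k i) * U k j) has_sum (if i = j then d i else 0)) UNIV))"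

lemma diag_isometry_bounded: "diag_isometry U \<Longrightarrow> bounded_op U"
  unfolding diag_isometry_def using diagonal_isometry_bounded by blast

lemma unitary_diag_isometry:
  assumes "bounded_op U" "op_adj U \<star> U = op_id"
  shows "((\<lambda>k. cnj (U k i) * U k j) has_sum (if i = j then 1 else 0)) UNIV"
proof -
  have "(\<lambda>k. op_adj U i k * U k j) summable_on UNIV"
    by (rule op_mult_summable) (use assms in auto)
  moreover have "(\<Sum>\<^sub>\<infinity>k. op_adj U i k * U k j) = (if i = j then 1 else 0)"
    using fun_cong[OF fun_cong[OF assms(2), of i], of j] by (simp add: op_mult_def op_id_def)
  ultimately show ?thesis by (simp add: has_sum_iff op_adj_def)
qed

lemma unitary_repD:
  assumes "unitary_rep G \<pi>" "g \<in> carrier G"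
  shows "bounded_op (\<pi> g)" "op_adj (\<pi> g) \<star> \<pi> g = op_id" "\<pi> g \<star> op_adj (\<pi> g) = op_id"
    "h \<in> carrier G \<Longrightarrow> \<pi> (g \<otimes>\<^bsub>G\<^esub> h) = \<pi> g \<star> \<pi> h"
  using assms by (auto simp: unitary_rep_def)

context group
begin

lemma unitary_rep_one: assumes "unitary_rep G \<pi>" shows "\<pi> \<one> = op_id"
proof -
  note r = unitary_repD[OF assms one_closed]
  have pp: "\<pi> \<one> \<star> \<pi> \<one> = \<pi> \<one>" using r(4)[OF one_closed] by simp
  have "op_adj (\<pi> \<one>) \<star> \<pi> \<one> \<star> \<pi> \<one> = op_adj (\<pi> \<one>) \<star> (\<pi> \<one> \<star> \<pi> \<one>)"
    by (rule op_mult_assoc) (use r in auto)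
  then show ?thesis unfolding pp r(2) op_id_mult .
qed

lemma unitary_rep_inv: assumes "unitary_rep G \<pi>" "g \<in> carrier G" shows "\<pi> (inv g) = op_adj (\<pi> g)"
proof -
  note r = unitary_repD[OF assms] unitary_repD[OF assms(1) inv_closed[OF assms(2)]]
  have "op_adj (\<pi> g) = op_adj (\<pi> g) \<star> (\<pi> g \<star> \<pi> (inv g))"
    using r(4)[of "inv g"] assms unitary_rep_one[OF assms(1)] by simp
  also have "\<dots> = \<pi> (inv g)" using r by (simp flip: op_mult_assoc)
  finally show ?thesis by simp
qed

abbreviation "F \<equiv> full_unitary G"

lemma full_unitary_fiber: "F g (\<pi>, i) (\<rho>, j) = (if \<pi> = \<rho> \<and> unitary_rep G \<pi> then \<pi> g i j else 0)"
  by (simp add: full_unitary_def)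

lemma full_unitary_mult [simp]:
  assumes "g \<in> carrier G" "h \<in> carrier G"
  shows "F g \<star> F h = F (g \<otimes> h)"
proof -
  have "(\<Sum>\<^sub>\<infinity>q. F g (\<pi>, i) q * F h q (\<rho>, k)) = F (g \<otimes> h) (\<pi>, i) (\<rho>, k)" for \<pi> i \<rho> k
  proof -
    have "(\<Sum>\<^sub>\<infinity>q. F g (\<pi>, i) q * F h q (\<rho>, k)) = (\<Sum>\<^sub>\<infinity>j. F g (\<pi>, i) (\<pi>, j) * F h (\<pi>, j) (\<rho>, k))"
    proof (rule infsum_inj)
      show "inj (Pair \<pi> :: nat \<Rightarrow> _)" by (simp add: inj_on_def)
      fix q :: "('a \<Rightarrow> nat opr) \<times> nat" assume q: "q \<notin> range (Pair \<pi>)"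
      then have "fst q \<noteq> \<pi>" by (metis prod.collapse rangeI)
      then show "F g (\<pi>, i) q * F h q (\<rho>, k) = 0" by (cases q) (simp add: full_unitary_fiber)
    qed
    also have "\<dots> = F (g \<otimes> h) (\<pi>, i) (\<rho>, k)"
    proof (cases "\<pi> = \<rho> \<and> unitary_rep G \<pi>")
      case True
      then show ?thesis using unitary_repD(4)[OF _ assms, of \<pi>] by (simp add: full_unitary_fiber op_mult_def)
    next
      case False
      then show ?thesis by (cases "\<pi> = \<rho>") (simp_all add: full_unitary_fiber)
    qed
    finally show ?thesis .
  qed
  then show ?thesis by (simp add: op_mult_def fun_eq_iff split_paired_all)
qed

lemma full_unitary_adj [simp]: "g \<in> carrier G \<Longrightarrow> op_adj (F g) = F (inv g)"
proof -
  assume g: "g \<in> carrier G"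
  have "cnj (F g (\<rho>, j) (\<pi>, i)) = F (inv g) (\<pi>, i) (\<rho>, j)" for \<pi> i \<rho> j
    using unitary_rep_inv[OF _ g, of \<pi>] by (cases "\<pi> = \<rho>") (simp_all add: full_unitary_fiber op_adj_def)
  then show ?thesis by (intro ext) (simp add: op_adj_def split_paired_all)
qed

lemma full_unitary_isometry: assumes g: "g \<in> carrier G" shows "diag_isometry (F g)"
proof -
  let ?d = "\<lambda>(\<pi>, i :: nat). if unitary_rep G \<pi> then 1 else 0 :: complex"
  have "((\<lambda>q. cnj (F g q (\<pi>, i)) * F g q (\<rho>, j)) has_sum (if (\<pi>, i) = (\<rho>, j) then ?d (\<pi>, i) else 0)) UNIV" for \<pi> i \<rho> j
  proof (subst has_sum_inj_iff[of "Pair \<pi> :: nat \<Rightarrow> _"])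
    show "inj (Pair \<pi> :: nat \<Rightarrow> _)" by (simp add: inj_on_def)
    show "cnj (F g q (\<pi>, i)) * F g q (\<rho>, j) = 0" if "q \<notin> range (Pair \<pi>)" for q
    proof -
      have "fst q \<noteq> \<pi>" using that by (metis prod.collapse rangeI)
      then show ?thesis by (cases q) (simp add: full_unitary_fiber)
    qed
    show "((\<lambda>k. cnj (F g (\<pi>, k) (\<pi>, i)) * F g (\<pi>, k) (\<rho>, j)) has_sum (if (\<pi>, i) = (\<rho>, j) then ?d (\<pi>, i) else 0)) UNIV"
    proof (cases "\<pi> = \<rho> \<and> unitary_rep G \<pi>")
      case True
      then have "((\<lambda>k. cnj (\<pi> g k i) * \<pi> g k j) has_sum (if i = j then 1 else 0)) UNIV"
        using unitary_diag_isometry[OF unitary_repD(1,2)[of G \<pi> g]] g by blast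
      moreover have "unitary_rep G \<rho>" using True by blast
      ultimately show ?thesis using True by (cases "i = j") (simp_all add: full_unitary_fiber)
    next
      case False
      then have "cnj (F g (\<pi>, k) (\<pi>, i)) * F g (\<pi>, k) (\<rho>, j) = 0" for k
        by (cases "\<pi> = \<rho>") (simp_all add: full_unitary_fiber)
      moreover have "(if (\<pi>, i) = (\<rho>, j) then ?d (\<pi>, i) else 0) = 0" using False by auto
      ultimately show ?thesis by (simp only: has_sum_0_simp)
    qed
  qed
  then show ?thesis unfolding diag_isometry_def
    by (intro exI[of _ ?d]) (simp add: split_paired_all)
qed

lemma full_unitary_bounded [simp]: "g \<in> carrier G \<Longrightarrow> bounded_op (F g)"
  using full_unitary_isometry by (rule diag_isometry_bounded)

lemma full_unitary_basis:
  assumes "finite (carrier G)"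
  shows "star_basis (F ` carrier G) (F \<one>)"
  by unfold_locales (use assms in \<open>auto intro!: op.span_base imageI\<close>)

lemma full_cstar_finite:
  assumes "finite (carrier G)"
  shows "full_cstar G = op_span (F ` carrier G)"
  unfolding full_cstar_def by (rule star_basis.closure_span[OF full_unitary_basis[OF assms]])

text \<open>
  The blocks of the full group C*-algebra include the left regular representation, carried over to
  the first $|G|$ natural numbers and extended by the identity. In its column at the neutral element,
  $\lambda_g$ has a single entry, whose position determines $g$. Matrix entries at these
  positions are therefore a basis dual to the $\lambda_g$.
\<close>

lemma full_unitary_dual_positions:
  assumes fin: "finite (carrier G)"
  shows "\<exists>q q0. \<forall>g\<in>carrier G. \<forall>h\<in>carrier G. F g (q h) q0 = (if g = h then 1 else 0)"
proof -
  obtain \<iota> where \<iota>: "bij_betw \<iota> (carrier G) {..<card (carrier G)}"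
    using ex_bij_betw_finite_nat[OF fin] by (auto simp: atLeast0LessThan)
  let ?N = "card (carrier G)"
  define \<kappa> where "\<kappa> = inv_into (carrier G) \<iota>"
  define \<sigma> where "\<sigma> g j = (if j < ?N then \<iota> (g \<otimes> \<kappa> j) else j)" for g j
  define \<rho> where "\<rho> g = (\<lambda>i j :: nat. if i = \<sigma> g j then 1 else 0 :: complex)" for g
  have \<kappa>: "\<kappa> j \<in> carrier G" "\<iota> (\<kappa> j) = j" if "j < ?N" for j
    using that \<iota> unfolding \<kappa>_def bij_betw_def by (auto intro: inv_into_into f_inv_into_f)
  have \<kappa>\<iota>: "\<kappa> (\<iota> g) = g" "\<iota> g < ?N" if "g \<in> carrier G" for g
    using that \<iota> unfolding \<kappa>_def bij_betw_def by auto
  have \<sigma>: "\<sigma> g (\<sigma> h j) = \<sigma> (g \<otimes> h) j" if "g \<in> carrier G" "h \<in> carrier G" for g h j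
    using that by (simp add: \<sigma>_def \<kappa> \<kappa>\<iota> m_assoc)
  have \<sigma>1: "\<sigma> \<one> j = j" for j by (simp add: \<sigma>_def \<kappa>)
  have \<sigma>i: "i = \<sigma> g j \<longleftrightarrow> \<sigma> (inv g) i = j" if "g \<in> carrier G" for g i j
    using \<sigma>[of g "inv g" i] \<sigma>[of "inv g" g j] that by (auto simp: \<sigma>1)
  have mult: "\<rho> g \<star> \<rho> h = \<rho> (g \<otimes> h)" if "g \<in> carrier G" "h \<in> carrier G" for g h
  proof -
    have "(\<Sum>\<^sub>\<infinity>j. \<rho> g i j * \<rho> h j k) = \<rho> (g \<otimes> h) i k" for i k
      using infsum_single[of "\<sigma> h k" "\<lambda>j. \<rho> g i j * \<rho> h j k"] \<sigma>[OF that] by (simp add: \<rho>_def)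
    then show ?thesis by (simp add: op_mult_def fun_eq_iff)
  qed
  have adj: "op_adj (\<rho> g) = \<rho> (inv g)" if "g \<in> carrier G" for g
    using \<sigma>i[OF that] by (auto simp: op_adj_def \<rho>_def fun_eq_iff)
  have one: "\<rho> \<one> = op_id" by (simp add: \<rho>_def op_id_def \<sigma>1)
  have bd: "bounded_op (\<rho> g)" if g: "g \<in> carrier G" for g
  proof (rule diagonal_isometry_bounded[where d="\<lambda>_. 1"])
    fix i j
    have "\<sigma> g i = \<sigma> g j \<longleftrightarrow> i = j" using \<sigma>i[OF g] by metis
    then show "((\<lambda>k. cnj (\<rho> g k i) * \<rho> g k j) has_sum (if i = j then 1 else 0)) UNIV"
      using has_sum_single[of "\<sigma> g i" "\<lambda>k. cnj (\<rho> g k i) * \<rho> g k j"] by (auto simp: \<rho>_def)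
  qed simp
  have rep: "unitary_rep G \<rho>"
    unfolding unitary_rep_def by (simp add: bd adj mult one)
  have "F g (\<rho>, \<iota> h) (\<rho>, \<iota> \<one>) = (if g = h then 1 else 0)" if "g \<in> carrier G" "h \<in> carrier G" for g h
  proof -
    have "\<iota> h = \<iota> g \<longleftrightarrow> h = g" using that \<iota> by (auto simp: bij_betw_def inj_on_def)
    then show ?thesis using that rep by (auto simp: full_unitary_fiber \<rho>_def \<sigma>_def \<kappa>\<iota>)
  qed
  then show ?thesis by (intro exI[of _ "\<lambda>h. (\<rho>, \<iota> h)"] exI[of _ "(\<rho>, \<iota> \<one>)"] ballI)
qed

end

text \<open>
  The entries at dual positions stand for the coordinate functionals of a basis. All homomorphisms
  out of the group algebra and out of the doubling are built from this lemma.
\<close>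

lemma linear_extension:
  fixes v :: "'k \<Rightarrow> 'i opr" and w :: "'k \<Rightarrow> 'j opr"
  assumes fin: "finite K" and dual: "\<And>k l. k \<in> K \<Longrightarrow> l \<in> K \<Longrightarrow> v l (r k) (c k) = (if k = l then 1 else 0)"
  shows "\<exists>f. linear_on UNIV f \<and> (\<forall>k\<in>K. f (v k) = w k)"
proof -
  define f where "f x = (\<Sum>k\<in>K. op_scale (x (r k) (c k)) (w k))" for x :: "'i opr"
  have "f (x + y) = f x + f y" for x y
    unfolding f_def plus_fun_apply op.scale_left_distrib sum.distrib ..
  moreover have "f (op_scale d x) = op_scale d (f x)" for d x
    unfolding f_def op.scale_sum_right by (simp add: op_scale_def[of d x])
  ultimately have "linear_on UNIV f" by (simp only: linear_on_def) blast
  moreover have "f (v l) = w l" if "l \<in> K" for l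
  proof -
    have "f (v l) = (\<Sum>k\<in>K. if k = l then w k else 0)"
      unfolding f_def using that dual by (intro sum.cong) auto
    also have "\<dots> = w l" using fin that by simp
    finally show ?thesis .
  qed
  ultimately show ?thesis by blast
qed

text \<open>
  Justifies the choice in \<open>full_hom\<close>: every unitary representation in \<open>B\<close> extends from the
  canonical unitaries, which are linearly independent.
\<close>

lemma (in group) full_hom_exists:
  assumes fin: "finite (carrier G)" and B: "op_subspace B"
    and w: "\<And>g. g \<in> carrier G \<Longrightarrow> w g \<in> B" "\<And>g. g \<in> carrier G \<Longrightarrow> bounded_op (w g)"
      "\<And>g h. g \<in> carrier G \<Longrightarrow> h \<in> carrier G \<Longrightarrow> w (g \<otimes> h) = w g \<star> w h"
      "\<And>g. g \<in> carrier G \<Longrightarrow> w (inv g) = op_adj (w g)" "w \<one> = unit_of B"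
  shows "unital_star_hom (full_cstar G) B (full_hom G B w)"
    "g \<in> carrier G \<Longrightarrow> full_hom G B w (F g) = w g"
proof -
  obtain q q0 where dual: "\<And>g h. g \<in> carrier G \<Longrightarrow> h \<in> carrier G \<Longrightarrow> F g (q h) q0 = (if g = h then 1 else 0)"
    using full_unitary_dual_positions[OF fin] by blast
  have "\<exists>f. linear_on UNIV f \<and> (\<forall>g\<in>carrier G. f (F g) = w g)"
    by (rule linear_extension[OF fin, of F q "\<lambda>_. q0"]) (auto simp: dual)
  then obtain f where f: "linear_on UNIV f" "\<And>g. g \<in> carrier G \<Longrightarrow> f (F g) = w g" by blast
  interpret C: star_basis "F ` carrier G" "F \<one>" by (rule full_unitary_basis[OF fin])
  have "unital_star_hom (full_cstar G) B f"
    unfolding full_cstar_finite[OF fin]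
    by (rule C.star_homI[OF linear_on_mono[OF f(1) subset_UNIV] B]) (auto simp: f(2) w)
  then have ex: "\<exists>f. unital_star_hom (full_cstar G) B f \<and> (\<forall>g\<in>carrier G. f (F g) = w g)"
    using f(2) by blast
  show "unital_star_hom (full_cstar G) B (full_hom G B w)"
    "g \<in> carrier G \<Longrightarrow> full_hom G B w (F g) = w g"
    using someI_ex[OF ex] unfolding full_hom_def by blast+
qed

lemma dsum_simps [simp]:
  "dsum_fst (x + y) = dsum_fst x + dsum_fst y" "dsum_snd (x + y) = dsum_snd x + dsum_snd y"
  "dsum_fst (op_scale c x) = op_scale c (dsum_fst x)" "dsum_snd (op_scale c x) = op_scale c (dsum_snd x)"
  "dsum_fst (dsum_inl a) = a" "dsum_snd (dsum_inl a) = 0" "dsum_fst (dsum_inr a) = 0" "dsum_snd (dsum_inr a) = a"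
  by (auto simp: dsum_fst_def dsum_snd_def dsum_inl_def dsum_inr_def op_scale_def fun_eq_iff)

lemma dsum_inj_linear:
  "dsum_inl (a + b) = dsum_inl a + dsum_inl b" "dsum_inl (op_scale c a) = op_scale c (dsum_inl a)"
  "dsum_inr (a + b) = dsum_inr a + dsum_inr b" "dsum_inr (op_scale c a) = op_scale c (dsum_inr a)"
  "dsum_inl 0 = 0" "dsum_inr 0 = 0"
  by (auto simp: dsum_inl_def dsum_inr_def op_scale_def fun_eq_iff split: sum.splits)

lemma dsum_adj: "op_adj (dsum_inl a) = dsum_inl (op_adj a)" "op_adj (dsum_inr a) = dsum_inr (op_adj a)"
  by (auto simp: dsum_inl_def dsum_inr_def op_adj_def fun_eq_iff split: sum.splits)

lemma dsum_mult:
  fixes a b :: "'i opr"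
  shows "dsum_inl a \<star> dsum_inl b = dsum_inl (a \<star> b)" "dsum_inr a \<star> dsum_inr b = dsum_inr (a \<star> b)"
    "dsum_inl a \<star> dsum_inr b = 0" "dsum_inr a \<star> dsum_inl b = 0"
proof -
  have l: "infsum f UNIV = (\<Sum>\<^sub>\<infinity>i. f (Inl i))" if "\<And>j. f (Inr j) = 0" for f :: "'i + 'i \<Rightarrow> complex"
  proof (rule infsum_inj)
    show "f x = 0" if "x \<notin> range Inl" for x using that \<open>\<And>j. f (Inr j) = 0\<close> by (cases x) auto
  qed simp
  have r: "infsum f UNIV = (\<Sum>\<^sub>\<infinity>i. f (Inr i))" if "\<And>j. f (Inl j) = 0" for f :: "'i + 'i \<Rightarrow> complex"
  proof (rule infsum_inj)
    show "f x = 0" if "x \<notin> range Inr" for x using that \<open>\<And>j. f (Inl j) = 0\<close> by (cases x) auto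
  qed simp
  show "dsum_inl a \<star> dsum_inl b = dsum_inl (a \<star> b)"
    unfolding op_mult_def fun_eq_iff
    by (intro allI, subst l) (auto simp: dsum_inl_def split: sum.splits)
  show "dsum_inr a \<star> dsum_inr b = dsum_inr (a \<star> b)"
    unfolding op_mult_def fun_eq_iff
    by (intro allI, subst r) (auto simp: dsum_inr_def split: sum.splits)
  have "dsum_inl a p q * dsum_inr b q s = 0" "dsum_inr a p q * dsum_inl b q s = 0" for p q s
    by (auto simp: dsum_inr_def dsum_inl_def split: sum.splits)
  then show "dsum_inl a \<star> dsum_inr b = 0" "dsum_inr a \<star> dsum_inl b = 0"
    unfolding op_mult_def by (intro ext; simp only: infsum_0_simp zero_fun_apply)+
qed

lemma diag_isometry_extend:
  fixes U :: "'i opr" and V :: "'j opr"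
  assumes "diag_isometry U" and h: "inj h" "\<And>i j. V (h i) (h j) = U i j"
    and V: "\<And>p q. p \<notin> range h \<or> q \<notin> range h \<Longrightarrow> V p q = 0"
  shows "diag_isometry V"
proof -
  obtain d where d: "\<And>i. d i \<in> {0, 1}"
    and U: "\<And>i j. ((\<lambda>k. cnj (U k i) * U k j) has_sum (if i = j then d i else 0)) UNIV"
    using assms(1) by (auto simp: diag_isometry_def)
  define d' where "d' p = (if p \<in> range h then d (inv_into UNIV h p) else 0)" for p
  have "((\<lambda>k. cnj (V k p) * V k q) has_sum (if p = q then d' p else 0)) UNIV" for p q
  proof (subst has_sum_inj_iff[OF h(1)])
    show "cnj (V k p) * V k q = 0" if "k \<notin> range h" for k using that V by simp
    show "((\<lambda>k. cnj (V (h k) p) * V (h k) q) has_sum (if p = q then d' p else 0)) UNIV"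
    proof (cases "p \<in> range h \<and> q \<in> range h")
      case True
      then obtain i j where "p = h i" "q = h j" by blast
      then show ?thesis using U[of i j] h by (cases "i = j") (simp_all add: d'_def inj_eq)
    next
      case False
      then have "cnj (V (h k) p) * V (h k) q = 0" for k using V by auto
      moreover have "(if p = q then d' p else 0) = 0" using False by (auto simp: d'_def)
      ultimately show ?thesis by (simp only: has_sum_0_simp)
    qed
  qed
  moreover have "d' p \<in> {0, 1}" for p using d by (simp add: d'_def)
  ultimately show ?thesis unfolding diag_isometry_def by blast
qed

lemma dsum_isometry:
  assumes "diag_isometry U" shows "diag_isometry (dsum_inl U)" "diag_isometry (dsum_inr U)"
  by (rule diag_isometry_extend[OF assms, of Inl], auto simp: dsum_inl_def split: sum.split)
    (rule diag_isometry_extend[OF assms, of Inr], auto simp: dsum_inr_def split: sum.split)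

section \<open>Universality of the doubling\<close>

lemma tensor_map_linear:
  assumes f: "linear_on UNIV f" and h: "linear_on V h"
  shows "right_in V X \<Longrightarrow> right_in V Y \<Longrightarrow> tensor_map f h (X + Y) = tensor_map f h X + tensor_map f h Y"
    "right_in V X \<Longrightarrow> tensor_map f h (op_scale c X) = op_scale c (tensor_map f h X)"
    "b \<in> V \<Longrightarrow> tensor_map f h (a \<boxtimes> b) = f a \<boxtimes> h b"
    "0 \<in> V \<Longrightarrow> tensor_map f h 0 = 0"
  by (simp_all add: tensor_map_def tensor_id_linear[OF f] id_tensor_linear[OF h] left_in_def)

context involutive_group
begin

text \<open>
  A homomorphism that intertwines the actions respects the doubled families. At an element moved by
  $\theta$ the two coefficients are visible separately; multiplying the values at $k$ and $k^{-1}$ yields the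
  values at the two projections \<open>T s \<one>\<close>, and these separate the coefficients everywhere else.
\<close>

lemma family_determined:
  fixes T :: "bool \<Rightarrow> 'a \<Rightarrow> 'i opr" and T' :: "bool \<Rightarrow> 'a \<Rightarrow> 'j opr"
  assumes T: "doubled_family G \<theta> T" and T': "doubled_family G \<theta> T'"
    and k: "k \<in> carrier G" "\<theta> k \<noteq> k"
    and f: "f 0 = 0" "\<And>s g. g \<in> carrier G \<Longrightarrow> bounded_op (f (T s g))"
      "\<And>s s' g h. g \<in> carrier G \<Longrightarrow> h \<in> carrier G \<Longrightarrow> f (T s g \<star> T s' h) = f (T s g) \<star> f (T s' h)"
    and eq: "\<And>g. g \<in> carrier G \<Longrightarrow> L g \<boxtimes> T' True g + L (\<theta> g) \<boxtimes> T' False (\<theta> g)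
       = L g \<boxtimes> f (T True g) + L (\<theta> g) \<boxtimes> f (T False (\<theta> g))"
    and g: "g \<in> carrier G"
  shows "f (T s g) = T' s g"
proof -
  interpret T: doubled_family G \<theta> T by (rule T)
  interpret T': doubled_family G \<theta> T' by (rule T')
  have moved: "f (T True x) = T' True x \<and> f (T False (\<theta> x)) = T' False (\<theta> x)"
    if x: "x \<in> carrier G" "\<theta> x \<noteq> x" for x
    using arg_cong[OF eq[OF x(1)], of "\<lambda>X. right_block X x \<one>"]
      arg_cong[OF eq[OF x(1)], of "\<lambda>X. right_block X (\<theta> x) \<one>"] x
    by (simp add: reg_unitary_coeff)
  have ik: "inv k \<in> carrier G" "\<theta> (inv k) \<noteq> inv k" using k by (auto simp: inv_inj inj_on_eq_iff[OF inv_inj])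
  have "f (T True k \<star> T True (inv k)) = T' True k \<star> T' True (inv k)"
    "f (T False (\<theta> k) \<star> T False (\<theta> (inv k))) = T' False (\<theta> k) \<star> T' False (\<theta> (inv k))"
    unfolding f(3)[OF k(1) ik(1)] f(3)[OF theta_closed[OF k(1)] theta_closed[OF ik(1)]]
    using moved[OF k] moved[OF ik] by simp_all
  then have one: "f (T s \<one>) = T' s \<one>" for s using k by (cases s) simp_all
  have gr: "T' s \<one> \<star> f (T s' x) = (if s = s' then f (T s' x) else 0)" if "x \<in> carrier G" for s s' x
  proof (cases "s = s'")
    case True
    then show ?thesis using f(3)[OF one_closed that, of s s'] that by (simp add: one)
  next
    case False
    then have "T s \<one> \<star> T s' x = 0" using that by simp
    then show ?thesis using f(3)[OF one_closed that, of s s'] False f(1) by (simp only: one if_False)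
  qed
  have "T' True x = f (T True x) \<and> T' False (\<theta> x) = f (T False (\<theta> x))" if x: "x \<in> carrier G" for x
    using graded_coefficients_unique[OF x theta_closed[OF x] eq[OF x], of "T' True \<one>" "T' False \<one>"] x
    by (simp add: gr f(2))
  from this[OF g] this[OF theta_closed[OF g]] show ?thesis using g by (cases s) simp_all
qed

definition doubling_family :: "bool \<Rightarrow> 'a \<Rightarrow> ('a full_index + 'a full_index) opr" where
  "doubling_family s g = (if s then dsum_inl (F g) else dsum_inr (F g))"

sublocale D: doubled_family G \<theta> doubling_family
proof
  fix g s assume g: "g \<in> carrier G"
  show "bounded_op (doubling_family s g)"
    using dsum_isometry[OF full_unitary_isometry[OF g]] by (simp add: doubling_family_def diag_isometry_bounded)
  show "op_adj (doubling_family s g) = doubling_family s (inv g)" using g by (simp add: doubling_family_def dsum_adj)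
  fix h s' assume "h \<in> carrier G"
  then show "doubling_family s g \<star> doubling_family s' h = (if s = s' then doubling_family s (g \<otimes> h) else 0)"
    using g by (simp add: doubling_family_def dsum_mult)
qed

abbreviation "C \<equiv> full_cstar G"
abbreviation "DG \<equiv> doubling (full_cqg G) (full_aut G \<theta>)"

lemma C_span: "C = op_span (F ` carrier G)"
  by (rule full_cstar_finite[OF finite_carrier])

interpretation C: star_basis "F ` carrier G" "F \<one>"
  by (rule full_unitary_basis[OF finite_carrier])

lemma C_in: "g \<in> carrier G \<Longrightarrow> F g \<in> C"
  unfolding C_span by (auto intro: op.span_base)

lemma C_subspace: "op_subspace C" unfolding C_span by (rule op.subspace_span)

lemma full_aut_hom:
  "unital_star_hom C C (full_aut G \<theta>)" "g \<in> carrier G \<Longrightarrow> full_aut G \<theta> (F g) = F (\<theta> g)"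
proof -
  have u: "F (\<theta> \<one>) = unit_of C" unfolding C_span C.unit_of_span by simp
  show "unital_star_hom C C (full_aut G \<theta>)" "g \<in> carrier G \<Longrightarrow> full_aut G \<theta> (F g) = F (\<theta> g)"
    unfolding full_aut_def
    using full_hom_exists[OF finite_carrier C_subspace, of "\<lambda>g. F (\<theta> g)"] u C_in by simp_all
qed

lemma spatial_CC: "spatial_tensor C C = op_span (tensor_set (F ` carrier G) (F ` carrier G))"
  unfolding C_span by (rule spatial_tensor_finite_span[OF C.fin C.fin C.bounded C.bounded])

lemma full_comult_hom:
  "unital_star_hom C (spatial_tensor C C) (comult (full_cqg G))"
  "g \<in> carrier G \<Longrightarrow> comult (full_cqg G) (F g) = F g \<boxtimes> F g"
proof -
  interpret CC: star_basis "tensor_set (F ` carrier G) (F ` carrier G)" "F \<one> \<boxtimes> F \<one>"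
    by (rule star_basis_tensor) (rule C.star_basis_axioms)+
  have u: "F \<one> \<boxtimes> F \<one> = unit_of (spatial_tensor C C)" unfolding spatial_CC CC.unit_of_span ..
  have i: "F g \<boxtimes> F g \<in> spatial_tensor C C" if "g \<in> carrier G" for g
    unfolding spatial_CC using that by (intro tensor_in_span) (auto intro: op.span_base)
  have s: "op_subspace (spatial_tensor C C)" unfolding spatial_CC by (rule op.subspace_span)
  show "unital_star_hom C (spatial_tensor C C) (comult (full_cqg G))"
    "g \<in> carrier G \<Longrightarrow> comult (full_cqg G) (F g) = F g \<boxtimes> F g"
    unfolding full_cqg_def
    using full_hom_exists[OF finite_carrier s, of "\<lambda>g. F g \<boxtimes> F g"] u i by (simp_all add: tensor_mult)
qed

lemma full_comult_right_in:
  assumes "x \<in> C" shows "right_in C (comult (full_cqg G) x)"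
proof -
  have "comult (full_cqg G) x \<in> op_span (tensor_set (F ` carrier G) (F ` carrier G))"
    using full_comult_hom(1) assms unfolding unital_star_hom_def spatial_CC by blast
  then show ?thesis unfolding C_span by (rule tensor_span_blocks)
qed

lemma DG_alg: "alg DG = D.W"
proof
  have l: "linear_on UNIV dsum_inl" "linear_on UNIV dsum_inr" by (simp_all add: linear_on_def dsum_inj_linear)
  have i: "dsum_inl a \<in> D.W \<and> dsum_inr a \<in> D.W" if "a \<in> C" for a
    using that unfolding C_span
    by (rule op_span_induct[where P="\<lambda>a. dsum_inl a \<in> D.W \<and> dsum_inr a \<in> D.W"])
      (auto simp: dsum_inj_linear op.span_zero op.span_add op.span_scale D.basis_def doubling_family_def intro!: op.span_base)
  then show "alg DG \<subseteq> D.W" by (auto simp: doubling_def full_cqg_def intro: op.span_add)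
  have "op_subspace (alg DG)"
    unfolding op.subspace_def
  proof (intro conjI ballI allI)
    have "dsum_inl 0 + dsum_inr 0 = (0 :: ('a full_index + 'a full_index) opr)"
      by (simp only: dsum_inj_linear add_0)
    then have "\<exists>a b. (0 :: ('a full_index + 'a full_index) opr) = dsum_inl a + dsum_inr b \<and> a \<in> C \<and> b \<in> C"
      using op.subspace_0[OF C_subspace] by metis
    then show "0 \<in> alg DG" by (simp add: doubling_def full_cqg_def)
    fix x y c assume x: "x \<in> alg DG" and y: "y \<in> alg DG"
    then obtain a b a' b' where ab: "a \<in> C" "b \<in> C" "a' \<in> C" "b' \<in> C"
      "x = dsum_inl a + dsum_inr b" "y = dsum_inl a' + dsum_inr b'"
      by (auto simp: doubling_def full_cqg_def)
    have "x + y = dsum_inl (a + a') + dsum_inr (b + b')" by (simp add: ab dsum_inj_linear add_ac)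
    moreover have "a + a' \<in> C" "b + b' \<in> C" using ab op.subspace_add[OF C_subspace] by auto
    ultimately show "x + y \<in> alg DG" by (auto simp: doubling_def full_cqg_def)
  next
    fix x c assume x: "x \<in> alg DG"
    then obtain a b where ab: "a \<in> C" "b \<in> C" "x = dsum_inl a + dsum_inr b"
      by (auto simp: doubling_def full_cqg_def)
    have "op_scale c x = dsum_inl (op_scale c a) + dsum_inr (op_scale c b)"
      by (simp add: ab dsum_inj_linear op.scale_right_distrib)
    moreover have "op_scale c a \<in> C" "op_scale c b \<in> C" using ab op.subspace_scale[OF C_subspace] by auto
    ultimately show "op_scale c x \<in> alg DG" by (auto simp: doubling_def full_cqg_def)
  qed
  moreover have "doubling_family s g \<in> alg DG" if "g \<in> carrier G" for s g
  proof -
    have "doubling_family s g = dsum_inl (if s then F g else 0) + dsum_inr (if s then 0 else F g)"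
      by (simp add: doubling_family_def dsum_inj_linear)
    moreover have "(if s then F g else 0) \<in> C" "(if s then 0 else F g) \<in> C"
      using that C_in op.subspace_0[OF C_subspace] by auto
    ultimately have "\<exists>a b. doubling_family s g = dsum_inl a + dsum_inr b \<and> a \<in> C \<and> b \<in> C" by blast
    then show ?thesis by (simp add: doubling_def full_cqg_def)
  qed
  ultimately show "D.W \<subseteq> alg DG" by (intro op.span_minimal) (auto simp: D.basis_def)
qed

lemma DG_coproduct: "D.is_coproduct (comult DG)"
proof -
  have inl: "linear_on UNIV dsum_inl" and inr: "linear_on UNIV dsum_inr"
    by (simp_all add: linear_on_def dsum_inj_linear)
  have aut: "linear_on C (full_aut G \<theta>)" by (rule star_hom_linear[OF full_aut_hom(1)])
  have h: "linear_on C dsum_inl" "linear_on C dsum_inr" "linear_on C (dsum_inr \<circ> full_aut G \<theta>)" "linear_on C (dsum_inl \<circ> full_aut G \<theta>)"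
    using aut by (simp_all add: linear_on_def dsum_inj_linear)
  note tm = tensor_map_linear[OF inl h(1)] tensor_map_linear[OF inl h(2)]
     tensor_map_linear[OF inr h(3)] tensor_map_linear[OF inr h(4)]
  have \<Delta>0: "linear_on C (comult (full_cqg G))" by (rule star_hom_linear[OF full_comult_hom(1)])
  have C0: "0 \<in> C" by (rule op.subspace_0[OF C_subspace])
  have fs: "dsum_fst x \<in> C" "dsum_snd x \<in> C" if "x \<in> D.W" for x
  proof -
    obtain a b where "a \<in> C" "b \<in> C" "x = dsum_inl a + dsum_inr b"
      using \<open>x \<in> D.W\<close> unfolding DG_alg[symmetric] by (auto simp: doubling_def full_cqg_def)
    then show "dsum_fst x \<in> C" "dsum_snd x \<in> C" by simp_all
  qed
  note lin = linear_onD[OF \<Delta>0] fs full_comult_right_in tm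
  have "linear_on D.W (comult DG)"
    unfolding linear_on_def
    by (auto simp: doubling_def lin op.scale_right_distrib add_ac)
  moreover have "comult DG (doubling_family s g) = doubling_family True g \<boxtimes> doubling_family s g + doubling_family False g \<boxtimes> doubling_family (\<not> s) (\<theta> g)"
    if "g \<in> carrier G" for s g
    using that C_in[OF that]
    by (cases s) (simp_all add: doubling_def doubling_family_def full_comult_hom(2) full_aut_hom(2) tm linear_on_zero[OF \<Delta>0 C0] C0)
  ultimately show ?thesis by (simp only: D.is_coproduct_def) blast
qed

text \<open>
  The columns at the neutral element provide dual matrix positions for the regular representation.
\<close>

lemma DG_coaction_exists: "\<exists>\<alpha>. D.is_coaction \<alpha>"
proof -
  have "\<exists>f. linear_on UNIV f \<and> (\<forall>g\<in>carrier G. f (L g)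
     = L g \<boxtimes> doubling_family True g + L (\<theta> g) \<boxtimes> doubling_family False (\<theta> g))"
    by (rule linear_extension[OF finite_carrier, of "L" "\<lambda>g. g" "\<lambda>_. \<one>"])
      (auto simp: reg_unitary_coeff)
  then show ?thesis unfolding D.is_coaction_def using linear_on_mono[OF _ subset_UNIV] by blast
qed

lemma D_linear_extension:
  fixes w :: "bool \<Rightarrow> 'a \<Rightarrow> 'j opr"
  shows "\<exists>f. linear_on UNIV f \<and> (\<forall>s. \<forall>g\<in>carrier G. f (doubling_family s g) = w s g)"
proof -
  obtain q q0 where dual: "\<And>g h. g \<in> carrier G \<Longrightarrow> h \<in> carrier G \<Longrightarrow> F g (q h) q0 = (if g = h then 1 else 0)"
    using full_unitary_dual_positions[OF finite_carrier] by blast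
  let ?in = "\<lambda>s. if s then Inl else Inr"
  have "\<exists>f. linear_on UNIV f \<and> (\<forall>k\<in>UNIV \<times> carrier G. f (case k of (s, g) \<Rightarrow> doubling_family s g) = (case k of (s, g) \<Rightarrow> w s g))"
  proof (rule linear_extension)
    show "finite (UNIV \<times> carrier G :: (bool \<times> 'a) set)" using finite_carrier by simp
    show "(case l of (s, g) \<Rightarrow> doubling_family s g) (case k of (s, g) \<Rightarrow> ?in s (q g)) (case k of (s, g) \<Rightarrow> ?in s q0)
       = (if k = l then 1 else 0)"
      if "k \<in> UNIV \<times> carrier G" "l \<in> UNIV \<times> carrier G" for k l
      using that by (cases k; cases l) (auto simp: doubling_family_def dsum_inl_def dsum_inr_def dual)
  qed
  then show ?thesis by fastforce
qed

lemma DG_record: "DG = \<lparr>alg = D.W, comult = comult DG\<rparr>"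
  using DG_alg by (metis cqg.surjective old.unit.exhaust)

end

lemma cqg_morphismI: "unital_star_hom (alg Q) (alg R) \<phi> \<Longrightarrow>
    (\<And>x. x \<in> alg Q \<Longrightarrow> comult R (\<phi> x) = tensor_map \<phi> \<phi> (comult Q x)) \<Longrightarrow> cqg_morphism Q R \<phi>"
  by (simp add: cqg_morphism_def)

lemma linear_on_image:
  assumes "linear_on (op_span B) f" "\<And>x. x \<in> B \<Longrightarrow> f x \<in> V" "op_subspace V" "x \<in> op_span B"
  shows "f x \<in> V"
proof -
  have "x \<in> op_span B \<and> f x \<in> V" using assms(4)
    by (rule op_span_induct[where P="\<lambda>x. x \<in> op_span B \<and> f x \<in> V"])
      (auto simp: linear_onD[OF assms(1)] assms(2) op.span_zero op.span_base op.span_add op.span_scale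
        linear_on_zero[OF assms(1)] op.subspace_0[OF assms(3)] op.subspace_add[OF assms(3)] op.subspace_scale[OF assms(3)])
  then show ?thesis ..
qed

context polyhedral_flip
begin

lemma theta_moves_b: "\<theta> b \<noteq> b"
  using short_words_distinct by (auto simp: theta_b inv_b)

lemma DG_object:
  assumes "D.is_coaction \<alpha>" shows "qiso_object G S DG \<alpha>"
  by (subst DG_record) (rule D.is_qiso_object[OF DG_coproduct assms word_length_theta])

lemma morphism_determined:
  fixes Q :: "'i cqg" and R :: "'j cqg"
  assumes T: "doubled_family G \<theta> T" "\<And>s g. g \<in> carrier G \<Longrightarrow> T s g \<in> alg Q" "doubled_family.is_coaction G \<theta> T \<alpha>"
    and T': "doubled_family G \<theta> T'" "doubled_family.is_coaction G \<theta> T' \<beta>"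
    and bd: "\<And>x. x \<in> alg R \<Longrightarrow> bounded_op x" and Q: "op_subspace (alg Q)"
    and \<psi>: "qiso_morphism G Q \<alpha> R \<beta> \<psi>" and g: "g \<in> carrier G"
  shows "\<psi> (T s g) = T' s g"
proof -
  interpret T: doubled_family G \<theta> T by (rule T)
  interpret T': doubled_family G \<theta> T' by (rule T')
  have hom: "unital_star_hom (alg Q) (alg R) \<psi>" and int: "\<And>x. x \<in> reduced_cstar G \<Longrightarrow> \<beta> x = id_tensor \<psi> (\<alpha> x)"
    using \<psi> by (auto simp: qiso_morphism_def cqg_morphism_def)
  have lin: "linear_on (alg Q) \<psi>" by (rule star_hom_linear[OF hom])
  show ?thesis
  proof (rule family_determined[OF T(1) T'(1) ab_closed(2) theta_moves_b _ _ _ _ g])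
    show "\<psi> 0 = 0" by (rule linear_on_zero[OF lin op.subspace_0[OF Q]])
    show "bounded_op (\<psi> (T s g))" if "g \<in> carrier G" for s g
      using bd hom T(2)[OF that] by (auto simp: unital_star_hom_def)
    show "\<psi> (T s g \<star> T s' h) = \<psi> (T s g) \<star> \<psi> (T s' h)" if "g \<in> carrier G" "h \<in> carrier G" for s s' g h
      using hom T(2)[OF that(1)] T(2)[OF that(2)] unfolding unital_star_hom_def by blast
    show "L g \<boxtimes> T' True g + L (\<theta> g) \<boxtimes> T' False (\<theta> g)
       = L g \<boxtimes> \<psi> (T True g) + L (\<theta> g) \<boxtimes> \<psi> (T False (\<theta> g))" (is "?l = ?r")
      if g: "g \<in> carrier G" for g
    proof -
      have "?l = \<beta> (L g)" using T'(2) g by (simp add: T'.is_coaction_def)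
      also have "\<dots> = id_tensor \<psi> (\<alpha> (L g))"
        using g by (intro int) (auto simp: T.reduced intro: op.span_base)
      also have "\<dots> = id_tensor \<psi> (L g \<boxtimes> T True g + L (\<theta> g) \<boxtimes> T False (\<theta> g))"
        using T(3) g by (simp add: T.is_coaction_def)
      also have "\<dots> = ?r"
        using g by (simp add: id_tensor_linear[OF lin] right_in_intros[OF Q] T(2))
      finally show ?thesis .
    qed
  qed
qed

text \<open>
  An arbitrary object contains a doubled family, and the doubling is the free one: its family is
  linearly independent, so there is exactly one linear map that matches the two families.
\<close>

theorem DG_universal:
  assumes \<alpha>: "D.is_coaction \<alpha>"
  shows "quantum_isometry_group TYPE('u) G S DG \<alpha>"
  unfolding quantum_isometry_group_def
proof (intro conjI allI impI)
  show "qiso_object G S DG \<alpha>" by (rule DG_object[OF \<alpha>])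
  fix R :: "'u cqg" and \<beta> assume obj: "qiso_object G S R \<beta>"
  interpret A: polyhedral_action G a b m \<theta> R \<beta> by unfold_locales (rule obj)
  obtain T where T: "doubled_family G \<theta> T" "\<And>s g. g \<in> carrier G \<Longrightarrow> T s g \<in> alg R"
     "T True \<one> + T False \<one> = unit_of (alg R)"
    and cop: "doubled_family.is_coproduct G \<theta> T (comult R)" and coa: "doubled_family.is_coaction G \<theta> T \<beta>"
    using A.doubled_family_exists by blast
  interpret T: doubled_family G \<theta> T by (rule T)
  obtain \<phi> where \<phi>: "linear_on UNIV \<phi>" "\<And>s g. g \<in> carrier G \<Longrightarrow> \<phi> (doubling_family s g) = T s g"
    using D_linear_extension[of T] by blast
  have lin: "linear_on V \<phi>" for V by (rule linear_on_mono[OF \<phi>(1) subset_UNIV])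
  have \<phi>0: "\<phi> 0 = 0" by (rule linear_on_zero[OF \<phi>(1)]) simp
  have \<phi>W: "\<phi> x \<in> T.W" if "x \<in> D.W" for x
    by (rule linear_on_image[OF lin _ op.subspace_span that]) (auto simp: D.basis_def \<phi>(2))
  have D\<Delta>: "linear_on D.W (comult DG)" by (rule D.\<Delta>_linear[OF DG_coproduct])
  have T\<Delta>: "linear_on T.W (comult R)" by (rule T.\<Delta>_linear[OF cop])
  have hom: "unital_star_hom D.W (alg R) \<phi>"
  proof (rule D.W.star_homI[OF lin A.R_subspace])
    show "\<phi> D.e = unit_of (alg R)" by (simp add: linear_onD[OF \<phi>(1)] \<phi>(2) T(3))
    fix x assume "x \<in> D.basis"
    then obtain s g where x: "x = doubling_family s g" "g \<in> carrier G" by (auto simp: D.basis_def)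
    show "\<phi> x \<in> alg R" "bounded_op (\<phi> x)" "\<phi> (op_adj x) = op_adj (\<phi> x)" using x T(2) by (simp_all add: \<phi>(2))
    fix y assume "y \<in> D.basis"
    then obtain s' h where y: "y = doubling_family s' h" "h \<in> carrier G" by (auto simp: D.basis_def)
    show "\<phi> (x \<star> y) = \<phi> x \<star> \<phi> y" using x y by (simp add: \<phi>(2) \<phi>0)
  qed
  have com: "comult R (\<phi> x) = tensor_map \<phi> \<phi> (comult DG x)" if "x \<in> D.W" for x
  proof (rule linear_on_eq[OF _ _ _ that, of "\<lambda>x. comult R (\<phi> x)" "\<lambda>x. tensor_map \<phi> \<phi> (comult DG x)"])
    show "linear_on D.W (\<lambda>x. comult R (\<phi> x))"
      by (simp add: linear_on_def linear_onD[OF \<phi>(1)] linear_onD[OF T\<Delta>] \<phi>W)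
    show "linear_on D.W (\<lambda>x. tensor_map \<phi> \<phi> (comult DG x))"
      by (simp add: linear_on_def linear_onD[OF D\<Delta>] tensor_map_linear[OF \<phi>(1) \<phi>(1)] right_in_def)
    fix x assume "x \<in> D.basis"
    then obtain s g where x: "x = doubling_family s g" "g \<in> carrier G" by (auto simp: D.basis_def)
    then show "comult R (\<phi> x) = tensor_map \<phi> \<phi> (comult DG x)"
      by (simp add: \<phi>(2) T.\<Delta>_T[OF cop] D.\<Delta>_T[OF DG_coproduct] tensor_map_linear[OF \<phi>(1) \<phi>(1)] right_in_def)
  qed
  have int: "\<beta> x = id_tensor \<phi> (\<alpha> x)" if "x \<in> reduced_cstar G" for x
  proof (rule linear_on_eq[OF _ _ _ that[unfolded D.reduced], of \<beta> "\<lambda>x. id_tensor \<phi> (\<alpha> x)"])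
    show "linear_on LG \<beta>" by (rule T.\<alpha>_linear[OF cop coa])
    show "linear_on LG (\<lambda>x. id_tensor \<phi> (\<alpha> x))"
      using D.\<alpha>_linear[OF DG_coproduct \<alpha>]
      by (auto simp: linear_on_def id_tensor_linear[OF \<phi>(1)] right_in_def)
    fix x assume "x \<in> L ` carrier G"
    then obtain g where x: "x = L g" "g \<in> carrier G" by auto
    then show "\<beta> x = id_tensor \<phi> (\<alpha> x)"
      by (simp add: \<phi>(2) T.\<alpha>_L[OF cop coa] D.\<alpha>_L[OF DG_coproduct \<alpha>] id_tensor_linear[OF \<phi>(1)] right_in_def)
  qed
  have mor: "qiso_morphism G DG \<alpha> R \<beta> \<phi>"
    unfolding qiso_morphism_def using cqg_morphismI[of DG R \<phi>] hom com int by (simp add: DG_alg)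
  show "\<exists>\<phi>. qiso_morphism G DG \<alpha> R \<beta> \<phi> \<and>
      (\<forall>\<psi>. qiso_morphism G DG \<alpha> R \<beta> \<psi> \<longrightarrow> (\<forall>x\<in>alg DG. \<psi> x = \<phi> x))"
  proof (intro exI[of _ \<phi>] conjI allI impI ballI, rule mor)
    fix \<psi> x assume \<psi>: "qiso_morphism G DG \<alpha> R \<beta> \<psi>" and x: "x \<in> alg DG"
    have lin\<psi>: "linear_on D.W \<psi>"
      using \<psi> star_hom_linear unfolding qiso_morphism_def cqg_morphism_def DG_alg by blast
    show "\<psi> x = \<phi> x"
    proof (rule linear_on_eq[OF lin\<psi> lin _ x[unfolded DG_alg]])
      fix y assume "y \<in> D.basis"
      then obtain s g where y: "y = doubling_family s g" "g \<in> carrier G" by (auto simp: D.basis_def)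
      have "\<psi> (doubling_family s g) = T s g"
        by (rule morphism_determined[OF D.doubled_family_axioms _ \<alpha> T(1) coa _ _ \<psi> y(2)])
          (use op.subspace_span in \<open>auto simp: DG_alg\<close>)
      then show "\<psi> y = \<phi> y" using y by (simp add: \<phi>(2))
    qed
  qed
qed

text \<open>
  Let \<open>T\<close> be the doubled family of a universal object $Q$. Its span, with the same coproduct and
  action, is again an object over the same index type, so there is a morphism $\chi$ from $Q$ to it. Followed
  by the inclusion, $\chi$ is an endomorphism of $(Q, \alpha)$ and thus the identity by
  uniqueness. Therefore $Q$ is spanned by \<open>T\<close>, and the morphism to the doubling, which sends \<open>T\<close> to
  a linearly independent family, is bijective. The detour through $\chi$ avoids composing morphisms:
  on an infinite-dimensional algebra, functoriality of \<open>tensor_map\<close> would rest on the continuity of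
  homomorphisms.
\<close>

theorem universal_object_isomorphic:
  fixes Q :: "'u cqg"
  assumes Q: "quantum_isometry_group TYPE('u) G S Q \<alpha>"
    and QD: "quantum_isometry_group TYPE('g full_index + 'g full_index) G S Q \<alpha>"
  shows "Q \<cong>\<^sub>q DG"
proof -
  have obj: "qiso_object G S Q \<alpha>" using Q by (simp add: quantum_isometry_group_def)
  interpret A: polyhedral_action G a b m \<theta> Q \<alpha> by unfold_locales (rule obj)
  obtain T where T: "doubled_family G \<theta> T" "\<And>s g. g \<in> carrier G \<Longrightarrow> T s g \<in> alg Q"
     "T True \<one> + T False \<one> = unit_of (alg Q)"
    and cop: "doubled_family.is_coproduct G \<theta> T (comult Q)" and coa: "doubled_family.is_coaction G \<theta> T \<alpha>"
    using A.doubled_family_exists by blast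
  interpret T: doubled_family G \<theta> T by (rule T)
  have W: "T.W \<subseteq> alg Q"
    by (rule op.span_minimal) (auto simp: T.basis_def A.R_subspace T(2))
  let ?Q' = "\<lparr>alg = T.W, comult = comult Q\<rparr>"
  have "qiso_object G S ?Q' \<alpha>" by (rule T.is_qiso_object[OF cop coa word_length_theta])
  then obtain \<chi> where \<chi>: "qiso_morphism G Q \<alpha> ?Q' \<alpha> \<chi>"
    using Q unfolding quantum_isometry_group_def by blast
  have \<chi>W: "\<chi> x \<in> T.W" if "x \<in> alg Q" for x
    using \<chi> that by (simp add: qiso_morphism_def cqg_morphism_def unital_star_hom_def)
  have \<chi>Q: "qiso_morphism G Q \<alpha> Q \<alpha> \<chi>"
    using \<chi> W T(3) by (auto simp: qiso_morphism_def cqg_morphism_def unital_star_hom_def T.W.unit_of_span)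
  have idQ: "qiso_morphism G Q \<alpha> Q \<alpha> (\<lambda>x. x)"
    by (auto simp: qiso_morphism_def cqg_morphism_def unital_star_hom_def tensor_map_def tensor_id_def id_tensor_def
      left_block_def right_block_def fun_eq_iff)
  have "\<exists>\<phi>. \<forall>\<psi>. qiso_morphism G Q \<alpha> Q \<alpha> \<psi> \<longrightarrow> (\<forall>x\<in>alg Q. \<psi> x = \<phi> x)"
    using Q obj unfolding quantum_isometry_group_def by blast
  with \<chi>Q idQ have "\<chi> x = x" if "x \<in> alg Q" for x using that by metis
  with \<chi>W W have algQ: "alg Q = T.W" by auto
  obtain \<beta> where \<beta>: "D.is_coaction \<beta>" using DG_coaction_exists by blast
  obtain \<phi> where \<phi>: "qiso_morphism G Q \<alpha> DG \<beta> \<phi>"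
    using QD DG_object[OF \<beta>] unfolding quantum_isometry_group_def by blast
  have mor: "cqg_morphism Q DG \<phi>" using \<phi> by (simp add: qiso_morphism_def)
  have lin: "linear_on T.W \<phi>"
    using mor star_hom_linear unfolding cqg_morphism_def algQ by blast
  have \<phi>T: "\<phi> (T s g) = doubling_family s g" if "g \<in> carrier G" for s g
    by (rule morphism_determined[OF T(1,2) coa D.doubled_family_axioms \<beta> _ A.R_subspace \<phi> that])
      (auto simp: DG_alg intro: D.W.span_bounded)
  obtain \<rho> where \<rho>: "linear_on UNIV \<rho>" "\<And>s g. g \<in> carrier G \<Longrightarrow> \<rho> (doubling_family s g) = T s g"
    using D_linear_extension[of T] by blast
  have lin\<rho>: "linear_on V \<rho>" for V by (rule linear_on_mono[OF \<rho>(1) subset_UNIV])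
  have \<phi>W: "\<phi> x \<in> D.W" if "x \<in> T.W" for x
    by (rule linear_on_image[OF lin _ op.subspace_span that]) (auto simp: T.basis_def \<phi>T)
  have \<rho>W: "\<rho> x \<in> T.W" if "x \<in> D.W" for x
    by (rule linear_on_image[OF lin\<rho> _ op.subspace_span that]) (auto simp: D.basis_def \<rho>(2))
  have "\<rho> (\<phi> x) = x" if "x \<in> T.W" for x
    by (rule linear_on_eq[OF _ _ _ that, of "\<lambda>x. \<rho> (\<phi> x)" "\<lambda>x. x"])
      (auto simp: linear_on_def linear_onD[OF lin] linear_onD[OF \<rho>(1)] T.basis_def \<phi>T \<rho>(2))
  moreover have "\<phi> (\<rho> y) = y" if "y \<in> D.W" for y
    by (rule linear_on_eq[OF _ _ _ that, of "\<lambda>y. \<phi> (\<rho> y)" "\<lambda>y. y"])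
      (auto simp: linear_on_def linear_onD[OF lin] linear_onD[OF \<rho>(1)] \<rho>W D.basis_def \<phi>T \<rho>(2))
  ultimately have "bij_betw \<phi> T.W D.W"
    using \<phi>W \<rho>W by (intro bij_betw_byWitness[where f'=\<rho>]) auto
  then show ?thesis unfolding cqg_isomorphic_def using mor by (auto simp: algQ DG_alg)
qed

end

theorem theorem5p4:
  fixes G :: "('g, 'x) monoid_scheme" and a b :: 'g and \<theta> :: "'g \<Rightarrow> 'g" and m :: nat
  assumes "m \<in> {3, 4, 5}"
    and "has_presentation G (case_gen a b) (polyhedral_relators m)"
    and "\<theta> \<in> iso G G" and "\<theta> a = a" and "\<theta> b = inv\<^bsub>G\<^esub> b"
  shows "(\<exists>\<alpha>. quantum_isometry_group TYPE('u) G {a, b, inv\<^bsub>G\<^esub> b}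
                 (doubling (full_cqg G) (full_aut G \<theta>)) \<alpha> \<and>
              quantum_isometry_group TYPE('g full_index + 'g full_index) G {a, b, inv\<^bsub>G\<^esub> b}
                 (doubling (full_cqg G) (full_aut G \<theta>)) \<alpha>) \<and>
         (\<forall>(Q :: 'u cqg) \<alpha>.
            quantum_isometry_group TYPE('u) G {a, b, inv\<^bsub>G\<^esub> b} Q \<alpha> \<and>
            quantum_isometry_group TYPE('g full_index + 'g full_index) G {a, b, inv\<^bsub>G\<^esub> b} Q \<alpha>
            \<longrightarrow> Q \<cong>\<^sub>q doubling (full_cqg G) (full_aut G \<theta>))"
proof -
  have "group G" using assms(2) by (simp add: has_presentation_def)
  then interpret polyhedral_flip G a b m \<theta>
    using assms by (simp add: polyhedral_flip_def polyhedral_def polyhedral_axioms_def polyhedral_flip_axioms_def)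
  obtain \<alpha> where \<alpha>: "D.is_coaction \<alpha>" using DG_coaction_exists by blast
  show ?thesis
    by (intro conjI allI impI exI[of _ \<alpha>] DG_universal[OF \<alpha>]; elim conjE; rule universal_object_isomorphic)
qed

end
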